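(* Let $R$ be a weakly reduced local ring of dimension $d>1$ and let $M$ be an $R$-module of finite length and of infinite projective dimension. Then $\operatorname{Supp}(\operatorname{Syz}_i(M))=\operatorname{Spec}(R)$ for all $i>0$.
   Context: Rings are commutative and noetherian. A ring is called weakly reduced if it is a quotient $S/I$ of a (noetherian) local ring $S$ by a nonzero, integrally closed ideal $I$. For a finitely generated module $M$ over a local ring $R$, let $\cdots\to R^{\beta_{i+1}}\xrightarrow{f_{i+1}}R^{\beta_i}\xrightarrow{f_i}\cdots\to R^{\beta_0}\xrightarrow{f_0}M\to 0$ be the minimal free resolution. For $i>0$, $\operatorname{Syz}_i(M):=\operatorname{coker}(f_{i+1})=\ker(f_{i-1})$ is the $i$-th syzygy module. *)

theory Defs
  imports "HOL-Algebra.Algebra" "HOL-Library.Extended_Nat"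
begin

section \<open>Local rings, spectrum, dimension\<close>

definition noetherian_local_ring :: "('a, 'k) ring_scheme \<Rightarrow> bool" where
  "noetherian_local_ring R \<longleftrightarrow>
     cring R \<and> noetherian_ring R \<and> (\<exists>!\<mm>. maximalideal \<mm> R)"

text \<open>Meaningful only if there is exactly one maximal ideal.\<close>

definition max_ideal :: "('a, 'k) ring_scheme \<Rightarrow> 'a set" where
  "max_ideal R = (THE \<mm>. maximalideal \<mm> R)"

definition prime_spectrum :: "('a, 'k) ring_scheme \<Rightarrow> 'a set set" where
  "prime_spectrum R = {\<pp>. primeideal \<pp> R}"

definition krull_dim :: "('a, 'k) ring_scheme \<Rightarrow> enat" where
  "krull_dim R = Sup {enat n | n. \<exists>\<pp> :: nat \<Rightarrow> 'a set.
     (\<forall>i\<le>n. \<pp> i \<in> prime_spectrum R) \<and> (\<forall>i<n. \<pp> i \<subset> \<pp> (Suc i))}"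


section \<open>Integrally closed ideals, weakly reduced rings\<close>

primrec ideal_power :: "('a, 'k) ring_scheme \<Rightarrow> 'a set \<Rightarrow> nat \<Rightarrow> 'a set" where
  "ideal_power R I 0 = carrier R"
| "ideal_power R I (Suc n) = I \<cdot>\<^bsub>R\<^esub> ideal_power R I n"

text \<open>The equation of integral dependence is
  \<open>r^n + a\<^sub>1 r^(n-1) + \<dots> + a\<^sub>n = 0\<close> with \<open>a\<^sub>k \<in> I^k\<close>.\<close>

definition integral_over_ideal :: "('a, 'k) ring_scheme \<Rightarrow> 'a set \<Rightarrow> 'a \<Rightarrow> bool" where
  "integral_over_ideal R I r \<longleftrightarrow> r \<in> carrier R \<and>
     (\<exists>n a. n > 0 \<and> (\<forall>k\<in>{1..n}. a k \<in> ideal_power R I k) \<and>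
        r [^]\<^bsub>R\<^esub> n \<oplus>\<^bsub>R\<^esub> (\<Oplus>\<^bsub>R\<^esub>k\<in>{1..n}. a k \<otimes>\<^bsub>R\<^esub> (r [^]\<^bsub>R\<^esub> (n - k))) = \<zero>\<^bsub>R\<^esub>)"

definition integrally_closed_ideal :: "('a, 'k) ring_scheme \<Rightarrow> 'a set \<Rightarrow> bool" where
  "integrally_closed_ideal R I \<longleftrightarrow>
     ideal I R \<and> (\<forall>r. integral_over_ideal R I r \<longrightarrow> r \<in> I)"

text \<open>A formula of HOL cannot quantify over the type of elements of \<open>S\<close>, so that type is a
  parameter. With a type variable in its place, a theorem assuming
  \<open>weakly_reduced TYPE('s) R\<close> covers every ring \<open>S\<close>.\<close>

definition weakly_reduced :: "'s itself \<Rightarrow> ('a, 'k) ring_scheme \<Rightarrow> bool" where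
  "weakly_reduced _ R \<longleftrightarrow> (\<exists>(S :: 's ring) I.
     noetherian_local_ring S \<and> integrally_closed_ideal S I \<and> I \<noteq> {\<zero>\<^bsub>S\<^esub>} \<and>
     R \<simeq> S Quot I)"


section \<open>Modules\<close>

text \<open>Records of type \<^typ>\<open>('a, 'b) module\<close> extend those of rings, so they have fields
  \<open>mult\<close> and \<open>one\<close>. These play no role in the locale \<^locale>\<open>module\<close> and are left
  undefined below.\<close>

definition mod_hom ::
  "('a, 'k) ring_scheme \<Rightarrow> ('a, 'b, 'l) module_scheme \<Rightarrow> ('a, 'c, 'm) module_scheme \<Rightarrow> ('b \<Rightarrow> 'c) set"
where
  "mod_hom R M N = {h \<in> carrier M \<rightarrow> carrier N.
     (\<forall>x\<in>carrier M. \<forall>y\<in>carrier M. h (x \<oplus>\<^bsub>M\<^esub> y) = h x \<oplus>\<^bsub>N\<^esub> h y) \<and>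
     (\<forall>a\<in>carrier R. \<forall>x\<in>carrier M. h (a \<odot>\<^bsub>M\<^esub> x) = a \<odot>\<^bsub>N\<^esub> h x)}"

text \<open>The free module on the set \<open>B\<close>: families with finitely many nonzero entries, extended by zero
  outside \<open>B\<close>. In particular \<open>R^n\<close> is \<open>free_module R {..<n}\<close>.\<close>

definition free_module :: "('a, 'k) ring_scheme \<Rightarrow> 'x set \<Rightarrow> ('a, 'x \<Rightarrow> 'a) module" where
  "free_module R B =
     \<lparr>carrier = {v. (\<forall>x\<in>B. v x \<in> carrier R) \<and> (\<forall>x. x \<notin> B \<longrightarrow> v x = \<zero>\<^bsub>R\<^esub>) \<and>
                    finite {x \<in> B. v x \<noteq> \<zero>\<^bsub>R\<^esub>}},
      monoid.mult = undefined, one = undefined,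
      ring.zero = (\<lambda>x. \<zero>\<^bsub>R\<^esub>), ring.add = (\<lambda>v w x. v x \<oplus>\<^bsub>R\<^esub> w x),
      smult = (\<lambda>a v x. if x \<in> B then a \<otimes>\<^bsub>R\<^esub> v x else \<zero>\<^bsub>R\<^esub>)\<rparr>"

definition quotient_module ::
  "('a, 'b, 'l) module_scheme \<Rightarrow> 'b set \<Rightarrow> ('a, 'b set) module"
where
  "quotient_module M N =
     \<lparr>carrier = a_rcosets\<^bsub>M\<^esub> N,
      monoid.mult = undefined, one = undefined,
      ring.zero = N, ring.add = set_add M,
      smult = (\<lambda>a A. \<Union>x\<in>A. N +>\<^bsub>M\<^esub> (a \<odot>\<^bsub>M\<^esub> x))\<rparr>"

definition module_length :: "('a, 'k) ring_scheme \<Rightarrow> ('a, 'b, 'l) module_scheme \<Rightarrow> enat" where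
  "module_length R M = Sup {enat n | n. \<exists>N :: nat \<Rightarrow> 'b set.
     (\<forall>i\<le>n. submodule (N i) R M) \<and> (\<forall>i<n. N i \<subset> N (Suc i))}"


section \<open>Localization and support\<close>

definition fraction_rel ::
  "'a set \<Rightarrow> ('a, 'b, 'l) module_scheme \<Rightarrow> (('b \<times> 'a) \<times> ('b \<times> 'a)) set"
where
  "fraction_rel T M = {((x, s), (y, t)). x \<in> carrier M \<and> s \<in> T \<and> y \<in> carrier M \<and> t \<in> T \<and>
     (\<exists>u\<in>T. u \<odot>\<^bsub>M\<^esub> (t \<odot>\<^bsub>M\<^esub> x) = u \<odot>\<^bsub>M\<^esub> (s \<odot>\<^bsub>M\<^esub> y))}"

definition fraction ::
  "'a set \<Rightarrow> ('a, 'b, 'l) module_scheme \<Rightarrow> 'b \<Rightarrow> 'a \<Rightarrow> ('b \<times> 'a) set"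
where
  "fraction T M x s = fraction_rel T M `` {(x, s)}"

text \<open>The localization of \<open>M\<close> at the multiplicative set \<open>T\<close>, as an \<open>R\<close>-module.\<close>

definition localization ::
  "('a, 'k) ring_scheme \<Rightarrow> 'a set \<Rightarrow> ('a, 'b, 'l) module_scheme \<Rightarrow> ('a, ('b \<times> 'a) set) module"
where
  "localization R T M =
     \<lparr>carrier = (carrier M \<times> T) // fraction_rel T M,
      monoid.mult = undefined, one = undefined,
      ring.zero = fraction T M \<zero>\<^bsub>M\<^esub> \<one>\<^bsub>R\<^esub>,
      ring.add = (\<lambda>A B. \<Union>(x, s)\<in>A. \<Union>(y, t)\<in>B.
               fraction T M (t \<odot>\<^bsub>M\<^esub> x \<oplus>\<^bsub>M\<^esub> s \<odot>\<^bsub>M\<^esub> y) (s \<otimes>\<^bsub>R\<^esub> t)),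
      smult = (\<lambda>a A. \<Union>(x, s)\<in>A. fraction T M (a \<odot>\<^bsub>M\<^esub> x) s)\<rparr>"

definition module_support :: "('a, 'k) ring_scheme \<Rightarrow> ('a, 'b, 'l) module_scheme \<Rightarrow> 'a set set" where
  "module_support R M = {\<pp> \<in> prime_spectrum R.
     carrier (localization R (carrier R - \<pp>) M) \<noteq> {\<zero>\<^bsub>localization R (carrier R - \<pp>) M\<^esub>}}"


section \<open>Projective dimension\<close>

text \<open>A module is projective iff it is a direct summand of a free module. A basis indexed by
  elements of \<open>P\<close> suffices, since \<open>P\<close> is a quotient of the free module on its
  underlying set; hence the type of \<open>B\<close> is no restriction.\<close>

definition projective_module :: "('a, 'k) ring_scheme \<Rightarrow> ('a, 'p, 'l) module_scheme \<Rightarrow> bool" where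
  "projective_module R P \<longleftrightarrow> module R P \<and>
     (\<exists>(B :: 'p set) \<iota> \<pi>. \<iota> \<in> mod_hom R P (free_module R B) \<and>
        \<pi> \<in> mod_hom R (free_module R B) P \<and> (\<forall>x\<in>carrier P. \<pi> (\<iota> x) = x))"

text \<open>\<open>0 \<rightarrow> P\<^sub>n \<rightarrow> \<dots> \<rightarrow> P\<^sub>1 \<rightarrow> P\<^sub>0 \<rightarrow> M \<rightarrow> 0\<close>, with
  \<open>g i\<close> mapping \<open>P i\<close> to \<open>P (i - 1)\<close> for \<open>i > 0\<close> and \<open>\<epsilon>\<close> mapping
  \<open>P 0\<close> to \<open>M\<close>.\<close>

definition projective_resolution_upto ::
  "('a, 'k) ring_scheme \<Rightarrow> ('a, 'b, 'l) module_scheme \<Rightarrow> nat \<Rightarrow>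
   (nat \<Rightarrow> ('a, 'p) module) \<Rightarrow> (nat \<Rightarrow> 'p \<Rightarrow> 'p) \<Rightarrow> ('p \<Rightarrow> 'b) \<Rightarrow> bool"
where
  "projective_resolution_upto R M n P g \<epsilon> \<longleftrightarrow>
     (\<forall>i. projective_module R (P i)) \<and>
     (\<forall>i>n. carrier (P i) = {\<zero>\<^bsub>P i\<^esub>}) \<and>
     \<epsilon> \<in> mod_hom R (P 0) M \<and>
     (\<forall>i. g (Suc i) \<in> mod_hom R (P (Suc i)) (P i)) \<and>
     \<epsilon> ` carrier (P 0) = carrier M \<and>
     g 1 ` carrier (P 1) = a_kernel (P 0) M \<epsilon> \<and>
     (\<forall>i. g (Suc (Suc i)) ` carrier (P (Suc (Suc i))) = a_kernel (P (Suc i)) (P i) (g (Suc i)))"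

text \<open>The infimum of the lengths of projective resolutions, infinite if no finite one exists. The
  terms are taken with elements in \<^typ>\<open>nat \<Rightarrow> 'a\<close>. For finitely generated \<open>M\<close>
  over a noetherian ring this is the usual projective dimension: if \<open>M\<close> has projective
  dimension at most \<open>n\<close>, it has a resolution by some \<open>R^b\<close> in degrees below \<open>n\<close> and
  a (projective) syzygy module in degree \<open>n\<close>, which for \<open>n > 0\<close> is a submodule of such an
  \<open>R^b\<close> and for \<open>n = 0\<close> is a direct summand of one.\<close>

definition proj_dim :: "('a, 'k) ring_scheme \<Rightarrow> ('a, 'b, 'l) module_scheme \<Rightarrow> enat" where
  "proj_dim R M = Inf {enat n | n.
     \<exists>(P :: nat \<Rightarrow> ('a, nat \<Rightarrow> 'a) module) g \<epsilon>. projective_resolution_upto R M n P g \<epsilon>}"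


section \<open>Minimal free resolutions and syzygies\<close>

text \<open>The resolution consists of the Betti numbers \<open>\<beta>\<close>, of maps \<open>f i\<close> from
  \<open>R^(\<beta> i)\<close> to \<open>R^(\<beta> (i - 1))\<close> for \<open>i > 0\<close>, and of the augmentation \<open>f0\<close> from
  \<open>R^(\<beta> 0)\<close> to \<open>M\<close>, which has a type of its own; \<open>f 0\<close> is not used. The last clause is
  minimality: the image of \<open>f (i + 1)\<close> lies in \<open>\<mm> R^(\<beta> i)\<close>, i.e. the matrices of these
  maps have all their entries in \<open>\<mm>\<close>.\<close>

definition minimal_free_resolution ::
  "('a, 'k) ring_scheme \<Rightarrow> ('a, 'b, 'l) module_scheme \<Rightarrow> (nat \<Rightarrow> nat) \<Rightarrow>
   (nat \<Rightarrow> (nat \<Rightarrow> 'a) \<Rightarrow> (nat \<Rightarrow> 'a)) \<Rightarrow> ((nat \<Rightarrow> 'a) \<Rightarrow> 'b) \<Rightarrow> bool"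
where
  "minimal_free_resolution R M \<beta> f f0 \<longleftrightarrow>
     (let F = (\<lambda>i. free_module R {..<\<beta> i}) in
      f0 \<in> mod_hom R (F 0) M \<and>
      (\<forall>i. f (Suc i) \<in> mod_hom R (F (Suc i)) (F i)) \<and>
      f0 ` carrier (F 0) = carrier M \<and>
      f 1 ` carrier (F 1) = a_kernel (F 0) M f0 \<and>
      (\<forall>i. f (Suc (Suc i)) ` carrier (F (Suc (Suc i))) = a_kernel (F (Suc i)) (F i) (f (Suc i))) \<and>
      (\<forall>i. \<forall>v\<in>carrier (F (Suc i)). \<forall>j<\<beta> i. f (Suc i) v j \<in> max_ideal R))"

text \<open>\<open>coker f\<^sub>i\<^sub>+\<^sub>1\<close>.\<close>

definition syzygy ::
  "('a, 'k) ring_scheme \<Rightarrow> (nat \<Rightarrow> nat) \<Rightarrow> (nat \<Rightarrow> (nat \<Rightarrow> 'a) \<Rightarrow> (nat \<Rightarrow> 'a)) \<Rightarrow> nat \<Rightarrow>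
   ('a, (nat \<Rightarrow> 'a) set) module"
where
  "syzygy R \<beta> f i =
     quotient_module (free_module R {..<\<beta> i})
       (f (Suc i) ` carrier (free_module R {..<\<beta> (Suc i)}))"

end

theory Submission
  imports Defs
begin

text \<open>
  Suppose that \<open>Syz\<^sub>i(M)\<close> vanishes at a prime \<open>p\<close>; if \<open>p\<close> is the maximal ideal, the resolution is
  finite. Otherwise, since \<open>M\<close> vanishes at every nonmaximal prime, the resolution splits
  there, and the rank of \<open>Syz\<^sub>i(M)\<close> at such primes is the alternating sum of
  \<open>\<beta>\<^sub>0, \<dots>, \<beta>\<^bsub>i-1\<^esub>\<close>. This rank is zero at \<open>p\<close>, hence at every nonmaximal prime, so
  \<open>Syz\<^sub>i(M)\<close> has finite length. As it is nonzero and embeds in a free module, there is a socle element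
  \<open>u \<noteq> 0\<close> of \<open>R\<close>. For \<open>j \<ge> 2\<close>, minimality and exactness give
  \<open>u R^\<beta>\<^bsub>j-1\<^esub> \<subseteq> im f\<^sub>j\<close>. If \<open>\<beta>\<^sub>j < \<beta>\<^bsub>j-1\<^esub>\<close>, then lifting to \<open>S\<close> with \<open>R = S/I\<close>
  exhibits \<open>u \<cdot> id\<close> as a matrix of deficient rank plus one with entries in \<open>I\<close>,
  so that a determinant shows \<open>u\<close> to be integral over \<open>I\<close>, i.e. zero in \<open>R\<close>. So
  \<open>\<beta>\<^sub>1 \<le> \<beta>\<^sub>2 \<le> \<dots>\<close>, while \<open>\<beta>\<^sub>0 < \<beta>\<^sub>1\<close> because \<open>dim R > 1\<close>, and the alternating sum cannot vanish.
\<close>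

section \<open>Ideals and elimination\<close>

text \<open>Localizations occur only where the support is unfolded. That the resolution splits at a
  prime \<open>q\<close> is expressed by a homotopy from multiplication by some \<open>c\<close>
  outside \<open>q\<close> to zero, and that the syzygy has rank zero at \<open>q\<close> by the
  values of \<open>f i\<close> having all entries in \<open>q\<close>. Linear algebra over the
  fraction field of \<open>R/q\<close> becomes the search for solutions in \<open>R\<close> that are
  nonzero modulo \<open>q\<close>. The failure at one prime spreads to all other nonmaximal primes
  because the alternating sum does not mention the prime. The inequality between
  \<open>\<beta> 0\<close> and \<open>\<beta> 1\<close> needs its own argument: in degree 0 the
  socle argument would require \<open>u\<close> to kill \<open>M\<close>. There the finite length of
  \<open>M\<close> is used a second time, for a chain of submodules built from two nested nonmaximal
  primes.\<close>

lemma (in noetherian_ring) exists_maximal_ideal_in_family: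
  assumes "\<I> \<noteq> {}" and "\<And>I. I \<in> \<I> \<Longrightarrow> ideal I R"
  obtains J where "J \<in> \<I>" and "\<And>I. I \<in> \<I> \<Longrightarrow> J \<subseteq> I \<Longrightarrow> I = J"
proof -
  have "\<exists>M\<in>\<I>. \<forall>I\<in>\<I>. M \<subseteq> I \<longrightarrow> I = M"
  proof (rule subset_Zorn)
    fix C assume C: "subset.chain \<I> C"
    show "\<exists>U\<in>\<I>. \<forall>I\<in>C. I \<subseteq> U"
    proof (cases "C = {}")
      case True
      then show ?thesis using assms(1) by auto
    next
      case False
      have "subset.chain {I. ideal I R} C"
        using C assms(2) unfolding pred_on.chain_def by auto
      from ideal_chain_is_trivial[OF False this] have "\<Union>C \<in> C" .
      then show ?thesis using C unfolding pred_on.chain_def by (intro bexI[of _ "\<Union>C"]) auto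
    qed
  qed
  then show thesis using that by (elim bexE) simp
qed

lemma (in cring) add_cgenideal_memI:
  assumes "ideal J R" "x \<in> J" "r \<in> carrier R" "a \<in> carrier R"
  shows "x \<oplus> r \<otimes> a \<in> J <+> PIdl a"
  using assms unfolding set_add_def' cgenideal_def by auto

lemma (in cring) add_cgenideal:
  assumes J: "ideal J R" and a: "a \<in> carrier R"
  shows "ideal (J <+> PIdl a) R" and "J \<subseteq> J <+> PIdl a" and "a \<in> J <+> PIdl a"
    and "z \<in> J <+> PIdl a \<Longrightarrow> \<exists>x\<in>J. \<exists>r\<in>carrier R. z = x \<oplus> r \<otimes> a"
proof -
  show "ideal (J <+> PIdl a) R" by (rule add_ideals[OF J cgenideal_ideal[OF a]])
  have z: "\<zero> \<in> J" and sub: "J \<subseteq> carrier R"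
    using additive_subgroup.zero_closed[OF ideal.axioms(1)[OF J]] ideal.Icarr[OF J] by blast+
  show "J \<subseteq> J <+> PIdl a"
  proof
    fix x assume x: "x \<in> J"
    show "x \<in> J <+> PIdl a" using add_cgenideal_memI[OF J x zero_closed a] sub x a by auto
  qed
  show "a \<in> J <+> PIdl a" using add_cgenideal_memI[OF J z one_closed a] a by simp
  show "z \<in> J <+> PIdl a \<Longrightarrow> \<exists>x\<in>J. \<exists>r\<in>carrier R. z = x \<oplus> r \<otimes> a"
    unfolding set_add_def' cgenideal_def by auto
qed

lemma (in noetherian_ring) exists_prime_disjoint:
  assumes "cring R" and T: "T \<subseteq> carrier R" "\<one> \<in> T" "\<zero> \<notin> T"
    and mult: "\<And>s t. s \<in> T \<Longrightarrow> t \<in> T \<Longrightarrow> s \<otimes> t \<in> T"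
  obtains P where "primeideal P R" "P \<inter> T = {}"
proof -
  interpret cring R by fact
  obtain P where P: "ideal P R" "P \<inter> T = {}"
    and max: "\<And>I. ideal I R \<Longrightarrow> I \<inter> T = {} \<Longrightarrow> P \<subseteq> I \<Longrightarrow> I = P"
  proof (rule exists_maximal_ideal_in_family[of "{I. ideal I R \<and> I \<inter> T = {}}"])
    show "{I. ideal I R \<and> I \<inter> T = {}} \<noteq> {}" using T(3) zeroideal by blast
  qed auto
  interpret P: ideal P R by fact
  have ex: "\<exists>x\<in>P. \<exists>r\<in>carrier R. x \<oplus> r \<otimes> a \<in> T" if a: "a \<in> carrier R" "a \<notin> P" for a
  proof -
    note A = add_cgenideal[OF P(1) a(1)]
    have "(P <+> PIdl a) \<inter> T \<noteq> {}" using max[OF A(1) _ A(2)] A(3) a(2) by auto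
    then show ?thesis using A(4) by blast
  qed
  have "primeideal P R"
  proof (rule primeidealI[OF P(1) is_cring])
    show "carrier R \<noteq> P" using T(2) P(2) by auto
    fix a b assume ab: "a \<in> carrier R" "b \<in> carrier R" "a \<otimes> b \<in> P"
    show "a \<in> P \<or> b \<in> P"
    proof (rule ccontr)
      assume "\<not> (a \<in> P \<or> b \<in> P)"
      then obtain x r y s where *: "x \<in> P" "r \<in> carrier R" "x \<oplus> r \<otimes> a \<in> T"
        "y \<in> P" "s \<in> carrier R" "y \<oplus> s \<otimes> b \<in> T" using ex ab by meson
      have c: "x \<in> carrier R" "y \<in> carrier R" using * by auto
      have "r \<otimes> a \<otimes> (s \<otimes> b) = r \<otimes> s \<otimes> (a \<otimes> b)"
        using * ab(1,2) by (simp add: m_ac)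
      then have "r \<otimes> a \<otimes> (s \<otimes> b) \<in> P" using * ab by (simp add: P.I_l_closed)
      then have "x \<otimes> (y \<oplus> s \<otimes> b) \<oplus> (r \<otimes> a \<otimes> y \<oplus> r \<otimes> a \<otimes> (s \<otimes> b)) \<in> P"
        using c * ab(1,2) by (intro P.a_closed P.I_r_closed[of x] P.I_l_closed[of y]) auto
      also have "x \<otimes> (y \<oplus> s \<otimes> b) \<oplus> (r \<otimes> a \<otimes> y \<oplus> r \<otimes> a \<otimes> (s \<otimes> b))
          = (x \<oplus> r \<otimes> a) \<otimes> (y \<oplus> s \<otimes> b)"
        using c * ab(1,2) l_distr[of x "r \<otimes> a" "y \<oplus> s \<otimes> b"] r_distr[of y "s \<otimes> b" "r \<otimes> a"] by simp
      finally show False using mult[OF *(3,6)] P(2) by blast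
    qed
  qed
  then show thesis using that P(2) by blast
qed

text \<open>An annihilator that is maximal among those of the nonzero multiples of \<open>a\<close>
  is prime. As \<open>b\<close> is such a multiple, every element that kills \<open>a\<close> lies
  in this prime; the socle argument contradicts exactly that.\<close>

lemma (in noetherian_ring) exists_prime_annihilator:
  assumes "cring R" and a: "a \<in> carrier R" "a \<noteq> \<zero>"
  shows "\<exists>b\<in>carrier R. b \<noteq> \<zero> \<and> primeideal {x \<in> carrier R. x \<otimes> b = \<zero>} R \<and>
    (\<forall>x\<in>carrier R. x \<otimes> a = \<zero> \<longrightarrow> x \<otimes> b = \<zero>)"
proof -
  interpret cring R by fact
  define ann where "ann b = {x \<in> carrier R. x \<otimes> b = \<zero>}" for b
  have ann_ideal: "ideal (ann b) R" if "b \<in> carrier R" for b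
  proof (rule idealI[OF ring_axioms])
    show "subgroup (ann b) (add_monoid R)"
      unfolding ann_def using that
      by unfold_locales (auto simp: l_distr a_inv_def[symmetric] l_minus)
    show "x \<otimes> a \<in> ann b" "a \<otimes> x \<in> ann b" if "a \<in> ann b" "x \<in> carrier R" for a x
      using that \<open>b \<in> carrier R\<close> m_lcomm[of a x b] unfolding ann_def by (auto simp: m_assoc)
  qed
  have "ann a \<in> ann ` {t \<otimes> a | t. t \<in> carrier R \<and> t \<otimes> a \<noteq> \<zero>}" using a
    by (intro image_eqI[OF refl]) (auto intro!: exI[of _ \<one>])
  then obtain J where "J \<in> ann ` {t \<otimes> a | t. t \<in> carrier R \<and> t \<otimes> a \<noteq> \<zero>}"
    and max: "\<And>I. I \<in> ann ` {t \<otimes> a | t. t \<in> carrier R \<and> t \<otimes> a \<noteq> \<zero>} \<Longrightarrow> J \<subseteq> I \<Longrightarrow> I = J"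
    using a ann_ideal
    by (elim exists_maximal_ideal_in_family[of "ann ` {t \<otimes> a | t. t \<in> carrier R \<and> t \<otimes> a \<noteq> \<zero>}", rotated 2]) auto
  then obtain t where t: "t \<in> carrier R" "t \<otimes> a \<noteq> \<zero>" "J = ann (t \<otimes> a)" by auto
  define b where "b = t \<otimes> a"
  have b: "b \<in> carrier R" "b \<noteq> \<zero>" using t a by (auto simp: b_def)
  have "primeideal (ann b) R"
  proof (rule primeidealI[OF ann_ideal[OF b(1)] is_cring])
    have "\<one> \<notin> ann b" using b by (auto simp: ann_def)
    then show "carrier R \<noteq> ann b" by auto
    fix x y assume xy: "x \<in> carrier R" "y \<in> carrier R" "x \<otimes> y \<in> ann b"
    show "x \<in> ann b \<or> y \<in> ann b"
    proof (cases "y \<otimes> b = \<zero>")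
      case True
      then show ?thesis using xy by (auto simp: ann_def)
    next
      case False
      \<comment> \<open>Multiples of \<open>b\<close> are multiples of \<open>a\<close>, so
        maximality applies to \<open>y \<otimes> b\<close> and no element outside
        \<open>ann b\<close> can kill it.\<close>
      have "ann (y \<otimes> b) = J"
      proof (rule max)
        show "ann (y \<otimes> b) \<in> ann ` {t \<otimes> a | t. t \<in> carrier R \<and> t \<otimes> a \<noteq> \<zero>}"
          using False xy t a by (auto simp: b_def m_assoc[symmetric])
        have "z \<otimes> (y \<otimes> b) = \<zero>" if "z \<in> carrier R" "z \<otimes> b = \<zero>" for z
          using m_lcomm[OF that(1) xy(2) b(1)] that xy by simp
        then show "J \<subseteq> ann (y \<otimes> b)" using t(3) unfolding b_def[symmetric] ann_def by auto
      qed
      moreover have "x \<in> ann (y \<otimes> b)" using xy b by (auto simp: ann_def m_assoc)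
      ultimately show ?thesis using t(3) b_def by auto
    qed
  qed
  moreover have "x \<otimes> b = \<zero>" if "x \<in> carrier R" "x \<otimes> a = \<zero>" for x
    using that t a by (auto simp: b_def m_lcomm)
  ultimately show ?thesis using b unfolding ann_def by blast
qed

text \<open>The algebra of one elimination step with pivot \<open>d\<close> and last variable
  \<open>w\<close>: the action of a cross-multiplied coefficient, the combination of two complete
  rows, in which the terms with \<open>w\<close> cancel, and the back substitution.\<close>

lemma (in cring) elimination_identities:
  assumes "d \<in> carrier R" "x \<in> carrier R" "y \<in> carrier R" "z \<in> carrier R" "w \<in> carrier R"
  shows "(d \<otimes> x \<ominus> y \<otimes> z) \<otimes> w = d \<otimes> (x \<otimes> w) \<oplus> (\<ominus> y) \<otimes> (z \<otimes> w)"
    and "d \<otimes> x \<oplus> (\<ominus> y) \<otimes> z = d \<otimes> (x \<oplus> y \<otimes> w) \<ominus> y \<otimes> (z \<oplus> d \<otimes> w)"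
    and "x \<otimes> (y \<oplus> d \<otimes> w) \<ominus> x \<otimes> y = (x \<otimes> d) \<otimes> w"
proof -
  show "(d \<otimes> x \<ominus> y \<otimes> z) \<otimes> w = d \<otimes> (x \<otimes> w) \<oplus> (\<ominus> y) \<otimes> (z \<otimes> w)"
    using assms by (simp add: a_minus_def l_distr l_minus m_assoc)
  have cancel: "a \<oplus> \<ominus> b = (a \<oplus> p) \<ominus> (b \<oplus> p)"
    if "a \<in> carrier R" "b \<in> carrier R" "p \<in> carrier R" for a b p
  proof -
    have "(a \<oplus> p) \<ominus> (b \<oplus> p) = a \<oplus> (\<ominus> b \<oplus> (p \<oplus> \<ominus> p))"
      using that by (simp only: a_minus_def minus_add a_closed a_inv_closed a_assoc a_lcomm)
    then show ?thesis using that by (simp add: r_neg)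
  qed
  show "d \<otimes> x \<oplus> (\<ominus> y) \<otimes> z = d \<otimes> (x \<oplus> y \<otimes> w) \<ominus> y \<otimes> (z \<oplus> d \<otimes> w)"
    using assms cancel[of "d \<otimes> x" "y \<otimes> z" "d \<otimes> (y \<otimes> w)"]
    by (simp add: r_distr l_minus m_lcomm[of y d w])
  have "p \<oplus> q \<ominus> p = q" if "p \<in> carrier R" "q \<in> carrier R" for p q
    using that by (simp add: a_minus_def a_comm[of p q] a_assoc r_neg)
  from this[of "x \<otimes> y" "x \<otimes> d \<otimes> w"] show "x \<otimes> (y \<oplus> d \<otimes> w) \<ominus> x \<otimes> y = (x \<otimes> d) \<otimes> w"
    using assms by (simp add: r_distr m_assoc)
qed

text \<open>Division-free elimination for a system with diagonal coefficients in \<open>T n\<close> and off-diagonal ones in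
  \<open>H n\<close>; clearing a variable by cross-multiplication doubles the degree \<open>n\<close>. In place of
  Cramer's rule, this serves both Nakayama's lemma at a prime and equations of integral dependence.\<close>

lemma (in cring) elimination:
  fixes T H :: "nat \<Rightarrow> 'a set" and w :: "nat \<Rightarrow> 'a"
  assumes P: "ideal P R"
    and T: "\<And>n. T n \<subseteq> carrier R" and H: "\<And>n. H n \<subseteq> carrier R"
    and TT: "\<And>n s t x y. \<lbrakk>s \<in> T n; t \<in> T n; x \<in> H n; y \<in> H n\<rbrakk> \<Longrightarrow> s \<otimes> t \<ominus> x \<otimes> y \<in> T (n + n)"
    and TH: "\<And>n t x y z. \<lbrakk>t \<in> T n; x \<in> H n; y \<in> H n; z \<in> H n\<rbrakk> \<Longrightarrow> t \<otimes> x \<ominus> y \<otimes> z \<in> H (n + n)"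
    and mult: "\<And>m n s t. s \<in> T m \<Longrightarrow> t \<in> T n \<Longrightarrow> \<exists>k. s \<otimes> t \<in> T k"
    and one: "\<exists>n. \<one> \<in> T n"
    and w: "\<And>i. i < b \<Longrightarrow> w i \<in> carrier R"
    and diag: "\<And>i. i < b \<Longrightarrow> A i i \<in> T n"
    and offdiag: "\<And>i j. i < b \<Longrightarrow> j < b \<Longrightarrow> i \<noteq> j \<Longrightarrow> A i j \<in> H n"
    and rel: "\<And>i. i < b \<Longrightarrow> (\<Oplus>j\<in>{..<b}. A i j \<otimes> w j) \<in> P"
  shows "\<exists>k. \<exists>t\<in>T k. \<forall>i<b. t \<otimes> w i \<in> P"
  using w diag offdiag rel
proof (induction b arbitrary: A n)
  case 0
  then show ?case using one by auto
next
  case (Suc b)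
  interpret P: ideal P R by fact
  have Ac: "A i j \<in> carrier R" if "i < Suc b" "j < Suc b" for i j
    using that Suc.prems(2,3) T H by (cases "i = j") blast+
  define d where "d = A b b"
  have dT: "d \<in> T n" and dc: "d \<in> carrier R" using Suc.prems(2) Ac by (auto simp: d_def)
  define A' where "A' i j = d \<otimes> A i j \<ominus> A i b \<otimes> A b j" for i j
  define S where "S i = (\<Oplus>j\<in>{..<b}. A i j \<otimes> w j)" for i
  have Sc: "S i \<in> carrier R" if "i < Suc b" for i
    unfolding S_def using Ac that Suc.prems(1) by (intro finsum_closed) auto
  have split: "(\<Oplus>j\<in>{..<Suc b}. A i j \<otimes> w j) = S i \<oplus> A i b \<otimes> w b" if "i < Suc b" for i
    unfolding lessThan_Suc S_def using that Ac Suc.prems(1)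
    by (subst finsum_insert) (auto intro!: a_comm finsum_closed)
  \<comment> \<open>Row \<open>b\<close> eliminates the variable \<open>w b\<close> from the others.
    The new diagonal and off-diagonal entries are the two kinds of minors covered by
    \<open>TT\<close> and \<open>TH\<close>.\<close>
  have "\<exists>k. \<exists>t\<in>T k. \<forall>i<b. t \<otimes> w i \<in> P"
  proof (rule Suc.IH[of A' "n + n"])
    show "w i \<in> carrier R" if "i < b" for i using Suc.prems(1) that by auto
    show "A' i i \<in> T (n + n)" if "i < b" for i
      unfolding A'_def using that Suc.prems(2,3) dT by (intro TT) auto
    show "A' i j \<in> H (n + n)" if "i < b" "j < b" "i \<noteq> j" for i j
      unfolding A'_def using that Suc.prems(2,3) dT by (intro TH) auto
    fix i assume i: "i < b"
    have "(\<Oplus>j\<in>{..<b}. A' i j \<otimes> w j) = (\<Oplus>j\<in>{..<b}. d \<otimes> (A i j \<otimes> w j) \<oplus> (\<ominus> A i b) \<otimes> (A b j \<otimes> w j))"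
    proof (rule finsum_cong'[OF refl])
      fix j assume "j \<in> {..<b}"
      then have c: "A i j \<in> carrier R" "A i b \<in> carrier R" "A b j \<in> carrier R" "w j \<in> carrier R"
        using Ac i Suc.prems(1) by auto
      show "A' i j \<otimes> w j = d \<otimes> (A i j \<otimes> w j) \<oplus> (\<ominus> A i b) \<otimes> (A b j \<otimes> w j)"
        unfolding A'_def using c dc by (intro elimination_identities(1))
    qed (use Ac i Suc.prems(1) dc in auto)
    also have "\<dots> = d \<otimes> S i \<oplus> (\<ominus> A i b) \<otimes> S b"
      unfolding S_def using Ac i Suc.prems(1) dc
      by (subst finsum_addf) (auto simp: finsum_rdistr)
    also have "\<dots> = d \<otimes> (S i \<oplus> A i b \<otimes> w b) \<ominus> A i b \<otimes> (S b \<oplus> d \<otimes> w b)"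
      using Sc[OF less_SucI[OF i]] Sc[OF lessI] Ac[OF less_SucI[OF i] lessI] dc Suc.prems(1)[OF lessI]
      by (intro elimination_identities(2))
    also have "\<dots> \<in> P"
      using Suc.prems(4)[of i] Suc.prems(4)[of b] i split[of i] split[of b] dc Ac[of i b]
      unfolding a_minus_def d_def[symmetric] by (auto intro!: P.a_closed P.I_l_closed P.a_inv_closed)
    finally show "(\<Oplus>j\<in>{..<b}. A' i j \<otimes> w j) \<in> P" .
  qed
  then obtain k t where t: "t \<in> T k" "\<And>i. i < b \<Longrightarrow> t \<otimes> w i \<in> P" by auto
  have tc: "t \<in> carrier R" using t T by auto
  \<comment> \<open>Back substitution: \<open>t\<close> handles all terms of row \<open>b\<close>
    except the last one, so the multiplier for \<open>w b\<close> is \<open>t\<close> times the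
    pivot.\<close>
  have "t \<otimes> S b \<in> P"
  proof -
    have "(\<Oplus>j\<in>B. A b j \<otimes> w j) \<in> carrier R \<and> t \<otimes> (\<Oplus>j\<in>B. A b j \<otimes> w j) \<in> P" if "B \<subseteq> {..<b}" for B
      using finite_subset[OF that finite_lessThan] that
    proof (induction B)
      case empty
      then show ?case using tc by auto
    next
      case (insert j B)
      then have c: "A b j \<in> carrier R" "w j \<in> carrier R" using Ac Suc.prems(1) by auto
      have "(\<Oplus>j\<in>insert j B. A b j \<otimes> w j) = A b j \<otimes> w j \<oplus> (\<Oplus>j\<in>B. A b j \<otimes> w j)"
        using insert Ac Suc.prems(1) by (intro finsum_insert) auto
      moreover have "t \<otimes> (A b j \<otimes> w j \<oplus> (\<Oplus>j\<in>B. A b j \<otimes> w j)) = A b j \<otimes> (t \<otimes> w j) \<oplus> t \<otimes> (\<Oplus>j\<in>B. A b j \<otimes> w j)"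
        using c tc insert by (simp add: r_distr m_lcomm)
      ultimately show ?case using c insert t(2)[of j] by (auto intro!: P.a_closed P.I_l_closed)
    qed
    from this[of "{..<b}"] show ?thesis unfolding S_def by auto
  qed
  moreover have "S b \<oplus> d \<otimes> w b \<in> P" using Suc.prems(4)[of b] split[of b] by (simp add: d_def)
  then have "t \<otimes> (S b \<oplus> d \<otimes> w b) \<in> P" using tc by (rule P.I_l_closed)
  ultimately have "t \<otimes> (S b \<oplus> d \<otimes> w b) \<ominus> t \<otimes> S b \<in> P"
    unfolding a_minus_def by (auto intro!: P.a_closed P.a_inv_closed)
  moreover have "t \<otimes> (S b \<oplus> d \<otimes> w b) \<ominus> t \<otimes> S b = (t \<otimes> d) \<otimes> w b"
    using tc Sc[OF lessI] dc Suc.prems(1)[OF lessI] by (intro elimination_identities(3))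
  ultimately have "(t \<otimes> d) \<otimes> w b \<in> P" by simp
  moreover have "(t \<otimes> d) \<otimes> w i \<in> P" if "i < b" for i
  proof -
    have "(t \<otimes> d) \<otimes> w i = d \<otimes> (t \<otimes> w i)" using tc dc Suc.prems(1)[OF less_SucI[OF that]] by (simp add: m_assoc m_lcomm)
    then show ?thesis using t(2)[OF that] dc by (auto intro: P.I_l_closed)
  qed
  ultimately show ?case using mult[OF t(1) dT] by (auto simp: less_Suc_eq)
qed


section \<open>Free modules and linear systems modulo a prime\<close>

definition unit_vec :: "('a, 'k) ring_scheme \<Rightarrow> 'x \<Rightarrow> 'x \<Rightarrow> 'a" where
  "unit_vec R x = (\<lambda>y. if y = x then \<one>\<^bsub>R\<^esub> else \<zero>\<^bsub>R\<^esub>)"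

lemma free_module_carrier:
  "finite B \<Longrightarrow> v \<in> carrier (free_module R B) \<longleftrightarrow>
    (\<forall>x\<in>B. v x \<in> carrier R) \<and> (\<forall>x. x \<notin> B \<longrightarrow> v x = \<zero>\<^bsub>R\<^esub>)"
  by (simp add: free_module_def)

lemma free_module_outside: "v \<in> carrier (free_module R B) \<Longrightarrow> x \<notin> B \<Longrightarrow> v x = \<zero>\<^bsub>R\<^esub>"
  by (simp add: free_module_def)

lemma free_module_add: "(v \<oplus>\<^bsub>free_module R B\<^esub> w) = (\<lambda>x. v x \<oplus>\<^bsub>R\<^esub> w x)"
  by (simp add: free_module_def)

lemma free_module_zero: "\<zero>\<^bsub>free_module R B\<^esub> = (\<lambda>x. \<zero>\<^bsub>R\<^esub>)"
  by (simp add: free_module_def)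

lemma mod_hom_closed: "h \<in> mod_hom R M N \<Longrightarrow> v \<in> carrier M \<Longrightarrow> h v \<in> carrier N"
  by (auto simp: mod_hom_def)

lemma mod_hom_add:
  "h \<in> mod_hom R M N \<Longrightarrow> v \<in> carrier M \<Longrightarrow> w \<in> carrier M \<Longrightarrow> h (v \<oplus>\<^bsub>M\<^esub> w) = h v \<oplus>\<^bsub>N\<^esub> h w"
  by (auto simp: mod_hom_def)

lemma mod_hom_smult:
  "h \<in> mod_hom R M N \<Longrightarrow> a \<in> carrier R \<Longrightarrow> v \<in> carrier M \<Longrightarrow> h (a \<odot>\<^bsub>M\<^esub> v) = a \<odot>\<^bsub>N\<^esub> h v"
  by (auto simp: mod_hom_def)

context cring
begin

lemma free_module_entry:
  "finite B \<Longrightarrow> v \<in> carrier (free_module R B) \<Longrightarrow> v x \<in> carrier R"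
  by (cases "x \<in> B") (auto simp: free_module_carrier)

lemma free_module_smult:
  assumes "finite B" "v \<in> carrier (free_module R B)" "a \<in> carrier R"
  shows "a \<odot>\<^bsub>free_module R B\<^esub> v = (\<lambda>x. a \<otimes> v x)"
  using assms by (auto simp: free_module_def)

lemma free_module_is_module:
  assumes B: "finite B"
  shows "module R (free_module R B)"
proof (rule moduleI[OF is_cring])
  show "abelian_group (free_module R B)"
  proof (rule abelian_groupI)
    show "\<exists>y\<in>carrier (free_module R B). y \<oplus>\<^bsub>free_module R B\<^esub> v = \<zero>\<^bsub>free_module R B\<^esub>"
      if "v \<in> carrier (free_module R B)" for v
      by (rule bexI[of _ "\<lambda>x. \<ominus> v x"])
        (use that B in \<open>auto simp: free_module_carrier free_module_add free_module_zero
          free_module_entry[OF B] fun_eq_iff l_neg\<close>)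
  qed (use B in \<open>auto simp: free_module_carrier free_module_add free_module_zero fun_eq_iff
        free_module_entry[OF B] intro!: a_assoc a_comm\<close>)
  show "a \<odot>\<^bsub>free_module R B\<^esub> v \<in> carrier (free_module R B)"
    if "a \<in> carrier R" "v \<in> carrier (free_module R B)" for a v
    using that free_module_smult[OF B that(2,1)] B by (auto simp: free_module_carrier)
qed (auto simp: free_module_def fun_eq_iff l_distr r_distr m_assoc)

lemma free_module_closed:
  assumes "finite B" "v \<in> carrier (free_module R B)"
  shows "w \<in> carrier (free_module R B) \<Longrightarrow> (\<lambda>x. v x \<oplus> w x) \<in> carrier (free_module R B)"
    and "a \<in> carrier R \<Longrightarrow> (\<lambda>x. a \<otimes> v x) \<in> carrier (free_module R B)"
  using assms by (auto simp: free_module_carrier)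

lemma unit_vec_closed:
  "finite B \<Longrightarrow> x \<in> B \<Longrightarrow> unit_vec R x \<in> carrier (free_module R B)"
  by (auto simp: free_module_carrier unit_vec_def)

lemma free_homI:
  assumes A: "finite A" and B: "finite B"
    and closed: "\<And>v. v \<in> carrier (free_module R A) \<Longrightarrow> T v \<in> carrier (free_module R B)"
    and add: "\<And>v w y. \<lbrakk>v \<in> carrier (free_module R A); w \<in> carrier (free_module R A)\<rbrakk> \<Longrightarrow>
      T (\<lambda>x. v x \<oplus> w x) y = T v y \<oplus> T w y"
    and smult: "\<And>a v y. \<lbrakk>a \<in> carrier R; v \<in> carrier (free_module R A)\<rbrakk> \<Longrightarrow>
      T (\<lambda>x. a \<otimes> v x) y = a \<otimes> T v y"
  shows "T \<in> mod_hom R (free_module R A) (free_module R B)"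
  unfolding mod_hom_def using closed add
  by (auto simp: free_module_add free_module_smult[OF A] free_module_smult[OF B] smult fun_eq_iff)

lemma free_hom_add:
  assumes "finite A" "finite B" "T \<in> mod_hom R (free_module R A) (free_module R B)"
    "v \<in> carrier (free_module R A)" "w \<in> carrier (free_module R A)"
  shows "T (\<lambda>x. v x \<oplus> w x) y = T v y \<oplus> T w y"
  using mod_hom_add[OF assms(3-5)] by (simp add: free_module_add)

lemma free_hom_smult:
  assumes "finite A" "finite B" "T \<in> mod_hom R (free_module R A) (free_module R B)"
    "a \<in> carrier R" "v \<in> carrier (free_module R A)"
  shows "T (\<lambda>x. a \<otimes> v x) y = a \<otimes> T v y"
  using mod_hom_smult[OF assms(3-5)] assms mod_hom_closed[OF assms(3,5)]
  by (simp add: free_module_smult)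

lemma free_hom_entry:
  assumes "finite B" "T \<in> mod_hom R (free_module R A) (free_module R B)"
    "v \<in> carrier (free_module R A)"
  shows "T v y \<in> carrier R"
  using free_module_entry[OF assms(1) mod_hom_closed[OF assms(2,3)]] .

lemma free_hom_zero:
  assumes "finite A" "finite B" "T \<in> mod_hom R (free_module R A) (free_module R B)"
  shows "T (\<lambda>x. \<zero>) y = \<zero>"
proof -
  have z: "(\<lambda>x. \<zero>) \<in> carrier (free_module R A)" using assms(1) by (auto simp: free_module_carrier)
  show ?thesis
    using free_hom_smult[OF assms zero_closed z, of y] free_hom_entry[OF assms(2,3) z, of y] by simp
qed

lemma free_hom_expand:
  assumes A: "finite A" "finite B" and T: "T \<in> mod_hom R (free_module R A) (free_module R B)"
    and v: "v \<in> carrier (free_module R A)"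
  shows "T v y = (\<Oplus>x\<in>A. v x \<otimes> T (unit_vec R x) y)"
proof -
  have "T (\<lambda>x. if x \<in> C then v x else \<zero>) y = (\<Oplus>x\<in>C. v x \<otimes> T (unit_vec R x) y)" if "C \<subseteq> A" for C
    using finite_subset[OF that A(1)] that
  proof (induction C)
    case empty
    then show ?case using free_hom_zero[OF A T] by simp
  next
    case (insert c C)
    let ?v = "\<lambda>x. if x \<in> C then v x else \<zero>"
    have vc: "v x \<in> carrier R" for x by (rule free_module_entry[OF A(1) v])
    have e: "unit_vec R x \<in> carrier (free_module R A)" if "x \<in> A" for x
      using unit_vec_closed[OF A(1) that] .
    have "c \<in> A" using insert by auto
    have v': "?v \<in> carrier (free_module R A)" using v A insert by (auto simp: free_module_carrier)
    have "(\<lambda>x. if x \<in> insert c C then v x else \<zero>) = (\<lambda>x. v c \<otimes> unit_vec R c x \<oplus> ?v x)"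
      using insert(2) vc by (auto simp: unit_vec_def fun_eq_iff)
    then have "T (\<lambda>x. if x \<in> insert c C then v x else \<zero>) y = T (\<lambda>x. v c \<otimes> unit_vec R c x \<oplus> ?v x) y"
      by simp
    also have "\<dots> = T (\<lambda>x. v c \<otimes> unit_vec R c x) y \<oplus> T ?v y"
      by (rule free_hom_add[OF A T free_module_closed(2)[OF A(1) e[OF \<open>c \<in> A\<close>] vc] v'])
    also have "\<dots> = v c \<otimes> T (unit_vec R c) y \<oplus> (\<Oplus>x\<in>C. v x \<otimes> T (unit_vec R x) y)"
      using free_hom_smult[OF A T vc e[OF \<open>c \<in> A\<close>]] insert by simp
    also have "\<dots> = (\<Oplus>x\<in>insert c C. v x \<otimes> T (unit_vec R x) y)"
      using insert vc e free_hom_entry[OF A(2) T] by (subst finsum_insert) auto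
    finally show ?case .
  qed
  moreover have "(\<lambda>x. if x \<in> A then v x else \<zero>) = v" using v A by (auto simp: free_module_carrier)
  ultimately show ?thesis using order_refl by metis
qed

lemma linear_extension:
  assumes A: "finite A" and B: "finite B" and g: "\<And>x. x \<in> A \<Longrightarrow> g x \<in> carrier (free_module R B)"
  defines "h \<equiv> \<lambda>v y. \<Oplus>x\<in>A. v x \<otimes> g x y"
  shows "h \<in> mod_hom R (free_module R A) (free_module R B)"
    and "x \<in> A \<Longrightarrow> h (unit_vec R x) = g x"
proof -
  have gc: "g x y \<in> carrier R" if "x \<in> A" for x y using free_module_entry[OF B g[OF that]] .
  have gz: "g x y = \<zero>" if "x \<in> A" "y \<notin> B" for x y using g[OF that(1)] that B by (auto simp: free_module_carrier)
  note vc = free_module_entry[OF A]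
  have hc: "h v y \<in> carrier R" if "v \<in> carrier (free_module R A)" for v y
    unfolding h_def using vc[OF that] gc by (intro finsum_closed) auto
  show "h \<in> mod_hom R (free_module R A) (free_module R B)"
  proof (rule free_homI[OF A B])
    fix v assume v: "v \<in> carrier (free_module R A)"
    have "h v y = \<zero>" if "y \<notin> B" for y
    proof -
      have "h v y = (\<Oplus>x\<in>A. \<zero>)"
        unfolding h_def using vc[OF v] gz that by (intro finsum_cong') auto
      then show ?thesis using A by simp
    qed
    then show "h v \<in> carrier (free_module R B)" using B hc[OF v] by (auto simp: free_module_carrier)
    show "h (\<lambda>x. a \<otimes> v x) y = a \<otimes> h v y" if a: "a \<in> carrier R" for a y
    proof -
      have "h (\<lambda>x. a \<otimes> v x) y = (\<Oplus>x\<in>A. a \<otimes> (v x \<otimes> g x y))"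
        unfolding h_def using vc[OF v] gc a by (intro finsum_cong') (auto simp: m_assoc)
      also have "\<dots> = a \<otimes> h v y"
        unfolding h_def using vc[OF v] gc a A by (intro finsum_rdistr[symmetric]) auto
      finally show ?thesis .
    qed
  next
    fix v w y assume vw: "v \<in> carrier (free_module R A)" "w \<in> carrier (free_module R A)"
    have "h (\<lambda>x. v x \<oplus> w x) y = (\<Oplus>x\<in>A. v x \<otimes> g x y \<oplus> w x \<otimes> g x y)"
      unfolding h_def using vc vw gc by (intro finsum_cong') (auto simp: l_distr)
    also have "\<dots> = h v y \<oplus> h w y"
      unfolding h_def using vc vw gc by (intro finsum_addf) auto
    finally show "h (\<lambda>x. v x \<oplus> w x) y = h v y \<oplus> h w y" .
  qed
  assume x: "x \<in> A"
  show "h (unit_vec R x) = g x"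
  proof
    fix y
    have "h (unit_vec R x) y = (\<Oplus>z\<in>A. if x = z then g z y else \<zero>)"
      unfolding h_def unit_vec_def using gc by (intro finsum_cong') auto
    also have "\<dots> = g x y" using finsum_singleton[OF x A, of "\<lambda>z. g z y"] gc by auto
    finally show "h (unit_vec R x) y = g x y" .
  qed
qed

lemma ideal_finsum_closed:
  assumes I: "ideal I R" and f: "\<And>x. x \<in> A \<Longrightarrow> f x \<in> I"
  shows "finsum R f A \<in> I"
proof (cases "finite A")
  case True
  interpret I: ideal I R by fact
  show ?thesis using True f
    by (induction A) (auto intro!: I.a_closed simp: finsum_insert Pi_iff)
next
  case False
  then show ?thesis using additive_subgroup.zero_closed[OF ideal.axioms(1)[OF I]]
    by (simp add: finsum_infinite)
qed

lemma free_hom_mod_ideal: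
  assumes "finite A" "finite B" "T \<in> mod_hom R (free_module R A) (free_module R B)"
    and v: "v \<in> carrier (free_module R A)" and I: "ideal I R" "\<And>x. x \<in> A \<Longrightarrow> v x \<in> I"
  shows "T v y \<in> I"
  unfolding free_hom_expand[OF assms(1-4)]
  using I(2) free_hom_entry[OF assms(2,3) unit_vec_closed[OF assms(1)]]
  by (intro ideal_finsum_closed[OF I(1)] ideal.I_r_closed[OF I(1)])

lemma free_hom_mod_ideal':
  assumes "finite A" "finite B" "T \<in> mod_hom R (free_module R A) (free_module R B)"
    and v: "v \<in> carrier (free_module R A)" and I: "ideal I R"
    and y: "\<And>x. x \<in> A \<Longrightarrow> T (unit_vec R x) y \<in> I"
  shows "T v y \<in> I"
  unfolding free_hom_expand[OF assms(1-4)]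
  using y free_module_entry[OF assms(1) v]
  by (intro ideal_finsum_closed[OF I(1)] ideal.I_l_closed[OF I(1)])

end

text \<open>More unknowns than equations over the fraction field of \<open>R/I\<close>, with
  denominators cleared. Each step removes one equation together with one unknown. Arbitrary finite
  index sets allow deleting an arbitrary pivot column and, later on, indexing by pairs.\<close>

lemma (in primeideal) homogeneous_system:
  assumes "finite A" "finite B" "card B < card A"
    and "T \<in> mod_hom R (free_module R A) (free_module R B)"
  shows "\<exists>v\<in>carrier (free_module R A). (\<exists>x\<in>A. v x \<notin> I) \<and> (\<forall>y\<in>B. T v y \<in> I)"
  using assms(2,1,3,4)
proof (induction B arbitrary: A T)
  case empty
  then obtain a where a: "a \<in> A" by (metis card_gt_0_iff card.empty ex_in_conv)
  have "\<one> \<notin> I" using I_notcarr one_imp_carrier by blast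
  then show ?case using a empty unit_vec_closed[of A a]
    by (intro bexI[of _ "unit_vec R a"]) (auto simp: unit_vec_def intro!: bexI[of _ a])
next
  case (insert b B)
  note A = \<open>finite A\<close> and T = insert.prems(3)
  have fB: "finite (insert b B)" using insert by auto
  \<comment> \<open>Forgetting coordinate \<open>b\<close> of the values gives a system with one
    equation less.\<close>
  have restr: "(\<lambda>v y. if y \<in> B then U v y else \<zero>) \<in> mod_hom R (free_module R C) (free_module R B)"
    if U: "U \<in> mod_hom R (free_module R C) (free_module R (insert b B))" and C: "finite C" for U C
    using free_hom_entry[OF fB U] free_hom_add[OF C fB U] free_hom_smult[OF C fB U] insert(1)
    by (intro free_homI[OF C insert(1)]) (auto simp: free_module_carrier)
  show ?case
  proof (cases "\<forall>x\<in>A. T (unit_vec R x) b \<in> I")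
    case True
    have "card B < card A" using insert by auto
    then obtain v where v: "v \<in> carrier (free_module R A)" "\<exists>x\<in>A. v x \<notin> I"
      "\<forall>y\<in>B. (if y \<in> B then T v y else \<zero>) \<in> I"
      using insert.IH[OF A _ restr[OF T A]] by auto
    moreover have "T v b \<in> I"
      using True by (intro free_hom_mod_ideal'[OF A fB T v(1) ideal_axioms]) auto
    ultimately show ?thesis by auto
  next
    case False
    then obtain a where a: "a \<in> A" "T (unit_vec R a) b \<notin> I" by auto
    define t where "t = T (unit_vec R a) b"
    have e: "unit_vec R a \<in> carrier (free_module R A)" using unit_vec_closed[OF A a(1)] .
    have tc: "t \<in> carrier R" unfolding t_def using free_hom_entry[OF fB T e] .
    define A' where "A' = A - {a}"
    have A': "finite A'" using A by (simp add: A'_def)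
    have sub: "v \<in> carrier (free_module R A)" if "v \<in> carrier (free_module R A')" for v
      using that A by (auto simp: A'_def free_module_carrier)
    \<comment> \<open>For \<open>v\<close> without coordinate \<open>a\<close>, this choice of
      coordinate \<open>a\<close> makes equation \<open>b\<close> hold exactly. The other
      coordinates are multiplied by the pivot \<open>t\<close>, and primality keeps them outside
      \<open>I\<close>.\<close>
    define E where "E v = (\<lambda>x. t \<otimes> v x \<oplus> (\<ominus> T v b) \<otimes> unit_vec R a x)" for v
    have Ec: "E v \<in> carrier (free_module R A)" if "v \<in> carrier (free_module R A)" for v
      unfolding E_def using that e tc free_hom_entry[OF fB T that]
      by (intro free_module_closed[OF A]) auto
    define U where "U v = T (E v)" for v
    have Uy: "U v y = t \<otimes> T v y \<ominus> T v b \<otimes> T (unit_vec R a) y" if v: "v \<in> carrier (free_module R A)" for v y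
    proof -
      have c: "T v z \<in> carrier R" for z using free_hom_entry[OF fB T v] .
      have "U v y = T (\<lambda>x. t \<otimes> v x) y \<oplus> T (\<lambda>x. (\<ominus> T v b) \<otimes> unit_vec R a x) y"
        unfolding U_def E_def
        by (rule free_hom_add[OF A fB T]) (use v e tc c in \<open>auto intro!: free_module_closed(2)[OF A]\<close>)
      also have "\<dots> = t \<otimes> T v y \<oplus> (\<ominus> T v b) \<otimes> T (unit_vec R a) y"
        using free_hom_smult[OF A fB T tc v] free_hom_smult[OF A fB T _ e] c by simp
      finally show ?thesis using c free_hom_entry[OF fB T e] by (simp add: a_minus_def l_minus)
    qed
    have U: "U \<in> mod_hom R (free_module R A') (free_module R (insert b B))"
    proof (rule free_homI[OF A' fB])
      show "U v \<in> carrier (free_module R (insert b B))" if "v \<in> carrier (free_module R A')" for v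
        unfolding U_def using mod_hom_closed[OF T Ec[OF sub[OF that]]] .
    next
      fix v w y assume vw: "v \<in> carrier (free_module R A')" "w \<in> carrier (free_module R A')"
      have vw': "(\<lambda>x. v x \<oplus> w x) \<in> carrier (free_module R A)"
        using free_module_closed(1)[OF A sub sub] vw by auto
      have c: "T v z \<in> carrier R" "T w z \<in> carrier R" for z using free_hom_entry[OF fB T sub] vw by auto
      show "U (\<lambda>x. v x \<oplus> w x) y = U v y \<oplus> U w y"
        unfolding Uy[OF vw'] Uy[OF sub[OF vw(1)]] Uy[OF sub[OF vw(2)]]
          free_hom_add[OF A fB T sub[OF vw(1)] sub[OF vw(2)]]
        using c(1)[of y] c(2)[of y] c(1)[of b] c(2)[of b] tc free_hom_entry[OF fB T e, of y]
        by algebra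
    next
      fix r v y assume r: "r \<in> carrier R" and v: "v \<in> carrier (free_module R A')"
      have c: "T v z \<in> carrier R" for z using free_hom_entry[OF fB T sub[OF v]] .
      have rv: "(\<lambda>x. r \<otimes> v x) \<in> carrier (free_module R A)" using free_module_closed(2)[OF A sub[OF v] r] .
      show "U (\<lambda>x. r \<otimes> v x) y = r \<otimes> U v y"
        unfolding Uy[OF rv] Uy[OF sub[OF v]] free_hom_smult[OF A fB T r sub[OF v]]
        using c[of y] c[of b] tc free_hom_entry[OF fB T e, of y] r
        by algebra
    qed
    have "card B < card A'" using insert a A by (simp add: A'_def)
    then obtain v where v: "v \<in> carrier (free_module R A')" "\<exists>x\<in>A'. v x \<notin> I"
      "\<forall>y\<in>B. (if y \<in> B then U v y else \<zero>) \<in> I"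
      using insert.IH[OF A' _ restr[OF U A']] by auto
    from v(2) obtain x where x: "x \<in> A'" "v x \<notin> I" by auto
    have vc: "v x \<in> carrier R" for x using free_module_entry[OF A' v(1)] .
    show ?thesis
    proof (intro bexI[of _ "E v"] conjI)
      have "E v x = t \<otimes> v x"
        using x vc tc free_hom_entry[OF fB T sub[OF v(1)], of b] by (simp add: E_def unit_vec_def A'_def)
      moreover have "t \<otimes> v x \<notin> I" using I_prime[OF tc vc, of x] x a(2) t_def by auto
      ultimately show "\<exists>x\<in>A. E v x \<notin> I" using x(1) by (intro bexI[of _ x]) (auto simp: A'_def)
      have "T (E v) b = \<zero>" using Uy[OF sub[OF v(1)], of b] tc free_hom_entry[OF fB T sub[OF v(1)], of b]
        m_comm[OF tc free_hom_entry[OF fB T sub[OF v(1)], of b]]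
        by (simp add: U_def t_def[symmetric] r_right_minus_eq)
      then show "\<forall>y\<in>insert b B. T (E v) y \<in> I" using v(3) by (auto simp: U_def)
      show "E v \<in> carrier (free_module R A)" using Ec[OF sub[OF v(1)]] .
    qed
  qed
qed


section \<open>Integral dependence and matrices of low rank\<close>

text \<open>The values \<open>a\<^sub>1 u^(n-1) + \<dots> + a\<^sub>n\<close> with \<open>a\<^sub>k \<in> I^k\<close>.\<close>

primrec lower_terms :: "('a, 'k) ring_scheme \<Rightarrow> 'a set \<Rightarrow> 'a \<Rightarrow> nat \<Rightarrow> 'a set" where
  "lower_terms R I u 0 = {\<zero>\<^bsub>R\<^esub>}"
| "lower_terms R I u (Suc n) =
     {u \<otimes>\<^bsub>R\<^esub> x \<oplus>\<^bsub>R\<^esub> a | x a. x \<in> lower_terms R I u n \<and> a \<in> ideal_power R I (Suc n)}"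

text \<open>In positive degree, the value zero is an equation of integral dependence of
  \<open>u\<close> on \<open>I\<close>. If \<open>u\<close> is not integral, these values therefore
  form a multiplicative set without zero.\<close>

definition monic_values :: "('a, 'k) ring_scheme \<Rightarrow> 'a set \<Rightarrow> 'a \<Rightarrow> nat \<Rightarrow> 'a set" where
  "monic_values R I u n = {u [^]\<^bsub>R\<^esub> n \<oplus>\<^bsub>R\<^esub> x | x. x \<in> lower_terms R I u n}"

context cring
begin

lemma finsum_swap:
  assumes "finite A" "finite B" and f: "\<And>i j. i \<in> A \<Longrightarrow> j \<in> B \<Longrightarrow> f i j \<in> carrier R"
  shows "(\<Oplus>i\<in>A. \<Oplus>j\<in>B. f i j) = (\<Oplus>j\<in>B. \<Oplus>i\<in>A. f i j)"
  using assms(1) f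
proof (induction A)
  case (insert a A)
  have "(\<Oplus>i\<in>insert a A. \<Oplus>j\<in>B. f i j) = (\<Oplus>j\<in>B. f a j) \<oplus> (\<Oplus>j\<in>B. \<Oplus>i\<in>A. f i j)"
    using insert by (subst finsum_insert) (auto intro!: finsum_closed)
  also have "\<dots> = (\<Oplus>j\<in>B. f a j \<oplus> (\<Oplus>i\<in>A. f i j))"
    using insert by (intro finsum_addf[symmetric]) (auto intro!: finsum_closed)
  also have "\<dots> = (\<Oplus>j\<in>B. \<Oplus>i\<in>insert a A. f i j)"
    using insert by (intro finsum_cong') (auto intro!: finsum_closed finsum_insert[symmetric])
  finally show ?case .
qed (simp add: finsum_zero)

section \<open>Powers of an ideal and monic expressions in one element\<close>

lemma ideal_power_ideal: "ideal I R \<Longrightarrow> ideal (ideal_power R I n) R"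
  by (induction n) (auto intro: ideal_prod_is_ideal oneideal)

lemma ideal_power_mult:
  assumes "ideal I R" "x \<in> ideal_power R I m" "y \<in> ideal_power R I n"
  shows "x \<otimes> y \<in> ideal_power R I (m + n)"
proof -
  have "ideal_power R I m \<cdot> ideal_power R I n = ideal_power R I (m + n)"
  proof (induction m)
    case 0
    show ?case
      using ideal_prod_one[OF ideal_power_ideal[OF assms(1), of n]]
        ideal_prod_commute[OF ideal_power_ideal[OF assms(1), of n] oneideal] by simp
  next
    case (Suc m)
    then show ?case
      using ideal_prod_assoc[OF assms(1) ideal_power_ideal ideal_power_ideal, OF assms(1) assms(1)] by simp
  qed
  then show ?thesis using ideal_prod.prod[OF assms(2,3), of R] by simp
qed

context
  fixes I u
  assumes I: "ideal I R" and u: "u \<in> carrier R"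
begin

abbreviation "low \<equiv> lower_terms R I u"

lemma ideal_power_closed: "a \<in> ideal_power R I n \<Longrightarrow> a \<in> carrier R"
  using ideal.Icarr[OF ideal_power_ideal[OF I]] .

lemma lower_terms_closed: "x \<in> low n \<Longrightarrow> x \<in> carrier R"
proof (induction n arbitrary: x)
  case (Suc n)
  then show ?case using u ideal_power_closed[of _ "Suc n"] by (auto simp del: ideal_power.simps)
qed auto

lemma zero_mem_power: "\<zero> \<in> ideal_power R I n"
  using additive_subgroup.zero_closed[OF ideal.axioms(1)[OF ideal_power_ideal[OF I]]] .

lemma lower_terms_mult_u: "x \<in> low n \<Longrightarrow> u \<otimes> x \<in> low (Suc n)"
  using zero_mem_power[of "Suc n"] lower_terms_closed[of x n] u
  by (simp del: ideal_power.simps) (metis m_closed r_zero)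

lemma lower_terms_zero: "\<zero> \<in> low n"
  using lower_terms_mult_u[of \<zero>] u by (induction n) (auto simp del: lower_terms.simps(2))

lemma lower_terms_add: "x \<in> low n \<Longrightarrow> y \<in> low n \<Longrightarrow> x \<oplus> y \<in> low n"
proof (induction n arbitrary: x y)
  case (Suc n)
  from Suc.prems obtain x' a y' b where *: "x = u \<otimes> x' \<oplus> a" "x' \<in> low n" "a \<in> ideal_power R I (Suc n)"
    "y = u \<otimes> y' \<oplus> b" "y' \<in> low n" "b \<in> ideal_power R I (Suc n)"
    by (auto simp del: ideal_power.simps)
  have "a \<oplus> b \<in> ideal_power R I (Suc n)"
    using * additive_subgroup.a_closed[OF ideal.axioms(1)[OF ideal_power_ideal[OF I]]] by blast
  moreover have "x \<oplus> y = u \<otimes> (x' \<oplus> y') \<oplus> (a \<oplus> b)"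
    using * u lower_terms_closed[OF *(2)] lower_terms_closed[OF *(5)]
      ideal_power_closed[OF *(3)] ideal_power_closed[OF *(6)]
    by (simp add: r_distr a_ac)
  ultimately show ?case using Suc.IH[OF *(2,5)] by (auto simp del: ideal_power.simps)
qed auto

lemma lower_terms_mult_left: "a \<in> ideal_power R I k \<Longrightarrow> x \<in> low n \<Longrightarrow> a \<otimes> x \<in> low (k + n)"
proof (induction n arbitrary: x)
  case 0
  then show ?case using ideal_power_closed[OF 0(1)] lower_terms_zero by simp
next
  case (Suc n)
  from Suc.prems obtain x' b where *: "x = u \<otimes> x' \<oplus> b" "x' \<in> low n" "b \<in> ideal_power R I (Suc n)"
    by (auto simp del: ideal_power.simps)
  have "a \<otimes> x = u \<otimes> (a \<otimes> x') \<oplus> a \<otimes> b"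
    using * u lower_terms_closed[OF *(2)] ideal_power_closed[OF *(3)] ideal_power_closed[OF Suc.prems(1)]
    by (simp add: r_distr m_lcomm)
  moreover have "a \<otimes> b \<in> ideal_power R I (Suc (k + n))"
    using ideal_power_mult[OF I Suc.prems(1) *(3)] by simp
  ultimately show ?case using Suc.IH[OF Suc.prems(1) *(2)] by (auto simp del: ideal_power.simps)
qed

text \<open>Degrees add as in a Rees algebra, with \<open>u\<close> in degree 1 and the
  \<open>k\<close>-th power of \<open>I\<close> in degree \<open>k\<close>.\<close>

lemma lower_terms_mult: "x \<in> low m \<Longrightarrow> y \<in> low n \<Longrightarrow> x \<otimes> y \<in> low (m + n)"
proof (induction m arbitrary: x)
  case 0
  then show ?case using lower_terms_closed[OF 0(2)] lower_terms_zero by simp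
next
  case (Suc m)
  from Suc.prems obtain x' a where *: "x = u \<otimes> x' \<oplus> a" "x' \<in> low m" "a \<in> ideal_power R I (Suc m)"
    by (auto simp del: ideal_power.simps)
  have "x \<otimes> y = u \<otimes> (x' \<otimes> y) \<oplus> a \<otimes> y"
    using * u lower_terms_closed[OF *(2)] ideal_power_closed[OF *(3)] lower_terms_closed[OF Suc.prems(2)]
    by (simp add: l_distr m_assoc)
  then show ?case
    using lower_terms_add[OF lower_terms_mult_u[OF Suc.IH[OF *(2) Suc.prems(2)]]]
      lower_terms_mult_left[OF *(3) Suc.prems(2)] by (simp del: ideal_power.simps lower_terms.simps)
qed

lemma lower_terms_uminus: "x \<in> low n \<Longrightarrow> \<ominus> x \<in> low n"
  \<comment> \<open>The zeroth power of \<open>I\<close> is the whole ring, so multiplication by -1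
    has degree 0.\<close>
  using lower_terms_mult_left[of "\<ominus> \<one>" 0 x n] lower_terms_closed[of x n] by (simp add: l_minus)

lemma lower_terms_mult_power: "x \<in> low n \<Longrightarrow> u [^] (m::nat) \<otimes> x \<in> low (m + n)"
proof (induction m)
  case 0
  then show ?case using lower_terms_closed[OF 0] by simp
next
  case (Suc m)
  then show ?case using lower_terms_mult_u[OF Suc.IH] lower_terms_closed[OF Suc.prems] u
    by (simp del: lower_terms.simps add: m_ac)
qed

lemma lower_terms_sum:
  "x \<in> low n \<Longrightarrow> \<exists>a. (\<forall>k\<in>{1..n}. a k \<in> ideal_power R I k) \<and> x = (\<Oplus>k\<in>{1..n}. a k \<otimes> u [^] (n - k))"
proof (induction n arbitrary: x)
  case (Suc n)
  from Suc.prems obtain x' b where *: "x = u \<otimes> x' \<oplus> b" "x' \<in> low n" "b \<in> ideal_power R I (Suc n)"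
    by (auto simp del: ideal_power.simps)
  from Suc.IH[OF *(2)] obtain a where a: "\<And>k. k \<in> {1..n} \<Longrightarrow> a k \<in> ideal_power R I k"
    "x' = (\<Oplus>k\<in>{1..n}. a k \<otimes> u [^] (n - k))" by blast
  define a' where "a' = a(Suc n := b)"
  have ac: "a k \<in> carrier R" if "k \<in> {1..n}" for k using ideal_power_closed[OF a(1)[OF that]] .
  have bc: "b \<in> carrier R" using ideal_power_closed[OF *(3)] .
  have "(\<Oplus>k\<in>{1..Suc n}. a' k \<otimes> u [^] (Suc n - k)) = (\<Oplus>k\<in>insert (Suc n) {1..n}. a' k \<otimes> u [^] (Suc n - k))"
    by (simp add: atLeastAtMostSuc_conv)
  also have "\<dots> = b \<oplus> (\<Oplus>k\<in>{1..n}. a' k \<otimes> u [^] (Suc n - k))"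
    using bc ac u by (subst finsum_insert) (auto simp: a'_def)
  also have "(\<Oplus>k\<in>{1..n}. a' k \<otimes> u [^] (Suc n - k)) = (\<Oplus>k\<in>{1..n}. u \<otimes> (a k \<otimes> u [^] (n - k)))"
    using ac u by (intro finsum_cong') (auto simp: a'_def Suc_diff_le m_ac)
  also have "\<dots> = u \<otimes> x'" unfolding a(2) using ac u by (intro finsum_rdistr[symmetric]) auto
  finally have "x = (\<Oplus>k\<in>{1..Suc n}. a' k \<otimes> u [^] (Suc n - k))"
    using *(1) bc u lower_terms_closed[OF *(2)] by (simp add: a_comm)
  moreover have "a' k \<in> ideal_power R I k" if "k \<in> {1..Suc n}" for k
    using that a(1) *(3) by (auto simp: a'_def simp del: ideal_power.simps)
  ultimately show ?case by blast
qed auto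

lemma integral_if_zero_mem_monic_values:
  assumes "\<zero> \<in> monic_values R I u n" "n > 0"
  shows "integral_over_ideal R I u"
proof -
  from assms(1) obtain x where x: "x \<in> low n" "\<zero> = u [^] n \<oplus> x" by (auto simp: monic_values_def)
  from lower_terms_sum[OF x(1)] x(2) assms(2) u show ?thesis
    unfolding integral_over_ideal_def by auto
qed

text \<open>The summand \<open>z\<close> leaves room for the product of off-diagonal entries in a
  two-by-two minor; with \<open>z\<close> zero this is closure under products.\<close>

lemma monic_values_mult:
  assumes "s \<in> monic_values R I u m" "t \<in> monic_values R I u n" "z \<in> low (m + n)"
  shows "s \<otimes> t \<oplus> z \<in> monic_values R I u (m + n)"
proof -
  obtain x y where *: "s = u [^] m \<oplus> x" "x \<in> low m" "t = u [^] n \<oplus> y" "y \<in> low n"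
    using assms by (auto simp: monic_values_def)
  have c: "x \<in> carrier R" "y \<in> carrier R" "z \<in> carrier R" "u [^] m \<in> carrier R" "u [^] n \<in> carrier R"
    using lower_terms_closed * assms u by auto
  have "s \<otimes> t \<oplus> z = u [^] (m + n) \<oplus> (u [^] m \<otimes> y \<oplus> (u [^] n \<otimes> x \<oplus> (x \<otimes> y \<oplus> z)))"
    unfolding * nat_pow_mult[OF u, symmetric] using c
    by (simp add: l_distr r_distr a_ac m_comm[of x "u [^] n"])
  moreover have "u [^] m \<otimes> y \<oplus> (u [^] n \<otimes> x \<oplus> (x \<otimes> y \<oplus> z)) \<in> low (m + n)"
    using lower_terms_mult_power[OF *(4), of m] lower_terms_mult_power[OF *(2), of n]
      lower_terms_mult[OF *(2,4)] assms(3)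
    by (intro lower_terms_add) (auto simp: add.commute)
  ultimately show ?thesis by (auto simp: monic_values_def)
qed

lemma monic_values_mult_lower:
  assumes "s \<in> monic_values R I u m" "y \<in> low n"
  shows "s \<otimes> y \<in> low (m + n)"
proof -
  obtain x where *: "s = u [^] m \<oplus> x" "x \<in> low m" using assms by (auto simp: monic_values_def)
  have "s \<otimes> y = u [^] m \<otimes> y \<oplus> x \<otimes> y"
    using lower_terms_closed[OF *(2)] lower_terms_closed[OF assms(2)] u * by (simp add: l_distr)
  then show ?thesis
    using lower_terms_add[OF lower_terms_mult_power[OF assms(2), of m] lower_terms_mult[OF *(2) assms(2)]]
    by simp
qed

lemma monic_values_closed: "s \<in> monic_values R I u n \<Longrightarrow> s \<in> carrier R"
  using lower_terms_closed u by (auto simp: monic_values_def)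

end

end

text \<open>The identity says that \<open>u\<close> times the identity matrix is, modulo \<open>I\<close>, a product of
  matrices factoring through rank \<open>n < b\<close>. So some \<open>u \<cdot> id - C\<close> with \<open>C\<close> over \<open>I\<close> is singular,
  and its determinant is an equation of integral dependence. In place of the determinant we use
  that, modulo a prime ideal avoiding all monic expressions in \<open>u\<close>, elimination shows that this
  matrix has no kernel.\<close>

lemma (in noetherian_ring) mem_integrally_closed_ideal_if_low_rank:
  fixes n b :: nat
  assumes "cring R" and int: "integrally_closed_ideal R I" and u: "u \<in> carrier R" and "n < b"
    and F: "\<And>i l. i < b \<Longrightarrow> l < n \<Longrightarrow> F i l \<in> carrier R"
    and G: "\<And>l j. l < n \<Longrightarrow> j < b \<Longrightarrow> G l j \<in> carrier R"
    and eq: "\<And>i j. i < b \<Longrightarrow> j < b \<Longrightarrow>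
      (if i = j then u else \<zero>) \<ominus> (\<Oplus>l\<in>{..<n}. F i l \<otimes> G l j) \<in> I"
  shows "u \<in> I"
proof (rule ccontr)
  assume "u \<notin> I"
  interpret cring R by fact
  have I: "ideal I R" using int by (simp add: integrally_closed_ideal_def)
  interpret I: ideal I R by fact
  note mon = monic_values_mult[OF I u] monic_values_mult_lower[OF I u]
  define T where "T = (\<Union>m. monic_values R I u m)"
  have one: "\<one> \<in> monic_values R I u 0" by (auto simp: monic_values_def)
  have nonzero: "\<zero> \<notin> monic_values R I u m" for m
  proof (cases m)
    case 0
    have "\<one> \<noteq> \<zero>" using \<open>u \<notin> I\<close> u one_zeroD I.zero_closed by auto
    then show ?thesis using 0 by (auto simp: monic_values_def)
  next
    case (Suc k)
    then show ?thesis
      using integral_if_zero_mem_monic_values[OF I u, of m] int \<open>u \<notin> I\<close>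
      by (auto simp: integrally_closed_ideal_def)
  qed
  have mult: "s \<otimes> t \<in> monic_values R I u (m + k)"
    if "s \<in> monic_values R I u m" "t \<in> monic_values R I u k" for s t m k
    using mon(1)[OF that lower_terms_zero[OF I u]] monic_values_closed[OF I u] that by simp
  \<comment> \<open>Modulo such a prime, every monic expression in \<open>u\<close> is nonzero and
    can be cancelled.\<close>
  obtain P where "primeideal P R" and disj: "P \<inter> T = {}"
  proof (rule exists_prime_disjoint[OF is_cring])
    show "T \<subseteq> carrier R" using monic_values_closed[OF I u] by (auto simp: T_def)
    show "\<one> \<in> T" using one by (auto simp: T_def)
    show "\<zero> \<notin> T" using nonzero by (auto simp: T_def)
    show "s \<otimes> t \<in> T" if st: "s \<in> T" "t \<in> T" for s t
    proof -
      obtain m k where "s \<in> monic_values R I u m" "t \<in> monic_values R I u k"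
        using st unfolding T_def by blast
      from mult[OF this] show ?thesis by (auto simp only: T_def)
    qed
  qed
  interpret P: primeideal P R by fact
  \<comment> \<open>Row vectors are multiplied by \<open>F\<close>: there are \<open>b\<close>
    unknowns and only \<open>n < b\<close> equations, so some \<open>v\<close> that is nonzero
    modulo \<open>P\<close> goes to zero modulo \<open>P\<close>.\<close>
  define f where "f = (\<lambda>v l. \<Oplus>i\<in>{..<b}. v i \<otimes> (if l < n then F i l else \<zero>))"
  have "f \<in> mod_hom R (free_module R {..<b}) (free_module R {..<n})"
    unfolding f_def using F by (intro linear_extension(1)) (auto simp: free_module_carrier)
  then obtain v where v: "v \<in> carrier (free_module R {..<b})" and vP: "\<exists>i\<in>{..<b}. v i \<notin> P"
    and fv: "\<And>l. l < n \<Longrightarrow> f v l \<in> P"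
    using P.homogeneous_system[of "{..<b}" "{..<n}" f] \<open>n < b\<close> by auto
  have vc: "v i \<in> carrier R" for i using free_module_entry[OF _ v] by simp
  define C where "C i j = (if i = j then u else \<zero>) \<ominus> (\<Oplus>l\<in>{..<n}. F i l \<otimes> G l j)" for i j
  have FG: "(\<Oplus>l\<in>{..<n}. F i l \<otimes> G l j) \<in> carrier R" if "i < b" "j < b" for i j
    using F G that by (intro finsum_closed) auto
  have CI: "C i j \<in> I" if "i < b" "j < b" for i j using eq[OF that] by (simp add: C_def)
  \<comment> \<open>The indices are swapped because \<open>v\<close> multiplies from the left. As
    \<open>u\<close> times the identity minus a matrix over \<open>I\<close>, \<open>A\<close> is
    monic of degree 1 on the diagonal; as the product of \<open>F\<close> and \<open>G\<close>, it
    kills \<open>v\<close> modulo \<open>P\<close>.\<close>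
  define A where "A j i = (if i = j then u else \<zero>) \<ominus> C i j" for i j
  have A: "A j i = (\<Oplus>l\<in>{..<n}. F i l \<otimes> G l j)" if "i < b" "j < b" for i j
  proof -
    have id: "x \<ominus> (x \<ominus> y) = y" if "x \<in> carrier R" "y \<in> carrier R" for x y
      using that by (simp add: a_minus_def minus_add minus_minus a_assoc[symmetric] r_neg)
    show ?thesis unfolding A_def C_def using id[OF _ FG[OF that]] u by simp
  qed
  have I1: "x \<in> lower_terms R I u 1" if "x \<in> I" for x
    using that ideal_prod_one[OF I] u I.Icarr[OF that] by (auto intro!: exI[of _ x])
  have "\<exists>k. \<exists>t\<in>monic_values R I u k. \<forall>i<b. t \<otimes> v i \<in> P"
  proof (rule elimination[where T = "monic_values R I u" and H = "lower_terms R I u" and A = A and n = 1])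
    show "A j j \<in> monic_values R I u 1" if "j < b" for j
    proof -
      have "\<ominus> C j j \<in> lower_terms R I u 1" using CI[OF that that] by (intro I1) simp
      then have "u [^] (1::nat) \<oplus> \<ominus> C j j \<in> monic_values R I u 1" by (auto simp only: monic_values_def)
      then show ?thesis using u by (simp add: A_def a_minus_def)
    qed
    show "A j i \<in> lower_terms R I u 1" if "j < b" "i < b" "j \<noteq> i" for i j
      using CI[OF that(2,1)] that u I.Icarr by (intro I1) (auto simp: A_def a_minus_def)
    show "s \<otimes> t \<ominus> x \<otimes> y \<in> monic_values R I u (m + m)"
      if "s \<in> monic_values R I u m" "t \<in> monic_values R I u m"
        "x \<in> lower_terms R I u m" "y \<in> lower_terms R I u m" for m s t x y
      unfolding a_minus_def using that
      by (intro mon lower_terms_uminus[OF I u] lower_terms_mult[OF I u])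
    show "t \<otimes> x \<ominus> y \<otimes> z \<in> lower_terms R I u (m + m)"
      if "t \<in> monic_values R I u m" "x \<in> lower_terms R I u m"
        "y \<in> lower_terms R I u m" "z \<in> lower_terms R I u m" for m t x y z
      unfolding a_minus_def using that
      by (intro mon lower_terms_add[OF I u] lower_terms_uminus[OF I u] lower_terms_mult[OF I u])
    show "\<exists>k. s \<otimes> t \<in> monic_values R I u k"
      if "s \<in> monic_values R I u m" "t \<in> monic_values R I u k" for m k s t
      using mult[OF that] by blast
    fix j assume j: "j < b"
    have "(\<Oplus>i\<in>{..<b}. A j i \<otimes> v i) = (\<Oplus>i\<in>{..<b}. \<Oplus>l\<in>{..<n}. G l j \<otimes> (v i \<otimes> F i l))"
    proof (rule finsum_cong'[OF refl])
      fix i assume "i \<in> {..<b}"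
      then have i: "i < b" by simp
      have "A j i \<otimes> v i = (\<Oplus>l\<in>{..<n}. F i l \<otimes> G l j \<otimes> v i)"
        unfolding A[OF i j] using F G i j vc by (intro finsum_ldistr) auto
      also have "\<dots> = (\<Oplus>l\<in>{..<n}. G l j \<otimes> (v i \<otimes> F i l))"
        using F G i j vc by (intro finsum_cong') (auto simp: m_ac)
      finally show "A j i \<otimes> v i = (\<Oplus>l\<in>{..<n}. G l j \<otimes> (v i \<otimes> F i l))" .
    qed (use F G j vc in \<open>auto intro!: finsum_closed\<close>)
    also have "\<dots> = (\<Oplus>l\<in>{..<n}. \<Oplus>i\<in>{..<b}. G l j \<otimes> (v i \<otimes> F i l))"
      using F G j vc by (intro finsum_swap) auto
    also have "\<dots> = (\<Oplus>l\<in>{..<n}. G l j \<otimes> f v l)"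
    proof (rule finsum_cong'[OF refl])
      fix l assume "l \<in> {..<n}"
      then have l: "l < n" by simp
      have "f v l = (\<Oplus>i\<in>{..<b}. v i \<otimes> F i l)" unfolding f_def using l by simp
      then show "(\<Oplus>i\<in>{..<b}. G l j \<otimes> (v i \<otimes> F i l)) = G l j \<otimes> f v l"
        using F G j vc l by (auto intro!: finsum_rdistr[symmetric])
    qed (use G fv j in \<open>auto dest: P.Icarr\<close>)
    also have "\<dots> \<in> P" using fv G j by (intro ideal_finsum_closed P.ideal_axioms P.I_l_closed) auto
    finally show "(\<Oplus>i\<in>{..<b}. A j i \<otimes> v i) \<in> P" .
  qed (use one vc monic_values_closed[OF I u] lower_terms_closed[OF I u] in
      \<open>auto intro: P.ideal_axioms\<close>)
  then obtain k t where t: "t \<in> monic_values R I u k" "\<And>i. i < b \<Longrightarrow> t \<otimes> v i \<in> P" by blast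
  obtain i where i: "i < b" "v i \<notin> P" using vP by auto
  have "t \<in> P" using P.I_prime[OF monic_values_closed[OF I u t(1)] vc t(2)[OF i(1)]] i(2) by auto
  then show False using t(1) disj by (auto simp: T_def)
qed

text \<open>Entries are lifted to \<open>S\<close> by arbitrary choice. This destroys the matrix
  identity only up to entries in \<open>I\<close>, which the preceding lemma permits, and a lift of
  \<open>u\<close> that lies in \<open>I\<close> means that \<open>u\<close> is zero.\<close>

lemma weakly_reduced_low_rank:
  fixes n b :: nat
  assumes "cring R" and wr: "weakly_reduced TYPE('s) R" and u: "u \<in> carrier R" and "n < b"
    and F: "\<And>i l. i < b \<Longrightarrow> l < n \<Longrightarrow> F i l \<in> carrier R"
    and G: "\<And>l j. l < n \<Longrightarrow> j < b \<Longrightarrow> G l j \<in> carrier R"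
    and eq: "\<And>i j. i < b \<Longrightarrow> j < b \<Longrightarrow>
      (\<Oplus>\<^bsub>R\<^esub>l\<in>{..<n}. F i l \<otimes>\<^bsub>R\<^esub> G l j) = (if i = j then u else \<zero>\<^bsub>R\<^esub>)"
  shows "u = \<zero>\<^bsub>R\<^esub>"
proof -
  interpret R: cring R by fact
  obtain S :: "'s ring" and I where S: "cring S" "noetherian_ring S" and I: "integrally_closed_ideal S I"
    and iso: "R \<simeq> S Quot I"
    using wr by (auto simp: weakly_reduced_def noetherian_local_ring_def)
  interpret S: cring S by fact
  have "ideal I S" using I by (simp add: integrally_closed_ideal_def)
  interpret I: ideal I S by fact
  interpret Q: cring "S Quot I" using I.quotient_is_cring[OF S(1)] .
  obtain \<phi> where \<phi>: "\<phi> \<in> ring_iso R (S Quot I)" using iso by (auto simp: is_ring_iso_def)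
  have \<phi>hom: "ring_hom_cring R (S Quot I) \<phi>"
    using \<phi> by (intro ring_hom_cringI R.is_cring Q.is_cring) (auto simp: ring_iso_def)
  interpret \<phi>: ring_hom_cring R "S Quot I" \<phi> by fact
  define \<pi> where "\<pi> = (+>\<^bsub>S\<^esub>) I"
  interpret \<pi>: ring_hom_cring S "S Quot I" \<pi>
    unfolding \<pi>_def by (rule I.rcos_ring_hom_cring[OF S(1)])
  have "\<exists>s\<in>carrier S. \<pi> s = \<phi> x" if "x \<in> carrier R" for x
    using \<phi>.hom_closed[OF that] by (auto simp: \<pi>_def FactRing_def A_RCOSETS_def')
  then obtain lift where lift: "\<And>x. x \<in> carrier R \<Longrightarrow> lift x \<in> carrier S \<and> \<pi> (lift x) = \<phi> x"
    by metis
  have ker: "s \<in> I \<longleftrightarrow> \<pi> s = \<zero>\<^bsub>S Quot I\<^esub>" if "s \<in> carrier S" for s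
    using that I.a_rcos_const[of s] I.a_rcos_self[of s] by (auto simp: \<pi>_def FactRing_def)
  have "lift u \<in> I"
  proof (rule noetherian_ring.mem_integrally_closed_ideal_if_low_rank[OF S(2,1) I _ \<open>n < b\<close>,
        of _ "\<lambda>i l. lift (F i l)" "\<lambda>l j. lift (G l j)"])
    fix i j assume ij: "i < b" "j < b"
    have sumc: "(\<Oplus>\<^bsub>S\<^esub>l\<in>{..<n}. lift (F i l) \<otimes>\<^bsub>S\<^esub> lift (G l j)) \<in> carrier S"
      using lift F G ij by (intro S.finsum_closed) auto
    have "\<pi> (\<Oplus>\<^bsub>S\<^esub>l\<in>{..<n}. lift (F i l) \<otimes>\<^bsub>S\<^esub> lift (G l j))
        = (\<Oplus>\<^bsub>S Quot I\<^esub>l\<in>{..<n}. \<pi> (lift (F i l) \<otimes>\<^bsub>S\<^esub> lift (G l j)))"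
      using lift F G ij by (subst \<pi>.hom_finsum) (auto simp: comp_def)
    also have "\<dots> = (\<Oplus>\<^bsub>S Quot I\<^esub>l\<in>{..<n}. \<phi> (F i l \<otimes>\<^bsub>R\<^esub> G l j))"
      using lift F G ij by (intro Q.finsum_cong') auto
    also have "\<dots> = \<phi> (\<Oplus>\<^bsub>R\<^esub>l\<in>{..<n}. F i l \<otimes>\<^bsub>R\<^esub> G l j)"
      using F G ij by (subst \<phi>.hom_finsum) (auto simp: comp_def)
    also have "\<dots> = \<phi> (if i = j then u else \<zero>\<^bsub>R\<^esub>)" by (simp only: eq[OF ij])
    also have "\<dots> = \<pi> (if i = j then lift u else \<zero>\<^bsub>S\<^esub>)" using lift u by auto
    finally have "\<pi> ((if i = j then lift u else \<zero>\<^bsub>S\<^esub>) \<ominus>\<^bsub>S\<^esub> (\<Oplus>\<^bsub>S\<^esub>l\<in>{..<n}. lift (F i l) \<otimes>\<^bsub>S\<^esub> lift (G l j)))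
        = \<zero>\<^bsub>S Quot I\<^esub>"
      using sumc lift[OF u] by (simp add: a_minus_def Q.r_neg)
    then show "(if i = j then lift u else \<zero>\<^bsub>S\<^esub>) \<ominus>\<^bsub>S\<^esub> (\<Oplus>\<^bsub>S\<^esub>l\<in>{..<n}. lift (F i l) \<otimes>\<^bsub>S\<^esub> lift (G l j)) \<in> I"
      using sumc lift[OF u] by (subst ker) auto
  qed (use lift u F G in auto)
  then have "\<phi> u = \<zero>\<^bsub>S Quot I\<^esub>" using lift[OF u] ker by auto
  then have eq: "\<phi> u = \<phi> \<zero>\<^bsub>R\<^esub>" by simp
  have "inj_on \<phi> (carrier R)" using \<phi> by (auto simp: ring_iso_def bij_betw_def)
  from inj_onD[OF this eq u R.zero_closed] show ?thesis .
qed


section \<open>Ranks in split complexes\<close>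

text \<open>A complex \<open>R^(\<beta> 0) \<leftarrow> R^(\<beta> 1) \<leftarrow> \<dots>\<close> on which multiplication by \<open>c\<close> is
  homotopic to zero, for some \<open>c\<close> outside the prime ideal \<open>q\<close>: it becomes exact over the field of fractions
  of \<open>R/q\<close>.\<close>

locale contractible_complex = primeideal q R for q and R (structure) +
  fixes \<beta> :: "nat \<Rightarrow> nat" and f h :: "nat \<Rightarrow> (nat \<Rightarrow> 'a) \<Rightarrow> (nat \<Rightarrow> 'a)" and c :: 'a
  assumes f: "f (Suc j) \<in> mod_hom R (free_module R {..<\<beta> (Suc j)}) (free_module R {..<\<beta> j})"
    and h: "h j \<in> mod_hom R (free_module R {..<\<beta> j}) (free_module R {..<\<beta> (Suc j)})"
    and c: "c \<in> carrier R" "c \<notin> q"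
    and complex: "v \<in> carrier (free_module R {..<\<beta> (Suc (Suc j))}) \<Longrightarrow> f (Suc j) (f (Suc (Suc j)) v) k = \<zero>"
    and homotopy_0: "v \<in> carrier (free_module R {..<\<beta> 0}) \<Longrightarrow> f 1 (h 0 v) k = c \<otimes> v k"
    and homotopy_Suc: "v \<in> carrier (free_module R {..<\<beta> (Suc j)}) \<Longrightarrow>
      f (Suc (Suc j)) (h (Suc j) v) k \<oplus> h j (f (Suc j) v) k = c \<otimes> v k"
begin

abbreviation F :: "nat \<Rightarrow> (nat \<Rightarrow> 'a) set" where
  "F j \<equiv> carrier (free_module R {..<\<beta> j})"

lemma f_mod: "v \<in> F (Suc j) \<Longrightarrow> (\<And>k. v k \<in> q) \<Longrightarrow> f (Suc j) v k \<in> q"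
  by (rule free_hom_mod_ideal[OF _ _ f _ ideal_axioms]) auto

lemma h_mod: "v \<in> F j \<Longrightarrow> (\<And>k. v k \<in> q) \<Longrightarrow> h j v k \<in> q"
  by (rule free_hom_mod_ideal[OF _ _ h _ ideal_axioms]) auto

lemmas f_closed = mod_hom_closed[OF f]
lemmas h_closed = mod_hom_closed[OF h]

lemma F_entry: "v \<in> F j \<Longrightarrow> v k \<in> carrier R"
  by (rule free_module_entry[rotated]) auto

lemma sum_mem: "x \<in> q \<Longrightarrow> y \<in> q \<Longrightarrow> x \<oplus> y \<in> q"
  by (rule additive_subgroup.a_closed[OF is_additive_subgroup])

lemma sum_mem_left: "x \<oplus> y \<in> q \<Longrightarrow> y \<in> q \<Longrightarrow> x \<in> carrier R \<Longrightarrow> x \<in> q"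
proof -
  assume *: "x \<oplus> y \<in> q" "y \<in> q" "x \<in> carrier R"
  have "x \<oplus> y \<oplus> \<ominus> y \<in> q"
    using sum_mem[OF *(1) additive_subgroup.a_inv_closed[OF is_additive_subgroup *(2)]] .
  moreover have "x \<oplus> y \<oplus> \<ominus> y = x" using *(3) Icarr[OF *(2)] by (simp add: a_assoc r_neg)
  ultimately show "x \<in> q" by (simp only:)
qed

lemma sum_mem_right: "x \<oplus> y \<in> q \<Longrightarrow> x \<in> q \<Longrightarrow> y \<in> carrier R \<Longrightarrow> y \<in> q"
  using sum_mem_left[of y x] a_comm[of x y] Icarr[of x] by simp

section \<open>Folding the truncated complex by parity\<close>

definition graded_index :: "nat \<Rightarrow> bool \<Rightarrow> (nat \<times> nat) set" where
  "graded_index i e = {(j, k). j < i \<and> k < \<beta> j \<and> even j = e}"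

definition slice :: "(nat \<times> nat \<Rightarrow> 'a) \<Rightarrow> nat \<Rightarrow> nat \<Rightarrow> 'a" where
  "slice v j = (\<lambda>k. v (j, k))"

text \<open>The map \<open>f + h\<close> on the direct sum of the terms in degrees below
  \<open>i\<close>; it exchanges the two parities. Without truncation its square is \<open>c\<close>
  plus the square of \<open>h\<close>, and the latter raises the degree by 2. It is thus triangular
  with \<open>c\<close> on the diagonal, hence injective where \<open>c\<close> is
  invertible.\<close>

definition total :: "nat \<Rightarrow> (nat \<times> nat \<Rightarrow> 'a) \<Rightarrow> nat \<times> nat \<Rightarrow> 'a" where
  "total i v = (\<lambda>(j, k). if j < i then
      (if Suc j < i then f (Suc j) (slice v (Suc j)) k else \<zero>) \<oplus>
      (if j > 0 then h (j - 1) (slice v (j - 1)) k else \<zero>) else \<zero>)"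

lemma finite_graded_index: "finite (graded_index i e)"
  by (rule finite_subset[of _ "(SIGMA j : {..<i}. {..<\<beta> j})"]) (auto simp: graded_index_def)

lemma card_graded_index: "card (graded_index i e) = (\<Sum>j | j < i \<and> even j = e. \<beta> j)"
proof -
  have "graded_index i e = (SIGMA j : {j. j < i \<and> even j = e}. {..<\<beta> j})"
    by (auto simp: graded_index_def)
  then show ?thesis by simp
qed

abbreviation G :: "nat \<Rightarrow> bool \<Rightarrow> (nat \<times> nat \<Rightarrow> 'a) set" where
  "G i e \<equiv> carrier (free_module R (graded_index i e))"

lemma slice_closed:
  assumes "v \<in> G i e"
  shows "slice v j \<in> F j"
proof -
  have "v (j, k) \<in> carrier R" for k using free_module_entry[OF finite_graded_index assms] .
  moreover have "v (j, k) = \<zero>" if "k \<ge> \<beta> j" for k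
    using free_module_outside[OF assms] that by (auto simp: graded_index_def)
  ultimately show ?thesis by (auto simp: free_module_carrier slice_def)
qed

lemma slice_zero: "v \<in> G i e \<Longrightarrow> even j \<noteq> e \<or> j \<ge> i \<Longrightarrow> slice v j = (\<lambda>k. \<zero>)"
  using finite_graded_index[of i e]
  by (auto simp: free_module_carrier slice_def graded_index_def)

lemma f_zero: "f (Suc j) (\<lambda>k. \<zero>) k = \<zero>"
  by (rule free_hom_zero[OF _ _ f]) auto

lemma h_zero: "h j (\<lambda>k. \<zero>) k = \<zero>"
  by (rule free_hom_zero[OF _ _ h]) auto

lemma total_hom:
  "total i \<in> mod_hom R (free_module R (graded_index i e)) (free_module R (graded_index i (\<not> e)))"
proof (rule free_homI[OF finite_graded_index finite_graded_index])
  have fc: "f (Suc j) (slice v (Suc j)) k \<in> carrier R" "h j (slice v j) k \<in> carrier R"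
    if "v \<in> G i e" for v j k
    using F_entry[OF f_closed[OF slice_closed[OF that]]] F_entry[OF h_closed[OF slice_closed[OF that]]] by auto
  show "total i v \<in> G i (\<not> e)" if v: "v \<in> G i e" for v
  proof -
    have "total i v (j, k) = \<zero>" if jk: "(j, k) \<notin> graded_index i (\<not> e)" for j k
    proof -
      have "j \<ge> i \<or> \<beta> j \<le> k \<or> (j < i \<and> even j = e)"
        using jk by (auto simp: graded_index_def)
      then consider "j \<ge> i" | "\<beta> j \<le> k" | "j < i" "even j = e" by blast
      then show ?thesis
      proof cases
        case 1
        then show ?thesis by (simp add: total_def)
      next
        case 2
        have "f (Suc j) (slice v (Suc j)) k = \<zero>"
          using f_closed[OF slice_closed[OF v, of "Suc j"]] 2 by (simp add: free_module_carrier)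
        moreover have "j > 0 \<Longrightarrow> h (j - 1) (slice v (j - 1)) k = \<zero>"
          using h_closed[OF slice_closed[OF v, of "j - 1"]] 2 by (simp add: free_module_carrier)
        ultimately show ?thesis by (cases j) (auto simp: total_def)
      next
        case 3
        have "slice v (Suc j) = (\<lambda>k. \<zero>)" using 3 by (intro slice_zero[OF v]) auto
        moreover have "j > 0 \<Longrightarrow> slice v (j - 1) = (\<lambda>k. \<zero>)" using 3 by (intro slice_zero[OF v]) (cases j, auto)
        ultimately show ?thesis using f_zero h_zero by (auto simp: total_def)
      qed
    qed
    moreover have "total i v (j, k) \<in> carrier R" for j k using fc[OF v] by (auto simp: total_def)
    ultimately show ?thesis using finite_graded_index by (auto simp: free_module_carrier)
  qed
  show "total i (\<lambda>x. v x \<oplus> w x) y = total i v y \<oplus> total i w y" if vw: "v \<in> G i e" "w \<in> G i e" for v w y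
  proof -
    have s: "slice (\<lambda>x. v x \<oplus> w x) j = (\<lambda>k. slice v j k \<oplus> slice w j k)" for j
      by (simp add: slice_def)
    have f': "f (Suc j) (\<lambda>k. slice v (Suc j) k \<oplus> slice w (Suc j) k) k = f (Suc j) (slice v (Suc j)) k \<oplus> f (Suc j) (slice w (Suc j)) k"
      for j k by (rule free_hom_add[OF _ _ f]) (use vw slice_closed in auto)
    have h': "h j (\<lambda>k. slice v j k \<oplus> slice w j k) k = h j (slice v j) k \<oplus> h j (slice w j) k"
      for j k by (rule free_hom_add[OF _ _ h]) (use vw slice_closed in auto)
    show ?thesis
      using fc[OF vw(1)] fc[OF vw(2)] by (cases y) (auto simp: total_def s f' h' a_ac)
  qed
  show "total i (\<lambda>x. a \<otimes> v x) y = a \<otimes> total i v y" if a: "a \<in> carrier R" and v: "v \<in> G i e" for a v y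
  proof -
    have s: "slice (\<lambda>x. a \<otimes> v x) j = (\<lambda>k. a \<otimes> slice v j k)" for j
      by (simp add: slice_def)
    have f': "f (Suc j) (\<lambda>k. a \<otimes> slice v (Suc j) k) k = a \<otimes> f (Suc j) (slice v (Suc j)) k" for j k
      by (rule free_hom_smult[OF _ _ f]) (use a v slice_closed in auto)
    have h': "h j (\<lambda>k. a \<otimes> slice v j k) k = a \<otimes> h j (slice v j) k" for j k
      by (rule free_hom_smult[OF _ _ h]) (use a v slice_closed in auto)
    show ?thesis using fc[OF v] a by (cases y) (auto simp: total_def s f' h' r_distr)
  qed
qed

text \<open>If \<open>v\<close> is supported in degrees of one parity, only one summand of the total map interacts with
  \<open>v\<^sub>j\<close> from below, so that \<open>v\<^sub>j\<close> vanishes modulo \<open>q\<close> by induction on \<open>j\<close>.\<close>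

lemma total_inj:
  assumes v: "v \<in> G i e"
    and lower: "\<And>j k. Suc j < i \<Longrightarrow> total i v (j, k) \<in> q"
    and top: "\<And>j k. Suc (Suc j) = i \<Longrightarrow> f (Suc j) (slice (total i v) (Suc j)) k \<in> q"
    and last: "\<And>j w k. Suc j = i \<Longrightarrow> even j = e \<Longrightarrow> w \<in> F i \<Longrightarrow> f i w k \<in> q"
  shows "v (j, k) \<in> q"
proof -
  have "\<forall>k. slice v j k \<in> q" for j
  proof (induction j rule: less_induct)
    case (less j)
    show ?case
    proof (cases "j < i \<and> even j = e")
      case False
      then have "slice v j = (\<lambda>k. \<zero>)" by (intro slice_zero[OF v]) auto
      then show ?thesis by simp
    next
      case True
      then have j: "j < i" and e: "even j = e" by auto
      note sc = slice_closed[OF v]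
      have below: "f j (slice v j) k \<in> q" if "j = Suc j'" for j' k
      proof -
        have "f (Suc j') (slice v (Suc j')) k \<oplus> (if j' > 0 then h (j' - 1) (slice v (j' - 1)) k else \<zero>) \<in> q"
          using lower[of j' k] j that by (auto simp: total_def)
        moreover have "(if j' > 0 then h (j' - 1) (slice v (j' - 1)) k else \<zero>) \<in> q"
          using less.IH[of "j' - 1"] that by (auto intro!: h_mod sc)
        ultimately show ?thesis
          using F_entry[OF f_closed[OF sc[of "Suc j'"]], of k] that by (auto intro: sum_mem_left)
      qed
      \<comment> \<open>Applying \<open>f (Suc j)\<close> to the component of the total map in
        degree \<open>Suc j\<close> removes the contribution of \<open>v\<close> from two degrees
        above, since two successive maps compose to zero.\<close>
      have above: "f (Suc j) (h j (slice v j)) k \<in> q" for k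
      proof (cases "Suc j = i")
        case True
        \<comment> \<open>In the top degree \<open>h j\<close> leaves the truncation, so the bound
          must come from \<open>f i\<close> itself.\<close>
        then show ?thesis using last[OF True e h_closed[OF sc, of j, unfolded True]] by simp
      next
        case False
        with j have j': "Suc j < i" by simp
        have T: "f (Suc j) (slice (total i v) (Suc j)) k \<in> q" 
        proof (cases "Suc (Suc j) = i")
          case True
          then show ?thesis by (rule top)
        next
          case False
          then have "Suc (Suc j) < i" using j' by simp
          then show ?thesis
            using lower slice_closed[OF mod_hom_closed[OF total_hom v]]
            by (intro f_mod) (auto simp: slice_def)
        qed
        let ?w = "if Suc (Suc j) < i then f (Suc (Suc j)) (slice v (Suc (Suc j))) else (\<lambda>k. \<zero>)"
        have w: "?w \<in> F (Suc j)" using f_closed[OF sc] by (auto simp: free_module_carrier)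
        have "slice (total i v) (Suc j) = (\<lambda>k. ?w k \<oplus> h j (slice v j) k)"
          using j' by (auto simp: slice_def total_def)
        then have "f (Suc j) (slice (total i v) (Suc j)) k = f (Suc j) ?w k \<oplus> f (Suc j) (h j (slice v j)) k"
          using free_hom_add[OF _ _ f w h_closed[OF sc]] by simp
        moreover have "f (Suc j) ?w k = \<zero>" using complex[OF sc] f_zero by auto
        ultimately show ?thesis
          using T F_entry[OF f_closed[OF h_closed[OF sc[of j]]], of k] by simp
      qed
      show ?thesis
      proof
        fix k
        have "c \<otimes> slice v j k \<in> q"
        proof (cases j)
          case 0
          then show ?thesis using above[of k] homotopy_0[OF sc[of 0], of k] by simp
        next
          case (Suc j')
          have "h j' (f (Suc j') (slice v (Suc j'))) k \<in> q"
            using below[OF Suc] Suc by (intro h_mod f_closed sc) auto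
          then have "f (Suc (Suc j')) (h (Suc j') (slice v (Suc j'))) k \<oplus> h j' (f (Suc j') (slice v (Suc j'))) k \<in> q"
            using above[of k] Suc by (intro sum_mem) auto
          then show ?thesis using homotopy_Suc[OF sc[of "Suc j'"], of k] Suc by simp
        qed
        then show "slice v j k \<in> q" using I_prime[OF c(1) F_entry[OF sc[of j], of k]] c(2) by auto
      qed
    qed
  qed
  then show ?thesis by (auto simp: slice_def)
qed

section \<open>Ranks modulo the prime and the alternating sum\<close>

lemma card_le_if_inj:
  assumes AB: "finite A" "finite B" and T: "T \<in> mod_hom R (free_module R A) (free_module R B)"
    and inj: "\<And>v x. v \<in> carrier (free_module R A) \<Longrightarrow> (\<And>y. y \<in> B \<Longrightarrow> T v y \<in> q) \<Longrightarrow> x \<in> A \<Longrightarrow> v x \<in> q"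
  shows "card A \<le> card B"
proof (rule ccontr)
  assume "\<not> card A \<le> card B"
  then have "card B < card A" by simp
  from homogeneous_system[OF AB this T] show False using inj by blast
qed

text \<open>The homotopy relation in degree \<open>i - 1\<close> involves \<open>f i\<close>, which the truncation to degrees below
  \<open>i\<close> lacks; the other parity is not affected.\<close>

lemma card_le:
  assumes "i > 0"
  shows "card (graded_index i (odd (i - 1))) \<le> card (graded_index i (even (i - 1)))"
proof (rule card_le_if_inj[OF finite_graded_index finite_graded_index])
  show "total i \<in> mod_hom R (free_module R (graded_index i (odd (i - 1))))
    (free_module R (graded_index i (even (i - 1))))"
    using total_hom[of i "odd (i - 1)"] by simp
  fix v x
  assume v: "v \<in> G i (odd (i - 1))" and Tq: "\<And>y. y \<in> graded_index i (even (i - 1)) \<Longrightarrow> total i v y \<in> q"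
    and x: "x \<in> graded_index i (odd (i - 1))"
  have T: "total i v \<in> G i (even (i - 1))" using mod_hom_closed[OF total_hom v] by simp
  have Tq': "total i v y \<in> q" for y
    using Tq[of y] free_module_outside[OF T, of y] additive_subgroup.zero_closed[OF is_additive_subgroup]
    by (cases "y \<in> graded_index i (even (i - 1))") auto
  obtain j k where "x = (j, k)" by (cases x)
  moreover have "v (j, k) \<in> q"
  proof (rule total_inj[OF v])
    show "f (Suc j) (slice (total i v) (Suc j)) k \<in> q" for j k
      using Tq' by (intro f_mod slice_closed[OF T]) (auto simp: slice_def)
  qed (use Tq' in auto)
  ultimately show "v x \<in> q" by simp
qed

text \<open>If \<open>f i\<close> vanishes modulo \<open>q\<close>, the homotopy relation also holds
  modulo \<open>q\<close> in the top degree of the truncation, so the total map is injective on both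
  parities.\<close>

lemma card_eq_if_map_zero:
  assumes "i > 0" and zero: "\<And>w k. w \<in> F i \<Longrightarrow> f i w k \<in> q"
  shows "card (graded_index i (odd (i - 1))) = card (graded_index i (even (i - 1)))"
proof (rule antisym[OF card_le[OF assms(1)]])
  show "card (graded_index i (even (i - 1))) \<le> card (graded_index i (odd (i - 1)))"
  proof (rule card_le_if_inj[OF finite_graded_index finite_graded_index])
    show "total i \<in> mod_hom R (free_module R (graded_index i (even (i - 1))))
      (free_module R (graded_index i (odd (i - 1))))"
      using total_hom[of i "even (i - 1)"] by simp
    fix v x
    assume v: "v \<in> G i (even (i - 1))" and Tq: "\<And>y. y \<in> graded_index i (odd (i - 1)) \<Longrightarrow> total i v y \<in> q"
      and x: "x \<in> graded_index i (even (i - 1))"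
    have T: "total i v \<in> G i (odd (i - 1))" using mod_hom_closed[OF total_hom v] by simp
    have Tq': "total i v y \<in> q" for y
      using Tq[of y] free_module_outside[OF T, of y] additive_subgroup.zero_closed[OF is_additive_subgroup]
    by (cases "y \<in> graded_index i (odd (i - 1))") auto
    obtain j k where "x = (j, k)" by (cases x)
    moreover have "v (j, k) \<in> q"
    proof (rule total_inj[OF v])
      show "f (Suc j) (slice (total i v) (Suc j)) k \<in> q" for j k
        using Tq' by (intro f_mod slice_closed[OF T]) (auto simp: slice_def)
    qed (use Tq' zero in auto)
    ultimately show "v x \<in> q" by simp
  qed
qed

text \<open>On the parity opposite to that of \<open>i - 1\<close> the total map is injective over
  the fraction field, so equal cardinalities make it surjective there. Thus a multiple of
  \<open>f i w\<close>, placed in degree \<open>i - 1\<close>, is the image of some vector modulo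
  \<open>q\<close>. As \<open>f i w\<close> is a cycle, injectivity still forces this vector to
  vanish modulo \<open>q\<close>, and \<open>f i w\<close> with it.\<close>

lemma map_zero_if_card_eq:
  assumes "i > 0" and eq: "card (graded_index i (odd (i - 1))) = card (graded_index i (even (i - 1)))"
    and w: "w \<in> F i"
  shows "f i w k \<in> q"
proof -
  define A where "A = graded_index i (odd (i - 1))"
  define B where "B = graded_index i (even (i - 1))"
  \<comment> \<open>A fresh index, since the indices in \<open>A\<close> and \<open>B\<close> have
    degree below \<open>i\<close>. It carries the coefficient of the additional column
    \<open>v\<close>.\<close>
  define z where "z = (i, 0::nat)"
  have fin: "finite A" "finite B" and z: "z \<notin> A" "z \<notin> B"
    using finite_graded_index by (auto simp: A_def B_def z_def graded_index_def)
  obtain i' where i: "i = Suc i'" using assms(1) by (cases i) auto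
  define v where "v = (\<lambda>(j, k). if j = i' then f i w k else \<zero>)"
  have fw: "f i w \<in> F i'" using f_closed[of w i'] w i by simp
  have v: "v \<in> carrier (free_module R B)"
    using fw fin(2) by (auto simp: free_module_carrier v_def B_def graded_index_def i)
  have restr: "(\<lambda>x. if x \<in> A then u x else \<zero>) \<in> carrier (free_module R A)"
    if "u \<in> carrier (free_module R (insert z A))" for u
    using that fin by (auto simp: free_module_carrier)
  have T: "total i \<in> mod_hom R (free_module R A) (free_module R B)"
    using total_hom[of i "odd (i - 1)"] by (simp add: A_def B_def)
  define U where "U u = (\<lambda>y. total i (\<lambda>x. if x \<in> A then u x else \<zero>) y \<oplus> u z \<otimes> v y)" for u
  have zA: "finite (insert z A)" using fin by simp
  note uz = free_module_entry[OF zA]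
  note vc = free_module_entry[OF fin(2) v]
  have Tc: "total i (\<lambda>x. if x \<in> A then u x else \<zero>) y \<in> carrier R"
    if "u \<in> carrier (free_module R (insert z A))" for u y
    using free_hom_entry[OF fin(2) T restr[OF that]] .
  have "U \<in> mod_hom R (free_module R (insert z A)) (free_module R B)"
  proof (rule free_homI[OF zA fin(2)])
    show "U u \<in> carrier (free_module R B)" if "u \<in> carrier (free_module R (insert z A))" for u
      unfolding U_def using mod_hom_closed[OF T restr] v uz that
      by (intro free_module_closed[OF fin(2)]) auto
  next
    fix u u' y assume u: "u \<in> carrier (free_module R (insert z A))" "u' \<in> carrier (free_module R (insert z A))"
    have "(\<lambda>x. if x \<in> A then u x \<oplus> u' x else \<zero>) =
        (\<lambda>x. (if x \<in> A then u x else \<zero>) \<oplus> (if x \<in> A then u' x else \<zero>))" by auto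
    then have "total i (\<lambda>x. if x \<in> A then u x \<oplus> u' x else \<zero>) y =
        total i (\<lambda>x. if x \<in> A then u x else \<zero>) y \<oplus> total i (\<lambda>x. if x \<in> A then u' x else \<zero>) y"
      using free_hom_add[OF fin T restr restr, OF u] by simp
    then show "U (\<lambda>x. u x \<oplus> u' x) y = U u y \<oplus> U u' y"
      using Tc[OF u(1)] Tc[OF u(2)] uz[OF u(1), of z] uz[OF u(2), of z] vc
      by (simp add: U_def l_distr a_ac)
  next
    fix a u y assume a: "a \<in> carrier R" and u: "u \<in> carrier (free_module R (insert z A))"
    have "(\<lambda>x. if x \<in> A then a \<otimes> u x else \<zero>) = (\<lambda>x. a \<otimes> (if x \<in> A then u x else \<zero>))"
      using a by auto
    then have "total i (\<lambda>x. if x \<in> A then a \<otimes> u x else \<zero>) y =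
        a \<otimes> total i (\<lambda>x. if x \<in> A then u x else \<zero>) y"
      using free_hom_smult[OF fin T a restr[OF u]] by simp
    then show "U (\<lambda>x. a \<otimes> u x) y = a \<otimes> U u y"
      using Tc[OF u] uz[OF u, of z] vc a by (simp add: U_def r_distr m_assoc)
  qed
  moreover have "card B < card (insert z A)" using z fin eq by (simp add: A_def B_def)
  ultimately obtain u where u: "u \<in> carrier (free_module R (insert z A))"
    and nz: "\<exists>x\<in>insert z A. u x \<notin> q" and Uq: "\<And>y. y \<in> B \<Longrightarrow> U u y \<in> q"
    using homogeneous_system[OF zA fin(2)] by blast
  define a where "a = (\<lambda>x. if x \<in> A then u x else \<zero>)"
  have a: "a \<in> carrier (free_module R A)" unfolding a_def by (rule restr[OF u])
  then have a': "a \<in> G i (odd (i - 1))" by (simp add: A_def)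
  have uzc: "u z \<in> carrier R" using uz[OF u] .
  have Ta: "total i a \<in> carrier (free_module R B)" using mod_hom_closed[OF T a] .
  have Tv: "total i a y \<oplus> u z \<otimes> v y \<in> q" for y
  proof (cases "y \<in> B")
    case True
    then show ?thesis using Uq[OF True] by (simp add: U_def a_def)
  next
    case False
    then have "total i a y = \<zero>" "v y = \<zero>" using Ta v by (auto intro: free_module_outside)
    then show ?thesis using uzc by simp
  qed
  have aq: "a (j, k) \<in> q" for j k
  proof (rule total_inj[OF a'])
    show "total i a (j, k) \<in> q" if "Suc j < i" for j k
      using Tv[of "(j, k)"] that uzc free_module_entry[OF fin(2) Ta, of "(j,k)"] by (simp add: v_def i)
  next
    \<comment> \<open>In degree \<open>i - 1\<close> the values of the total map are known modulo
      \<open>q\<close> only up to a multiple of \<open>f i w\<close>. This is why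
      \<open>total_inj\<close> tests that degree only after \<open>f (Suc j)\<close>, which kills
      the multiple.\<close>
    fix j k assume j: "Suc (Suc j) = i"
    have sl: "slice (total i a) (Suc j) \<in> F (Suc j)"
      using slice_closed[of "total i a" i "even (i - 1)"] Ta by (simp add: B_def)
    have "f (Suc j) (\<lambda>k. slice (total i a) (Suc j) k \<oplus> u z \<otimes> f i w k) k \<in> q"
    proof (rule f_mod)
      show "(\<lambda>k. slice (total i a) (Suc j) k \<oplus> u z \<otimes> f i w k) \<in> F (Suc j)"
        using sl fw uzc i j by (intro free_module_closed) auto
      show "slice (total i a) (Suc j) k \<oplus> u z \<otimes> f i w k \<in> q" for k
        using Tv[of "(Suc j, k)"] i j by (simp add: slice_def v_def)
    qed
    also have "f (Suc j) (\<lambda>k. slice (total i a) (Suc j) k \<oplus> u z \<otimes> f i w k) k =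
        f (Suc j) (slice (total i a) (Suc j)) k \<oplus> f (Suc j) (\<lambda>k. u z \<otimes> f i w k) k"
      using sl fw uzc i j by (intro free_hom_add[OF _ _ f] free_module_closed) auto
    also have "f (Suc j) (\<lambda>k. u z \<otimes> f i w k) k = u z \<otimes> f (Suc j) (f i w) k"
      using fw uzc i j by (intro free_hom_smult[OF _ _ f]) auto
    also have "f (Suc j) (f i w) k = \<zero>" using complex[of w j k] w j by simp
    finally show "f (Suc j) (slice (total i a) (Suc j)) k \<in> q"
      using uzc F_entry[OF f_closed[OF sl], of k] by simp
  qed (use i in auto)
  \<comment> \<open>Otherwise the whole solution \<open>u\<close> would vanish modulo
    \<open>q\<close>.\<close>
  have "u z \<notin> q"
  proof
    assume "u z \<in> q"
    with nz obtain x where "x \<in> A" "u x \<notin> q" by auto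
    then show False using aq[of "fst x" "snd x"] by (simp add: a_def)
  qed
  moreover have "total i a y \<in> q" for y
    by (rule free_hom_mod_ideal[OF fin T a ideal_axioms]) (use aq in auto)
  then have "u z \<otimes> v (i', k) \<in> q" using sum_mem_right[OF Tv] uzc vc by auto
  then have "u z \<in> q \<or> v (i', k) \<in> q" using I_prime[OF uzc vc] by auto
  ultimately show ?thesis by (simp add: v_def)
qed

lemma sum_parity:
  "int (card (graded_index i True)) - int (card (graded_index i False)) = (\<Sum>j<i. (-1) ^ j * int (\<beta> j))"
proof -
  have "(\<Sum>j<i. (-1) ^ j * int (\<beta> j)) =
      (\<Sum>j\<in>{j. j < i \<and> even j = True} \<union> {j. j < i \<and> even j = False}. (-1) ^ j * int (\<beta> j))"
    by (intro sum.cong) auto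
  also have "\<dots> = (\<Sum>j | j < i \<and> even j = True. (-1) ^ j * int (\<beta> j)) +
      (\<Sum>j | j < i \<and> even j = False. (-1) ^ j * int (\<beta> j))"
    by (intro sum.union_disjoint) auto
  also have "(\<Sum>j | j < i \<and> even j = True. (-1) ^ j * int (\<beta> j)) = (\<Sum>j | j < i \<and> even j = True. int (\<beta> j))"
    by (intro sum.cong) auto
  also have "(\<Sum>j | j < i \<and> even j = False. (-1) ^ j * int (\<beta> j)) = - (\<Sum>j | j < i \<and> even j = False. int (\<beta> j))"
    by (subst sum_negf[symmetric], intro sum.cong) auto
  finally show ?thesis by (simp add: card_graded_index)
qed

text \<open>Up to sign, the sum is the rank of \<open>f i\<close> over the fraction field of
  \<open>R/q\<close>, as in a split exact complex. Only the vanishing of this rank is needed, and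
  the right-hand side is independent of \<open>q\<close>.\<close>

lemma map_zero_iff_alternating_sum:
  assumes "i > 0"
  shows "(\<forall>w\<in>F i. \<forall>k. f i w k \<in> q) \<longleftrightarrow> (\<Sum>j<i. (-1) ^ j * int (\<beta> j)) = 0"
proof -
  have "(\<forall>w\<in>F i. \<forall>k. f i w k \<in> q) \<longleftrightarrow>
      card (graded_index i (odd (i - 1))) = card (graded_index i (even (i - 1)))"
    using card_eq_if_map_zero[OF assms] map_zero_if_card_eq[OF assms] by blast
  also have "\<dots> \<longleftrightarrow> card (graded_index i True) = card (graded_index i False)"
    by (cases "even (i - 1)") auto
  also have "\<dots> \<longleftrightarrow> (\<Sum>j<i. (-1) ^ j * int (\<beta> j)) = 0"
    by (simp add: sum_parity[symmetric])
  finally show ?thesis .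
qed

text \<open>The composite of \<open>h 0\<close> and \<open>f 1\<close> is multiplication by
  \<open>c\<close>, so \<open>h 0\<close> is injective modulo \<open>q\<close>.\<close>

lemma betti_0_le: "\<beta> 0 \<le> \<beta> 1"
proof -
  have "card {..<\<beta> 0} \<le> card {..<\<beta> 1}"
  proof (rule card_le_if_inj[OF _ _ h, of 0, unfolded One_nat_def[symmetric]])
    fix v x assume v: "v \<in> F 0" and hv: "\<And>y. y \<in> {..<\<beta> 1} \<Longrightarrow> h 0 v y \<in> q"
    have "h 0 v y \<in> q" for y
      using hv[of y] free_module_outside[OF h_closed[OF v], of y] additive_subgroup.zero_closed[OF is_additive_subgroup]
      by (cases "y < \<beta> 1") auto
    then have "f (Suc 0) (h 0 v) x \<in> q" by (intro f_mod h_closed[OF v])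
    then have "c \<otimes> v x \<in> q" using homotopy_0[OF v] by simp
    then show "v x \<in> q" using I_prime[OF c(1) F_entry[OF v]] c(2) by auto
  qed auto
  then show ?thesis by simp
qed

text \<open>The relations \<open>c v = f h v\<close> express the entries of \<open>v\<close> in terms of each other with coefficients
  in \<open>q\<close>, so they vanish at \<open>q\<close> by Nakayama's lemma.\<close>

lemma annihilator_if_map_zero:
  assumes zero: "\<And>w k. w \<in> F (Suc i) \<Longrightarrow> f (Suc i) w k \<in> q" and w: "w \<in> F (Suc i)"
  shows "\<exists>t\<in>carrier R - q. \<forall>k. t \<otimes> f (Suc i) w k = \<zero>"
proof -
  define v where "v = f (Suc i) w"
  have v: "v \<in> F i" unfolding v_def by (rule f_closed[OF w])
  \<comment> \<open>As a boundary, \<open>v\<close> is a cycle, so the other term of the homotopy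
    relation vanishes.\<close>
  have fh: "f (Suc i) (h i v) k = c \<otimes> v k" for k
  proof (cases i)
    case 0
    then show ?thesis using homotopy_0[of v k] v by simp
  next
    case (Suc i')
    have "f (Suc i') v = (\<lambda>k. \<zero>)" unfolding v_def using complex[of w i'] w Suc by auto
    then show ?thesis
      using homotopy_Suc[of v i' k] v Suc h_zero F_entry[OF f_closed[OF h_closed[of v i]], of k] by simp
  qed
  define D where "D k k' = f (Suc i) (h i (unit_vec R k')) k" for k k'
  have D: "D k k' \<in> q" if "k' < \<beta> i" for k k'
    unfolding D_def using that by (intro zero h_closed unit_vec_closed) auto
  have vc: "v k \<in> carrier R" for k using F_entry[OF v] .
  have Dv: "(\<Oplus>k'\<in>{..<\<beta> i}. v k' \<otimes> D k k') = c \<otimes> v k" for k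
  proof -
    have "(\<lambda>v. f (Suc i) (h i v)) \<in> mod_hom R (free_module R {..<\<beta> i}) (free_module R {..<\<beta> i})"
      using f[of i] h[of i] by (auto simp: mod_hom_def Pi_iff)
    from free_hom_expand[OF _ _ this v, of k] fh[of k] show ?thesis by (simp add: D_def)
  qed
  define A where "A k k' = (if k' = k then c else \<zero>) \<ominus> D k k'" for k k'
  have "\<exists>n::nat. \<exists>t\<in>carrier R - q. \<forall>k<\<beta> i. t \<otimes> v k \<in> {\<zero>}"
  \<comment> \<open>With constant families, elimination only distinguishes elements outside
    \<open>q\<close> from elements of \<open>q\<close>. The target ideal is zero, so the resulting
    equations hold exactly and not only modulo \<open>q\<close>.\<close>
  proof (rule elimination[where T = "\<lambda>n. carrier R - q" and H = "\<lambda>n. q" and A = A and n = 0])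
    have diff: "s \<ominus> x \<in> carrier R - q" if "s \<in> carrier R - q" "x \<in> q" for s x
    proof -
      have "s \<in> q" if "s \<ominus> x \<in> q"
        using sum_mem_left[OF that[unfolded a_minus_def] additive_subgroup.a_inv_closed[OF is_additive_subgroup \<open>x \<in> q\<close>]]
          \<open>s \<in> carrier R - q\<close> by auto
      then show ?thesis using that Icarr by auto
    qed
    have prod: "s \<otimes> t \<in> carrier R - q" if "s \<in> carrier R - q" "t \<in> carrier R - q" for s t
      using that I_prime by auto
    show "s \<otimes> t \<ominus> x \<otimes> y \<in> carrier R - q"
      if "s \<in> carrier R - q" "t \<in> carrier R - q" "x \<in> q" "y \<in> q" for s t x y
      using that by (intro diff prod I_l_closed) (auto dest: Icarr)
    show "\<exists>k. s \<otimes> t \<in> carrier R - q" if "s \<in> carrier R - q" "t \<in> carrier R - q" for s t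
      using prod[OF that] by blast
    show "t \<otimes> x \<ominus> y \<otimes> z \<in> q" if "t \<in> carrier R - q" "x \<in> q" "y \<in> q" "z \<in> q" for t x y z
      unfolding a_minus_def using that
      by (intro sum_mem additive_subgroup.a_inv_closed[OF is_additive_subgroup] I_l_closed) (auto dest: Icarr)
    show "\<exists>n. \<one> \<in> carrier R - q" using I_notcarr one_imp_carrier by auto
    show "A k k \<in> carrier R - q" if "k < \<beta> i" for k
      using diff[OF _ D[OF that]] c by (simp add: A_def)
    show "A k k' \<in> q" if "k < \<beta> i" "k' < \<beta> i" "k \<noteq> k'" for k k'
      using additive_subgroup.a_inv_closed[OF is_additive_subgroup D[OF that(2), of k]]
        Icarr[OF D[OF that(2), of k]] that by (simp add: A_def a_minus_def)
    fix k assume k: "k < \<beta> i"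
    have "(\<Oplus>k'\<in>{..<\<beta> i}. A k k' \<otimes> v k') =
        (\<Oplus>k'\<in>{..<\<beta> i}. (if k = k' then c \<otimes> v k' else \<zero>) \<oplus> \<ominus> \<one> \<otimes> (v k' \<otimes> D k k'))"
      using vc Icarr[OF D] c by (intro finsum_cong') (auto simp: A_def a_minus_def l_distr r_distr l_minus r_minus m_comm)
    also have "\<dots> = (\<Oplus>k'\<in>{..<\<beta> i}. if k = k' then c \<otimes> v k' else \<zero>) \<oplus> \<ominus> \<one> \<otimes> (\<Oplus>k'\<in>{..<\<beta> i}. v k' \<otimes> D k k')"
      using vc Icarr[OF D] c by (subst finsum_addf) (auto intro!: finsum_rdistr[symmetric])
    also have "(\<Oplus>k'\<in>{..<\<beta> i}. if k = k' then c \<otimes> v k' else \<zero>) = c \<otimes> v k"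
      using finsum_singleton[of k "{..<\<beta> i}" "\<lambda>k. c \<otimes> v k"] k c vc by auto
    finally show "(\<Oplus>k'\<in>{..<\<beta> i}. A k k' \<otimes> v k') \<in> {\<zero>}"
      unfolding Dv using c vc by (simp add: l_minus r_neg)
  qed (use vc Icarr zeroideal in auto)
  then obtain t where t: "t \<in> carrier R - q" "\<And>k. k < \<beta> i \<Longrightarrow> t \<otimes> v k = \<zero>" by auto
  have "t \<otimes> v k = \<zero>" for k
    using t free_module_outside[OF v, of k] by (cases "k < \<beta> i") auto
  then show ?thesis using t(1) v_def by auto
qed

end


section \<open>Resolutions of modules of finite length\<close>

lemma (in noetherian_ring) exists_maximalideal_above:
  assumes "cring R" "ideal I R" "I \<noteq> carrier R"
  obtains J where "maximalideal J R" "I \<subseteq> J"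
proof -
  interpret cring R by fact
  let ?F = "{J. ideal J R \<and> I \<subseteq> J \<and> J \<noteq> carrier R}"
  obtain J where J: "J \<in> ?F" and max: "\<And>J'. J' \<in> ?F \<Longrightarrow> J \<subseteq> J' \<Longrightarrow> J' = J"
    by (rule exists_maximal_ideal_in_family[of ?F]) (use assms in auto)
  have "maximalideal J R"
  proof (rule maximalidealI)
    show "J' = J \<or> J' = carrier R" if "ideal J' R" "J \<subseteq> J'" for J'
      using max[of J'] that J by blast
  qed (use J in auto)
  then show thesis using that J by auto
qed

section \<open>Local rings and Nakayama's lemma\<close>

locale noetherian_local_cring = cring R + noetherian_ring R for R (structure) +
  assumes unique_maximalideal: "\<exists>!\<mm>. maximalideal \<mm> R"
begin

abbreviation "\<mm> \<equiv> max_ideal R"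

lemma maximalideal_max_ideal: "maximalideal \<mm> R"
  unfolding max_ideal_def by (rule theI'[OF unique_maximalideal])

lemma ideal_max_ideal: "ideal \<mm> R"
  using maximalideal_max_ideal by (rule maximalideal.axioms(1))

lemma proper_ideal_le: "ideal I R \<Longrightarrow> I \<noteq> carrier R \<Longrightarrow> I \<subseteq> \<mm>"
  using exists_maximalideal_above[OF is_cring] unique_maximalideal maximalideal_max_ideal by metis

lemma prime_le: "primeideal p R \<Longrightarrow> p \<subseteq> \<mm>"
  by (rule proper_ideal_le) (auto dest: primeideal.axioms(1) primeideal.I_notcarr)

lemma exists_inverse:
  assumes "x \<in> carrier R" "x \<notin> \<mm>"
  shows "\<exists>s\<in>carrier R. s \<otimes> x = \<one>"
proof -
  have "PIdl x = carrier R"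
    using proper_ideal_le[OF cgenideal_ideal[OF assms(1)]] cgenideal_self[OF assms(1)] assms(2) by auto
  then have "\<one> \<in> PIdl x" by simp
  then show ?thesis by (auto simp: cgenideal_def)
qed

lemma one_minus_inverse:
  assumes "a \<in> \<mm>"
  shows "\<exists>s\<in>carrier R. s \<otimes> (\<one> \<ominus> a) = \<one>"
proof (rule exists_inverse)
  interpret m: maximalideal \<mm> R by (rule maximalideal_max_ideal)
  have a: "a \<in> carrier R" using assms m.Icarr by auto
  show "\<one> \<ominus> a \<in> carrier R" using a by simp
  show "\<one> \<ominus> a \<notin> \<mm>"
  proof
    assume "\<one> \<ominus> a \<in> \<mm>"
    then have "\<one> \<ominus> a \<oplus> a \<in> \<mm>" using assms by (rule additive_subgroup.a_closed[OF m.is_additive_subgroup])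
    moreover have "\<one> \<ominus> a \<oplus> a = \<one>" using a by (simp add: a_minus_def a_assoc l_neg)
    ultimately show False using m.one_imp_carrier m.I_notcarr by auto
  qed
qed

text \<open>Nakayama's lemma for ideals: the quotient of \<open>J\<close> by a maximal proper subideal is simple,
  hence killed by the maximal ideal.\<close>

lemma exists_subideal_containing_max_mult:
  assumes J: "ideal J R" and J': "ideal J' R" "J' \<subset> J"
  shows "\<exists>K. ideal K R \<and> J' \<subseteq> K \<and> K \<subset> J \<and> (\<forall>a\<in>\<mm>. \<forall>z\<in>J. a \<otimes> z \<in> K)"
proof -
  let ?F = "{K. ideal K R \<and> J' \<subseteq> K \<and> K \<subset> J}"
  obtain K where K: "K \<in> ?F" and max: "\<And>K'. K' \<in> ?F \<Longrightarrow> K \<subseteq> K' \<Longrightarrow> K' = K"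
    by (rule exists_maximal_ideal_in_family[of ?F]) (use J' in auto)
  interpret K: ideal K R using K by simp
  interpret J: ideal J R by fact
  have "a \<otimes> z \<in> K" if a: "a \<in> \<mm>" and z: "z \<in> J" for a z
  proof (rule ccontr)
    assume az: "a \<otimes> z \<notin> K"
    have c: "a \<in> carrier R" "z \<in> carrier R" using ideal.Icarr[OF ideal_max_ideal a] J.Icarr[OF z] by auto
    note I = add_cgenideal[OF K.ideal_axioms m_closed[OF c]]
    have "set_add R K (PIdl (a \<otimes> z)) \<subseteq> J"
    proof
      fix y assume "y \<in> set_add R K (PIdl (a \<otimes> z))"
      then obtain x r where "x \<in> K" "r \<in> carrier R" "y = x \<oplus> r \<otimes> (a \<otimes> z)" using I(4) by blast
      then show "y \<in> J" using K z c by (auto intro!: J.I_l_closed additive_subgroup.a_closed[OF J.is_additive_subgroup])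
    qed
    then have "set_add R K (PIdl (a \<otimes> z)) = J" using max[of "set_add R K (PIdl (a \<otimes> z))"] I(1-3) K az by auto
    then obtain x r where x: "x \<in> K" "r \<in> carrier R" "z = x \<oplus> r \<otimes> (a \<otimes> z)" using I(4) z by blast
    have ra: "r \<otimes> a \<in> \<mm>" using ideal.I_l_closed[OF ideal_max_ideal a x(2)] .
    obtain s where s: "s \<in> carrier R" "s \<otimes> (\<one> \<ominus> r \<otimes> a) = \<one>" using one_minus_inverse[OF ra] by auto
    have "x = x \<oplus> r \<otimes> (a \<otimes> z) \<ominus> r \<otimes> (a \<otimes> z)"
      using c x(2) K.Icarr[OF x(1)] by (simp add: a_minus_def a_assoc r_neg)
    also have "\<dots> = z \<ominus> r \<otimes> (a \<otimes> z)" by (simp only: x(3)[symmetric])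
    also have "\<dots> = (\<one> \<ominus> r \<otimes> a) \<otimes> z" using c x(2) by (simp add: a_minus_def l_distr l_minus m_assoc)
    finally have "s \<otimes> x = z" using s c x(2) by (simp add: m_assoc[symmetric])
    then have "z \<in> K" using K.I_l_closed[OF x(1) s(1)] by simp
    then show False using az K.I_l_closed c by auto
  qed
  then show ?thesis using K by blast
qed

end

lemma noetherian_local_cringI: "noetherian_local_ring R \<Longrightarrow> noetherian_local_cring R"
  by (simp add: noetherian_local_ring_def noetherian_local_cring_def noetherian_local_cring_axioms_def)

section \<open>Chains of submodules in a module of finite length\<close>

lemma submodule_chain_bound:
  assumes "module_length R M < \<infinity>"
  obtains b where "\<And>n N. \<lbrakk>\<And>i. i \<le> n \<Longrightarrow> submodule (N i) R M; \<And>i. i < n \<Longrightarrow> N i \<subset> N (Suc i)\<rbrakk> \<Longrightarrow> n \<le> b"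
proof -
  from assms obtain b where b: "module_length R M = enat b" by auto
  have "n \<le> b" if "\<And>i. i \<le> n \<Longrightarrow> submodule (N i) R M" "\<And>i. i < n \<Longrightarrow> N i \<subset> N (Suc i)" for n N
  proof -
    have "enat n \<le> module_length R M"
      unfolding module_length_def using that by (intro Sup_upper) blast
    then show ?thesis using b by simp
  qed
  then show thesis using that by blast
qed

lemma ascending_submodules_stabilize:
  assumes "module_length R M < \<infinity>" "\<And>i. submodule (N i) R M" "\<And>i. N i \<subseteq> N (Suc i)"
  shows "\<exists>n. N (Suc n) = N n"
proof (rule ccontr)
  assume "\<not> ?thesis"
  then have "N i \<subset> N (Suc i)" for i using assms(3)[of i] by blast
  then show False using submodule_chain_bound[OF assms(1)] assms(2) by (metis not_less_eq_eq order_refl)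
qed

lemma descending_submodules_stabilize:
  assumes len: "module_length R M < \<infinity>" and sub: "\<And>i. submodule (N i) R M" and desc: "\<And>i. N (Suc i) \<subseteq> N i"
  shows "\<exists>n. N (Suc n) = N n"
proof (rule ccontr)
  assume "\<not> ?thesis"
  then have strict: "N (Suc i) \<subset> N i" for i using desc[of i] by blast
  obtain b where b: "\<And>n N. \<lbrakk>\<And>i. i \<le> n \<Longrightarrow> submodule (N i) R M; \<And>i. i < n \<Longrightarrow> N i \<subset> N (Suc i)\<rbrakk> \<Longrightarrow> n \<le> b"
    using submodule_chain_bound[OF len] by blast
  have "Suc b \<le> b"
  proof (rule b[of "Suc b" "\<lambda>i. N (Suc b - i)"])
    show "N (Suc b - i) \<subset> N (Suc b - Suc i)" if "i < Suc b" for i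
      using strict[of "b - i"] that by (simp add: Suc_diff_le)
  qed (rule sub)
  then show False by simp
qed

text \<open>With the sign of its last term made positive, the sum does not decrease when two terms
  are added; it starts from \<open>\<beta> 0\<close> and from \<open>\<beta> 1 - \<beta> 0\<close>,
  both positive.\<close>

lemma alternating_sum_nonzero:
  fixes \<beta> :: "nat \<Rightarrow> nat"
  assumes "0 < \<beta> 0" "\<beta> 0 < \<beta> 1" "\<And>j. \<beta> (Suc j) \<le> \<beta> (Suc (Suc j))" "i > 0"
  shows "(\<Sum>j<i. (-1) ^ j * int (\<beta> j)) \<noteq> 0"
proof -
  have "0 < (-1) ^ i * (\<Sum>j<Suc i. (-1) ^ j * int (\<beta> j))" for i
  proof (induction i rule: induct_nat_012)
    case (ge2 i)
    then show ?case using assms(3)[of i] by (auto simp: algebra_simps)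
  qed (use assms in auto)
  from this[of "i - 1"] show ?thesis using assms(4) by auto
qed

section \<open>The minimal resolution and its homotopies\<close>

locale finite_length_resolution = noetherian_local_cring R for R (structure) +
  fixes M :: "('a, 'c, 'm) module_scheme" and \<beta> f f0
  assumes module_M: "module R M"
    and finite_length: "module_length R M < \<infinity>"
    and resolution: "minimal_free_resolution R M \<beta> f f0"
begin

sublocale M: module R M by (rule module_M)

abbreviation F :: "nat \<Rightarrow> (nat \<Rightarrow> 'a) set" where
  "F j \<equiv> carrier (free_module R {..<\<beta> j})"

lemma f0_hom: "f0 \<in> mod_hom R (free_module R {..<\<beta> 0}) M"
  and f_hom: "f (Suc j) \<in> mod_hom R (free_module R {..<\<beta> (Suc j)}) (free_module R {..<\<beta> j})"
  and f0_surj: "f0 ` F 0 = carrier M"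
  and f_1_image: "f 1 ` F 1 = {v \<in> F 0. f0 v = \<zero>\<^bsub>M\<^esub>}"
  and f_image: "f (Suc (Suc j)) ` F (Suc (Suc j)) = {v \<in> F (Suc j). f (Suc j) v = (\<lambda>k. \<zero>)}"
  and minimal: "v \<in> F (Suc j) \<Longrightarrow> k < \<beta> j \<Longrightarrow> f (Suc j) v k \<in> \<mm>"
  using resolution unfolding minimal_free_resolution_def Let_def a_kernel_def' free_module_zero by auto

lemmas f_closed = mod_hom_closed[OF f_hom]
lemmas f_add = free_hom_add[OF finite_lessThan finite_lessThan f_hom]
lemmas f_smult = free_hom_smult[OF finite_lessThan finite_lessThan f_hom]
lemmas unit_vec_F = unit_vec_closed[OF finite_lessThan, unfolded lessThan_iff]

lemma F_entry: "v \<in> F j \<Longrightarrow> v k \<in> carrier R"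
  by (rule free_module_entry[rotated]) auto

lemma f0_closed: "v \<in> F 0 \<Longrightarrow> f0 v \<in> carrier M"
  using mod_hom_closed[OF f0_hom] .

lemma f0_add: "v \<in> F 0 \<Longrightarrow> w \<in> F 0 \<Longrightarrow> f0 (\<lambda>x. v x \<oplus> w x) = f0 v \<oplus>\<^bsub>M\<^esub> f0 w"
  using mod_hom_add[OF f0_hom] by (simp add: free_module_add)

lemma f0_smult: "a \<in> carrier R \<Longrightarrow> v \<in> F 0 \<Longrightarrow> f0 (\<lambda>x. a \<otimes> v x) = a \<odot>\<^bsub>M\<^esub> f0 v"
  using mod_hom_smult[OF f0_hom] by (simp add: free_module_smult)

lemma entry_mem_max: "v \<in> F (Suc j) \<Longrightarrow> f (Suc j) v k \<in> \<mm>"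
  using minimal[of v j k] free_module_outside[OF f_closed[of v j], of k]
    additive_subgroup.zero_closed[OF ideal.axioms(1)[OF ideal_max_ideal]]
  by (cases "k < \<beta> j") auto

lemma complex: "v \<in> F (Suc (Suc j)) \<Longrightarrow> f (Suc j) (f (Suc (Suc j)) v) k = \<zero>"
  using f_image[of j] by (metis (mono_tags, lifting) imageI mem_Collect_eq)

lemma exact: "v \<in> F (Suc j) \<Longrightarrow> (\<And>k. f (Suc j) v k = \<zero>) \<Longrightarrow> \<exists>w\<in>F (Suc (Suc j)). v = f (Suc (Suc j)) w"
proof -
  assume "v \<in> F (Suc j)" "\<And>k. f (Suc j) v k = \<zero>"
  then have "v \<in> f (Suc (Suc j)) ` F (Suc (Suc j))" unfolding f_image by auto
  then show ?thesis by auto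
qed

lemma exact_0: "v \<in> F 0 \<Longrightarrow> f0 v = \<zero>\<^bsub>M\<^esub> \<Longrightarrow> \<exists>w\<in>F 1. v = f 1 w"
proof -
  assume "v \<in> F 0" "f0 v = \<zero>\<^bsub>M\<^esub>"
  then have "v \<in> f 1 ` F 1" unfolding f_1_image by auto
  then show ?thesis by auto
qed

lemma hom_ext_unit_vec:
  assumes "T \<in> mod_hom R (free_module R {..<m::nat}) (free_module R {..<n::nat})"
    and "U \<in> mod_hom R (free_module R {..<m}) (free_module R {..<n})"
    and "\<And>k. k < m \<Longrightarrow> T (unit_vec R k) = U (unit_vec R k)"
    and "v \<in> carrier (free_module R {..<m})"
  shows "T v = U v"
proof
  fix y
  have "T v y = (\<Oplus>x\<in>{..<m}. v x \<otimes> T (unit_vec R x) y)" "U v y = (\<Oplus>x\<in>{..<m}. v x \<otimes> U (unit_vec R x) y)"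
    using free_hom_expand[OF _ _ assms(1,4)] free_hom_expand[OF _ _ assms(2,4)] by auto
  moreover have "(\<Oplus>x\<in>{..<m}. v x \<otimes> T (unit_vec R x) y) = (\<Oplus>x\<in>{..<m}. v x \<otimes> U (unit_vec R x) y)"
    using assms(3) free_module_entry[OF _ assms(4)] free_hom_entry[OF _ assms(2) unit_vec_closed]
    by (intro finsum_cong') auto
  ultimately show "T v y = U v y" by simp
qed

lemma lift_hom:
  assumes T: "T \<in> mod_hom R (free_module R {..<m::nat}) (free_module R {..<\<beta> j})"
    and im: "\<And>v. v \<in> carrier (free_module R {..<m}) \<Longrightarrow> \<exists>w\<in>F (Suc j). T v = f (Suc j) w"
  shows "\<exists>h\<in>mod_hom R (free_module R {..<m}) (free_module R {..<\<beta> (Suc j)}).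
    \<forall>v\<in>carrier (free_module R {..<m}). f (Suc j) (h v) = T v"
proof -
  have "\<exists>w. k < m \<longrightarrow> w \<in> F (Suc j) \<and> T (unit_vec R k) = f (Suc j) w" for k
    using im[of "unit_vec R k"] unit_vec_F[of k m] by auto
  then obtain g where g: "\<And>k. k < m \<Longrightarrow> g k \<in> F (Suc j)" "\<And>k. k < m \<Longrightarrow> T (unit_vec R k) = f (Suc j) (g k)"
    by metis
  define h where "h v y = (\<Oplus>x\<in>{..<m}. v x \<otimes> g x y)" for v y
  have h: "h \<in> mod_hom R (free_module R {..<m}) (free_module R {..<\<beta> (Suc j)})"
    and hu: "\<And>k. k < m \<Longrightarrow> h (unit_vec R k) = g k"
    using linear_extension[of "{..<m}" "{..<\<beta> (Suc j)}" g] g(1)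
    unfolding h_def[abs_def] by auto
  have fh: "(\<lambda>v. f (Suc j) (h v)) \<in> mod_hom R (free_module R {..<m}) (free_module R {..<\<beta> j})"
    using h f_hom[of j] by (auto simp: mod_hom_def Pi_iff)
  have "f (Suc j) (h v) = T v" if "v \<in> carrier (free_module R {..<m})" for v
    using hom_ext_unit_vec[OF fh T _ that] hu g(2) by simp
  then show ?thesis using h by blast
qed

lemma smult_hom:
  assumes "c \<in> carrier R" "finite B"
  shows "(\<lambda>v k. c \<otimes> v k) \<in> mod_hom R (free_module R B) (free_module R B)"
  using assms free_module_entry[OF assms(2)]
  by (intro free_homI) (auto simp: free_module_closed r_distr m_lcomm)

text \<open>Multiplication by \<open>c\<close> on the resolution lifts the zero map of
  \<open>M\<close>, and lifts to a free resolution are unique up to homotopy.\<close>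

lemma exists_homotopy:
  assumes c: "c \<in> carrier R" and kill: "\<And>x. x \<in> carrier M \<Longrightarrow> c \<odot>\<^bsub>M\<^esub> x = \<zero>\<^bsub>M\<^esub>"
  obtains h where "\<And>j. h j \<in> mod_hom R (free_module R {..<\<beta> j}) (free_module R {..<\<beta> (Suc j)})"
    "\<And>v k. v \<in> F 0 \<Longrightarrow> f 1 (h 0 v) k = c \<otimes> v k"
    "\<And>j v k. v \<in> F (Suc j) \<Longrightarrow> f (Suc (Suc j)) (h (Suc j) v) k \<oplus> h j (f (Suc j) v) k = c \<otimes> v k"
proof -
  \<comment> \<open>The last conjunct of \<open>P\<close> makes \<open>c\<close> minus
    \<open>h\<close> after \<open>f (Suc j)\<close> take values in the kernel of
    \<open>f (Suc j)\<close>. By exactness these values can then be lifted, which constructs the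
    next map.\<close>
  define P where "P j h \<longleftrightarrow> h \<in> mod_hom R (free_module R {..<\<beta> j}) (free_module R {..<\<beta> (Suc j)}) \<and>
    (j = 0 \<longrightarrow> (\<forall>v\<in>F 0. \<forall>k. f 1 (h v) k = c \<otimes> v k)) \<and>
    (\<forall>v\<in>F (Suc j). \<forall>k. f (Suc j) (h (f (Suc j) v)) k = c \<otimes> f (Suc j) v k)" for j h
  define Q where "Q j h h' \<longleftrightarrow>
    (\<forall>v\<in>F (Suc j). \<forall>k. f (Suc (Suc j)) (h' v) k \<oplus> h (f (Suc j) v) k = c \<otimes> v k)" for j h h'
  have "\<exists>h. \<forall>j. P j (h j) \<and> Q j (h j) (h (Suc j))"
  proof (rule dependent_nat_choice)
    have "\<exists>w\<in>F 1. (\<lambda>k. c \<otimes> v k) = f 1 w" if v: "v \<in> F 0" for v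
      using v c f0_smult[OF c v] kill[OF f0_closed[OF v]]
      by (intro exact_0) (auto intro: free_module_closed)
    then obtain h where h: "h \<in> mod_hom R (free_module R {..<\<beta> 0}) (free_module R {..<\<beta> (Suc 0)})"
      "\<And>v. v \<in> F 0 \<Longrightarrow> f (Suc 0) (h v) = (\<lambda>k. c \<otimes> v k)"
      using lift_hom[OF smult_hom[OF c finite_lessThan], of 0] by auto
    then have "P 0 h" using f_closed[of _ 0] by (auto simp: P_def)
    then show "\<exists>h. P 0 h" by blast
  next
    fix h j assume P: "P j h"
    then have h: "h \<in> mod_hom R (free_module R {..<\<beta> j}) (free_module R {..<\<beta> (Suc j)})"
      and fhf: "\<And>v k. v \<in> F (Suc j) \<Longrightarrow> f (Suc j) (h (f (Suc j) v)) k = c \<otimes> f (Suc j) v k"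
      by (auto simp: P_def)
    define T where "T v = (\<lambda>k. c \<otimes> v k \<oplus> (\<ominus> \<one>) \<otimes> h (f (Suc j) v) k)" for v
    have hf: "(\<lambda>v. h (f (Suc j) v)) \<in> mod_hom R (free_module R {..<\<beta> (Suc j)}) (free_module R {..<\<beta> (Suc j)})"
      using h f_hom[of j] by (auto simp: mod_hom_def Pi_iff)
    note hfc = free_hom_entry[OF finite_lessThan hf]
    have Tc: "T v \<in> F (Suc j)" if "v \<in> F (Suc j)" for v
      unfolding T_def using that c mod_hom_closed[OF hf that] by (intro free_module_closed) auto
    have T: "T \<in> mod_hom R (free_module R {..<\<beta> (Suc j)}) (free_module R {..<\<beta> (Suc j)})"
    proof (rule free_homI)
      show "T (\<lambda>x. v x \<oplus> w x) y = T v y \<oplus> T w y" if "v \<in> F (Suc j)" "w \<in> F (Suc j)" for v w y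
        unfolding T_def free_hom_add[OF finite_lessThan finite_lessThan hf that]
        using hfc[OF that(1)] hfc[OF that(2)] F_entry[OF that(1)] F_entry[OF that(2)] c
        by (simp add: r_distr a_ac)
      show "T (\<lambda>x. a \<otimes> v x) y = a \<otimes> T v y" if "a \<in> carrier R" "v \<in> F (Suc j)" for a v y
        unfolding T_def free_hom_smult[OF finite_lessThan finite_lessThan hf that]
        using hfc[OF that(2)] F_entry[OF that(2)] c that by (simp add: r_distr m_lcomm)
    qed (use Tc in auto)
    have "\<exists>w\<in>F (Suc (Suc j)). T v = f (Suc (Suc j)) w" if v: "v \<in> F (Suc j)" for v
    proof (rule exact[OF Tc[OF v]])
      fix k
      have "f (Suc j) (T v) k = f (Suc j) (\<lambda>k. c \<otimes> v k) k \<oplus> f (Suc j) (\<lambda>k. (\<ominus> \<one>) \<otimes> h (f (Suc j) v) k) k"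
        unfolding T_def using v c mod_hom_closed[OF hf v] by (intro f_add free_module_closed) auto
      also have "\<dots> = c \<otimes> f (Suc j) v k \<oplus> (\<ominus> \<one>) \<otimes> (c \<otimes> f (Suc j) v k)"
        using f_smult[OF c v] f_smult[OF _ mod_hom_closed[OF hf v], of "\<ominus> \<one>"] fhf[OF v] by simp
      also have "\<dots> = \<zero>" using c F_entry[OF f_closed[OF v], of k] by (simp add: l_minus r_neg)
      finally show "f (Suc j) (T v) k = \<zero>" .
    qed
    then obtain h' where h': "h' \<in> mod_hom R (free_module R {..<\<beta> (Suc j)}) (free_module R {..<\<beta> (Suc (Suc j))})"
      "\<And>v. v \<in> F (Suc j) \<Longrightarrow> f (Suc (Suc j)) (h' v) = T v"
      using lift_hom[OF T] by auto
    have cancel: "c \<otimes> v k \<oplus> (\<ominus> \<one>) \<otimes> h (f (Suc j) v) k \<oplus> h (f (Suc j) v) k = c \<otimes> v k"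
      if "v \<in> F (Suc j)" for v k
      using hfc[OF that, of k] F_entry[OF that, of k] c by (simp add: l_minus a_assoc l_neg)
    have Q: "Q j h h'" unfolding Q_def using cancel h'(2) by (auto simp: T_def)
    moreover have "P (Suc j) h'"
    proof -
      have "f (Suc (Suc j)) (h' (f (Suc (Suc j)) v)) k = c \<otimes> f (Suc (Suc j)) v k"
        if v: "v \<in> F (Suc (Suc j))" for v k
      proof -
        have "f (Suc j) (f (Suc (Suc j)) v) = (\<lambda>k. \<zero>)" using complex[OF v] by auto
        then have "T (f (Suc (Suc j)) v) k = c \<otimes> f (Suc (Suc j)) v k"
          using free_hom_zero[OF _ _ h] F_entry[OF f_closed[OF v], of k] c by (simp add: T_def)
        then show ?thesis using h'(2)[OF f_closed[OF v]] by simp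
      qed
      then show ?thesis using h'(1) by (auto simp: P_def)
    qed
    ultimately show "\<exists>h'. P (Suc j) h' \<and> Q j h h'" by blast
  qed
  then obtain h where P: "\<And>j. P j (h j)" and Q: "\<And>j. Q j (h j) (h (Suc j))" by blast
  show thesis
  proof (rule that[of h])
    show "h j \<in> mod_hom R (free_module R {..<\<beta> j}) (free_module R {..<\<beta> (Suc j)})" for j
      using P[of j] by (simp add: P_def)
    show "f 1 (h 0 v) k = c \<otimes> v k" if "v \<in> F 0" for v k
      using P[of 0] that by (simp add: P_def)
    show "f (Suc (Suc j)) (h (Suc j) v) k \<oplus> h j (f (Suc j) v) k = c \<otimes> v k" if "v \<in> F (Suc j)" for j v k
      using Q[of j] that by (simp add: Q_def)
  qed
qed

text \<open>The element is a power of some \<open>x\<close> in \<open>\<mm>\<close> outside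
  \<open>q\<close>. For each \<open>y\<close> the submodules generated by the multiples of
  \<open>y\<close> by powers of \<open>x\<close> stabilize, and Nakayama's lemma gives an exponent
  depending on \<open>y\<close>; the ascending kernels of the powers of \<open>x\<close> make it
  uniform.\<close>

lemma exists_killing_element:
  assumes q: "primeideal q R" "q \<noteq> \<mm>"
  shows "\<exists>c\<in>carrier R - q. \<forall>y\<in>carrier M. c \<odot>\<^bsub>M\<^esub> y = \<zero>\<^bsub>M\<^esub>"
proof -
  interpret q: primeideal q R by fact
  obtain x where x: "x \<in> \<mm>" "x \<notin> q" using prime_le[OF q(1)] q(2) by auto
  have xc: "x \<in> carrier R" using ideal.Icarr[OF ideal_max_ideal x(1)] .
  have pow: "(x [^] n) \<odot>\<^bsub>M\<^esub> (x \<odot>\<^bsub>M\<^esub> y) = (x [^] Suc n) \<odot>\<^bsub>M\<^esub> y" if "y \<in> carrier M" for n :: nat and y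
    using that xc by (simp add: M.smult_assoc1)
  have pow': "x \<odot>\<^bsub>M\<^esub> ((x [^] n) \<odot>\<^bsub>M\<^esub> y) = (x [^] Suc n) \<odot>\<^bsub>M\<^esub> y" if "y \<in> carrier M" for n :: nat and y
    using that xc by (simp add: M.smult_assoc1[symmetric] m_comm)
  have nil: "\<exists>n::nat. (x [^] n) \<odot>\<^bsub>M\<^esub> y = \<zero>\<^bsub>M\<^esub>" if y: "y \<in> carrier M" for y
  proof -
    define N where "N n = {r \<odot>\<^bsub>M\<^esub> ((x [^] n) \<odot>\<^bsub>M\<^esub> y) | r. r \<in> carrier R}" for n :: nat
    have "\<exists>n. N (Suc n) = N n"
    proof (rule descending_submodules_stabilize[OF finite_length])
      fix n :: nat
      have z: "(x [^] n) \<odot>\<^bsub>M\<^esub> y \<in> carrier M" using xc y by simp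
      show "submodule (N n) R M"
      proof (rule M.submoduleI)
        show "N n \<subseteq> carrier M" using z by (auto simp: N_def)
        show "\<zero>\<^bsub>M\<^esub> \<in> N n" unfolding N_def using M.smult_l_null[OF z] by (intro CollectI exI[of _ \<zero>]) auto
        show "\<ominus>\<^bsub>M\<^esub> a \<in> N n" if "a \<in> N n" for a
        proof -
          obtain r where "r \<in> carrier R" "a = r \<odot>\<^bsub>M\<^esub> ((x [^] n) \<odot>\<^bsub>M\<^esub> y)" using \<open>a \<in> N n\<close> by (auto simp: N_def)
          then show ?thesis unfolding N_def using M.smult_l_minus[OF _ z] by (intro CollectI exI[of _ "\<ominus> r"]) auto
        qed
        show "a \<oplus>\<^bsub>M\<^esub> b \<in> N n" if ab: "a \<in> N n" "b \<in> N n" for a b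
        proof -
          obtain r s where "r \<in> carrier R" "a = r \<odot>\<^bsub>M\<^esub> ((x [^] n) \<odot>\<^bsub>M\<^esub> y)"
            "s \<in> carrier R" "b = s \<odot>\<^bsub>M\<^esub> ((x [^] n) \<odot>\<^bsub>M\<^esub> y)" using ab by (auto simp: N_def)
          then show ?thesis unfolding N_def using M.smult_l_distr[OF _ _ z] by (intro CollectI exI[of _ "r \<oplus> s"]) auto
        qed
        show "a \<odot>\<^bsub>M\<^esub> b \<in> N n" if ab: "a \<in> carrier R" "b \<in> N n" for a b
        proof -
          obtain s where "s \<in> carrier R" "b = s \<odot>\<^bsub>M\<^esub> ((x [^] n) \<odot>\<^bsub>M\<^esub> y)" using ab by (auto simp: N_def)
          then show ?thesis unfolding N_def using M.smult_assoc1[OF ab(1) _ z] ab(1)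
            by (intro CollectI exI[of _ "a \<otimes> s"]) auto
        qed
      qed
      show "N (Suc n) \<subseteq> N n"
      proof
        fix b assume "b \<in> N (Suc n)"
        then obtain s where "s \<in> carrier R" "b = s \<odot>\<^bsub>M\<^esub> (x \<odot>\<^bsub>M\<^esub> ((x [^] n) \<odot>\<^bsub>M\<^esub> y))"
          unfolding pow'[OF y] by (auto simp: N_def)
        then show "b \<in> N n" unfolding N_def using M.smult_assoc1[OF _ xc z] xc
          by (intro CollectI exI[of _ "s \<otimes> x"]) auto
      qed
    qed
    then obtain n where n: "N (Suc n) = N n" by auto
    define z where "z = (x [^] n) \<odot>\<^bsub>M\<^esub> y"
    have z: "z \<in> carrier M" using xc y by (simp add: z_def)
    have "z \<in> N n" unfolding N_def z_def[symmetric] using z by (intro CollectI exI[of _ \<one>]) auto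
    then have "z \<in> N (Suc n)" using n by simp
    then obtain r where r: "r \<in> carrier R" "z = r \<odot>\<^bsub>M\<^esub> (x \<odot>\<^bsub>M\<^esub> z)"
      unfolding N_def pow'[OF y, symmetric] z_def[symmetric] by blast
    obtain s where s: "s \<in> carrier R" "s \<otimes> (\<one> \<ominus> r \<otimes> x) = \<one>"
      using one_minus_inverse[OF ideal.I_l_closed[OF ideal_max_ideal x(1) r(1)]] by auto
    have rxz: "(r \<otimes> x) \<odot>\<^bsub>M\<^esub> z = z" using r xc z by (simp add: M.smult_assoc1)
    have "(\<one> \<ominus> r \<otimes> x) \<odot>\<^bsub>M\<^esub> z = \<zero>\<^bsub>M\<^esub>"
      using r xc z rxz by (simp add: a_minus_def M.smult_l_distr M.smult_l_minus M.r_neg)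
    then have "s \<odot>\<^bsub>M\<^esub> ((\<one> \<ominus> r \<otimes> x) \<odot>\<^bsub>M\<^esub> z) = \<zero>\<^bsub>M\<^esub>" using s by simp
    then have "(s \<otimes> (\<one> \<ominus> r \<otimes> x)) \<odot>\<^bsub>M\<^esub> z = \<zero>\<^bsub>M\<^esub>"
      using M.smult_assoc1[of s "\<one> \<ominus> r \<otimes> x" z] s(1) r(1) xc z by simp
    then have "z = \<zero>\<^bsub>M\<^esub>" using s z by simp
    then show ?thesis unfolding z_def by blast
  qed
  define K where "K n = {y \<in> carrier M. (x [^] n) \<odot>\<^bsub>M\<^esub> y = \<zero>\<^bsub>M\<^esub>}" for n :: nat
  have K_Suc: "K n \<subseteq> K (Suc n)" for n
    using pow'[symmetric] xc by (auto simp: K_def simp del: nat_pow_Suc)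
  have "\<exists>n. K (Suc n) = K n"
  proof (rule ascending_submodules_stabilize[OF finite_length])
    show "K n \<subseteq> K (Suc n)" for n by (rule K_Suc)
    show "submodule (K n) R M" for n
    proof (rule M.submoduleI)
      show "a \<odot>\<^bsub>M\<^esub> b \<in> K n" if "a \<in> carrier R" "b \<in> K n" for a b
      proof -
        have b: "b \<in> carrier M" using that by (simp add: K_def)
        have "(x [^] n) \<odot>\<^bsub>M\<^esub> (a \<odot>\<^bsub>M\<^esub> b) = a \<odot>\<^bsub>M\<^esub> ((x [^] n) \<odot>\<^bsub>M\<^esub> b)"
          using b that(1) xc by (simp add: M.smult_assoc1[symmetric] m_comm)
        then show ?thesis using that by (simp add: K_def)
      qed
    qed (use xc in \<open>auto simp: K_def M.smult_r_distr M.smult_r_minus\<close>)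
  qed
  then obtain n where n: "K (Suc n) = K n" by auto
  have "K (n + m) = K n" for m
  proof (induction m)
    case (Suc m)
    have "K (n + Suc m) \<subseteq> K (Suc n)"
    proof
      fix y assume "y \<in> K (n + Suc m)"
      then have y: "y \<in> carrier M" "(x [^] Suc (n + m)) \<odot>\<^bsub>M\<^esub> y = \<zero>\<^bsub>M\<^esub>" by (auto simp: K_def)
      then have "x \<odot>\<^bsub>M\<^esub> y \<in> K (n + m)" using pow[OF y(1)] xc by (auto simp: K_def simp del: nat_pow_Suc)
      then have "x \<odot>\<^bsub>M\<^esub> y \<in> K n" using Suc by simp
      then show "y \<in> K (Suc n)" using pow[OF y(1)] y(1) by (auto simp: K_def simp del: nat_pow_Suc)
    qed
    moreover have "K n \<subseteq> K (n + k)" for k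
      using K_Suc by (induction k) auto
    ultimately show ?case using n by blast
  qed simp
  moreover have "K m \<subseteq> K (n + m)" for m
  proof -
    have "K m \<subseteq> K (k + m)" for k using K_Suc by (induction k) auto
    then show ?thesis .
  qed
  ultimately have "y \<in> K n" if "y \<in> carrier M" for y
    using nil[OF that] that K_def by blast
  moreover have "x [^] n \<notin> q"
  proof (induction n)
    case 0
    show ?case using q.one_imp_carrier q.I_notcarr by auto
  next
    case (Suc n)
    then show ?case using q.I_prime[of "x [^] n" x] xc x(2) by auto
  qed
  ultimately show ?thesis using xc by (intro bexI[of _ "x [^] n"]) (auto simp: K_def)
qed

lemma contractible_at:
  assumes "primeideal q R" "c \<in> carrier R - q" "\<forall>y\<in>carrier M. c \<odot>\<^bsub>M\<^esub> y = \<zero>\<^bsub>M\<^esub>"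
  shows "\<exists>h. contractible_complex q R \<beta> f h c"
proof -
  interpret q: primeideal q R by fact
  obtain h where h: "\<And>j. h j \<in> mod_hom R (free_module R {..<\<beta> j}) (free_module R {..<\<beta> (Suc j)})"
    "\<And>v k. v \<in> F 0 \<Longrightarrow> f 1 (h 0 v) k = c \<otimes> v k"
    "\<And>j v k. v \<in> F (Suc j) \<Longrightarrow> f (Suc (Suc j)) (h (Suc j) v) k \<oplus> h j (f (Suc j) v) k = c \<otimes> v k"
    by (rule exists_homotopy[of c]) (use assms(2,3) in auto)
  have "contractible_complex q R \<beta> f h c"
    by unfold_locales (use assms(2) f_hom h complex in auto)
  then show ?thesis by blast
qed

end

section \<open>Inequalities between Betti numbers\<close>

context finite_length_resolution
begin

text \<open>The argument of Krull's principal ideal theorem, with \<open>f 1\<close> in place of multiplication by one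
  element and the contractions to \<open>R\<close> of the ideals \<open>x^n R\<^bsub>p1\<^esub> + p0 R\<^bsub>p1\<^esub>\<close> in place of symbolic powers.
  If \<open>\<beta> 1 = \<beta> 0\<close>, then \<open>f 1\<close> is invertible at \<open>p1\<close> modulo \<open>p0\<close>, so that the stabilization of
  these ideals modulo the image of \<open>f 1\<close> lifts to their stabilization by Nakayama's lemma.\<close>

lemma betti_0_less:
  assumes p0: "primeideal p0 R" and p1: "primeideal p1 R" and p01: "p0 \<subset> p1" and p1m: "p1 \<noteq> \<mm>" and pos: "0 < \<beta> 0"
  shows "\<beta> 0 < \<beta> 1"
proof -
  interpret p0: primeideal p0 R by fact
  interpret p1: primeideal p1 R by fact
  obtain c where c: "c \<in> carrier R - p1" "\<forall>y\<in>carrier M. c \<odot>\<^bsub>M\<^esub> y = \<zero>\<^bsub>M\<^esub>"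
      using exists_killing_element[OF p1 p1m] by blast
  have c0: "c \<in> carrier R - p0" using c(1) p01 by auto
  obtain h where "contractible_complex p0 R \<beta> f h c"
    using contractible_at[OF p0 c0 c(2)] by blast
  interpret C: contractible_complex p0 R \<beta> f h c by fact
  have "\<beta> 1 \<noteq> \<beta> 0"
  proof
    assume eq: "\<beta> 1 = \<beta> 0"
    \<comment> \<open>The rank of \<open>f 2\<close> modulo \<open>p0\<close> is the difference of
      the first two Betti numbers.\<close>
    have "(\<Sum>j<2. (-1) ^ j * int (\<beta> j)) = 0" using eq by (simp add: numeral_2_eq_2)
    then have f2: "f (Suc (Suc 0)) w k \<in> p0" if "w \<in> F (Suc (Suc 0))" for w k
      using C.map_zero_iff_alternating_sum[of 2] that by (simp add: numeral_2_eq_2)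
    obtain x where x: "x \<in> p1" "x \<notin> p0" using p01 by auto
    have xc: "x \<in> carrier R" using x(1) by (rule p1.Icarr)
    define J where "J n = {y \<in> carrier R. \<exists>s\<in>carrier R - p1. \<exists>r\<in>carrier R. \<exists>z\<in>p0. s \<otimes> y = r \<otimes> x [^] n \<oplus> z}"
      for n :: nat
    have prod: "s \<otimes> t \<in> carrier R - p1" if "s \<in> carrier R - p1" "t \<in> carrier R - p1" for s t
      using that p1.I_prime by auto
    have one: "\<one> \<in> carrier R - p1" using p1.I_notcarr p1.one_imp_carrier by auto
    have p0_add: "y \<oplus> z \<in> p0" if "y \<in> p0" "z \<in> p0" for y z
      using that by (rule additive_subgroup.a_closed[OF p0.is_additive_subgroup])
    have p0_zero: "\<zero> \<in> p0" by (rule additive_subgroup.zero_closed[OF p0.is_additive_subgroup])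
    have J_mult: "a \<otimes> y \<in> J n" if a: "a \<in> carrier R" and "y \<in> J n" for a y n
    proof -
      obtain s r z where *: "s \<in> carrier R - p1" "r \<in> carrier R" "z \<in> p0" "s \<otimes> y = r \<otimes> x [^] n \<oplus> z" "y \<in> carrier R"
        using \<open>y \<in> J n\<close> by (auto simp: J_def)
      have "s \<otimes> (a \<otimes> y) = a \<otimes> (r \<otimes> x [^] n \<oplus> z)" using * a m_lcomm[of s a y] by simp
      also have "\<dots> = (a \<otimes> r) \<otimes> x [^] n \<oplus> a \<otimes> z"
        using * a xc p0.Icarr[OF *(3)] by (simp add: r_distr m_assoc)
      finally show ?thesis
        using * a p0.I_l_closed[OF *(3) a] unfolding J_def by blast
    qed
    have J_add: "y \<oplus> y' \<in> J n" if yy: "y \<in> J n" "y' \<in> J n" for y y' n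
    proof -
      obtain s r z where *: "s \<in> carrier R - p1" "r \<in> carrier R" "z \<in> p0" "s \<otimes> y = r \<otimes> x [^] n \<oplus> z" "y \<in> carrier R"
        using yy(1) by (auto simp: J_def)
      obtain s' r' z' where **: "s' \<in> carrier R - p1" "r' \<in> carrier R" "z' \<in> p0"
        "s' \<otimes> y' = r' \<otimes> x [^] n \<oplus> z'" "y' \<in> carrier R"
        using yy(2) by (auto simp: J_def)
      have zc: "z \<in> carrier R" "z' \<in> carrier R" using *(3) **(3) p0.Icarr by auto
      have "(s \<otimes> s') \<otimes> (y \<oplus> y') = s' \<otimes> (s \<otimes> y) \<oplus> s \<otimes> (s' \<otimes> y')"
        using *(1,5) **(1,5) by (simp add: r_distr m_ac)
      also have "\<dots> = s' \<otimes> (r \<otimes> x [^] n \<oplus> z) \<oplus> s \<otimes> (r' \<otimes> x [^] n \<oplus> z')" by (simp only: *(4) **(4))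
      also have "\<dots> = (s' \<otimes> r \<oplus> s \<otimes> r') \<otimes> x [^] n \<oplus> (s' \<otimes> z \<oplus> s \<otimes> z')"
        using *(1,2) **(1,2) zc xc by (simp add: r_distr l_distr m_assoc a_ac)
      finally have e: "(s \<otimes> s') \<otimes> (y \<oplus> y') = (s' \<otimes> r \<oplus> s \<otimes> r') \<otimes> x [^] n \<oplus> (s' \<otimes> z \<oplus> s \<otimes> z')" .
      have "s' \<otimes> z \<oplus> s \<otimes> z' \<in> p0" using *(1,3) **(1,3) by (intro p0_add p0.I_l_closed) auto
      moreover have "s' \<otimes> r \<oplus> s \<otimes> r' \<in> carrier R" using *(1,2) **(1,2) by auto
      ultimately show ?thesis using e prod[OF *(1) **(1)] *(5) **(5) unfolding J_def by blast
    qed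
    have p0_J: "y \<in> J n" if "y \<in> p0" for y n
    proof -
      have "\<one> \<otimes> y = \<zero> \<otimes> x [^] n \<oplus> y" using p0.Icarr[OF that] xc by simp
      then show ?thesis using one that p0.Icarr[OF that] unfolding J_def by blast
    qed
    have J_ideal: "ideal (J n) R" for n
    proof (rule idealI[OF ring_axioms])
      show "subgroup (J n) (add_monoid R)"
      proof (rule subgroup.intro)
        show "inv\<^bsub>add_monoid R\<^esub> y \<in> J n" if "y \<in> J n" for y
        proof -
          have "\<ominus> y = (\<ominus> \<one>) \<otimes> y" using that by (simp add: J_def l_minus)
          then show ?thesis using J_mult[OF _ that, of "\<ominus> \<one>"] by (simp add: a_inv_def)
        qed
      qed (use J_add p0_J[OF p0_zero] in \<open>auto simp: J_def\<close>)
      show "a \<otimes> y \<in> J n" "y \<otimes> a \<in> J n" if "y \<in> J n" "a \<in> carrier R" for a y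
        using J_mult[OF that(2,1)] that m_comm[of y a] by (auto simp: J_def)
    qed
    have J_Suc: "J (Suc n) \<subseteq> J n" for n
    proof
      fix y assume "y \<in> J (Suc n)"
      then obtain s r z where *: "s \<in> carrier R - p1" "r \<in> carrier R" "z \<in> p0" "s \<otimes> y = r \<otimes> x [^] Suc n \<oplus> z" "y \<in> carrier R"
        by (auto simp: J_def)
      have "s \<otimes> y = (r \<otimes> x) \<otimes> x [^] n \<oplus> z" using * xc p0.Icarr[OF *(3)] by (simp add: m_ac)
      moreover have "r \<otimes> x \<in> carrier R" using *(2) xc by simp
      ultimately show "y \<in> J n" using * unfolding J_def by blast
    qed
    have J_sat: "y \<in> J n" if sy: "s \<in> carrier R - p1" "y \<in> carrier R" "s \<otimes> y \<in> J n" for s y n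
    proof -
      obtain t r z where *: "t \<in> carrier R - p1" "r \<in> carrier R" "z \<in> p0" "t \<otimes> (s \<otimes> y) = r \<otimes> x [^] n \<oplus> z"
        using sy(3) by (auto simp: J_def)
      have "(t \<otimes> s) \<otimes> y = r \<otimes> x [^] n \<oplus> z" using * sy by (simp add: m_assoc)
      then show ?thesis using * prod[OF *(1) sy(1)] sy(2) unfolding J_def by blast
    qed
    \<comment> \<open>A descending chain of submodules of \<open>M\<close>. Where it stabilizes, a
      vector with entries in \<open>J n\<close> differs from one with entries in
      \<open>J (Suc n)\<close> by an element of the image of \<open>f 1\<close>.\<close>
    define N where "N n = f0 ` {v \<in> F 0. \<forall>k. v k \<in> J n}" for n
    have "\<exists>n. N (Suc n) = N n"
    proof (rule descending_submodules_stabilize[OF finite_length])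
      show "N (Suc n) \<subseteq> N n" for n using J_Suc[of n] unfolding N_def by (intro image_mono) auto
      fix n
      interpret J: ideal "J n" R by (rule J_ideal)
      have smult: "a \<odot>\<^bsub>M\<^esub> b \<in> N n" if ab: "a \<in> carrier R" "b \<in> N n" for a b
      proof -
        obtain v where v: "v \<in> F 0" "\<And>k. v k \<in> J n" "b = f0 v" using ab(2) by (auto simp: N_def)
        have "a \<odot>\<^bsub>M\<^esub> b = f0 (\<lambda>k. a \<otimes> v k)" using f0_smult[OF ab(1) v(1)] v(3) by simp
        moreover have "(\<lambda>k. a \<otimes> v k) \<in> F 0" using v(1) ab(1) by (intro free_module_closed) auto
        ultimately show ?thesis using J_mult[OF ab(1) v(2)] by (auto simp: N_def)
      qed
      have sub: "N n \<subseteq> carrier M" using f0_closed by (auto simp: N_def)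
      show "submodule (N n) R M"
      proof (rule M.submoduleI[OF sub])
        have "f0 (\<lambda>k. \<zero> \<otimes> \<zero>) = \<zero> \<odot>\<^bsub>M\<^esub> f0 (\<lambda>k. \<zero>)"
          by (rule f0_smult) (auto simp: free_module_carrier)
        then have "f0 (\<lambda>k. \<zero>) = \<zero>\<^bsub>M\<^esub>" using f0_closed[of "\<lambda>k. \<zero>"] by (simp add: free_module_carrier)
        moreover have "(\<lambda>k. \<zero>) \<in> {v \<in> F 0. \<forall>k. v k \<in> J n}"
          using p0_J[OF p0_zero] by (auto simp: free_module_carrier)
        ultimately show "\<zero>\<^bsub>M\<^esub> \<in> N n" unfolding N_def by (intro image_eqI[of _ f0 "\<lambda>k. \<zero>"]) simp_all
        show "\<ominus>\<^bsub>M\<^esub> a \<in> N n" if "a \<in> N n" for a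
          using smult[OF _ that, of "\<ominus> \<one>"] subsetD[OF sub that] M.smult_l_minus[of \<one> a] by simp
        show "a \<oplus>\<^bsub>M\<^esub> b \<in> N n" if ab: "a \<in> N n" "b \<in> N n" for a b
        proof -
          obtain v w where v: "v \<in> F 0" "\<And>k. v k \<in> J n" "a = f0 v" and w: "w \<in> F 0" "\<And>k. w k \<in> J n" "b = f0 w"
            using ab by (auto simp: N_def)
          have "a \<oplus>\<^bsub>M\<^esub> b = f0 (\<lambda>k. v k \<oplus> w k)" using f0_add[OF v(1) w(1)] v(3) w(3) by simp
          moreover have "(\<lambda>k. v k \<oplus> w k) \<in> F 0" using v(1) w(1) by (intro free_module_closed) auto
          ultimately show ?thesis using J_add[OF v(2) w(2)] by (auto simp: N_def)
        qed
      qed (rule smult)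
    qed
    then obtain n where n: "N (Suc n) = N n" by auto
    interpret J: ideal "J n" R by (rule J_ideal)
    interpret J': ideal "J (Suc n)" R by (rule J_ideal)
    \<comment> \<open>The homotopy writes \<open>c \<otimes> y k\<close> as a sum of an entry of
      \<open>f 2\<close>, which lies in \<open>p0\<close>, and an entry of \<open>h 0\<close>
      applied to \<open>f 1 y\<close>. Both are in \<open>J n\<close>, and \<open>c\<close> can be
      cancelled because \<open>J n\<close> is saturated at \<open>p1\<close>.\<close>
    have f1_J: "y k \<in> J n" if y: "y \<in> F 1" and fy: "\<And>k. f 1 y k \<in> J n" for y k
    proof -
      have y': "y \<in> F (Suc 0)" using y by simp
      have "h 0 (f (Suc 0) y) k \<in> J n"
        by (rule free_hom_mod_ideal[OF _ _ C.h f_closed[OF y'] J_ideal]) (use fy in auto)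
      moreover have "f (Suc (Suc 0)) (h (Suc 0) y) k \<in> J n"
        by (rule p0_J[OF f2[OF C.h_closed[OF y']]])
      ultimately have "c \<otimes> y k \<in> J n" unfolding C.homotopy_Suc[OF y', of k, symmetric] by (intro J_add)
      then show ?thesis using J_sat[OF c(1) F_entry[OF y']] by auto
    qed
    \<comment> \<open>Stabilization is applied to \<open>g\<close> times the first basis vector,
      which exists by \<open>pos\<close>; the claim is its coordinate 0.\<close>
    have decomp: "\<exists>w\<in>J (Suc n). \<exists>y\<in>F 1. (\<forall>k. y k \<in> J n) \<and> g = w \<oplus> f 1 y 0" if g: "g \<in> J n" for g
    proof -
      have gc: "g \<in> carrier R" using g by (rule J.Icarr)
      define v where "v = (\<lambda>k. g \<otimes> unit_vec R (0::nat) k)"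
      have v: "v \<in> F 0" unfolding v_def using gc unit_vec_F[OF pos] by (intro free_module_closed) auto
      have vJ: "v k \<in> J n" for k using gc g p0_J[OF p0_zero] by (auto simp: v_def unit_vec_def)
      have "f0 v \<in> N (Suc n)" unfolding n using v vJ by (auto simp: N_def)
      then obtain w where w: "w \<in> F 0" "\<And>k. w k \<in> J (Suc n)" "f0 v = f0 w" by (auto simp: N_def)
      define u where "u = (\<lambda>k. v k \<oplus> (\<ominus> \<one>) \<otimes> w k)"
      have w1: "(\<lambda>k. (\<ominus> \<one>) \<otimes> w k) \<in> F 0" using w(1) by (intro free_module_closed) auto
      have u: "u \<in> F 0" unfolding u_def by (rule free_module_closed(1)[OF finite_lessThan v w1])
      have "f0 u = f0 w \<oplus>\<^bsub>M\<^esub> (\<ominus> \<one>) \<odot>\<^bsub>M\<^esub> f0 w"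
        unfolding u_def using f0_add[OF v w1] f0_smult[OF _ w(1), of "\<ominus> \<one>"] w(3) by simp
      also have "\<dots> = \<zero>\<^bsub>M\<^esub>" using f0_closed[OF w(1)] M.smult_l_minus[of \<one> "f0 w"] by (simp add: M.r_neg)
      finally obtain y where y: "y \<in> F 1" "u = f 1 y" using exact_0[OF u] by auto
      have uJ: "u k \<in> J n" for k
        unfolding u_def by (rule J_add[OF vJ J_mult[OF _ subsetD[OF J_Suc w(2)]]]) simp
      have "y k \<in> J n" for k
        by (rule f1_J[OF y(1)]) (use uJ y(2) in simp)
      moreover have "g = w 0 \<oplus> u 0"
        unfolding u_def v_def using gc F_entry[OF w(1), of 0]
        by (simp add: unit_vec_def l_minus a_lcomm[of "w 0"] r_neg)
      ultimately show ?thesis unfolding y(2) using w(2) y(1) by blast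
    qed
    have "J (Suc n) = J n"
    proof (rule ccontr)
      assume "J (Suc n) \<noteq> J n"
      then have "J (Suc n) \<subset> J n" using J_Suc[of n] by auto
      from exists_subideal_containing_max_mult[OF J_ideal J_ideal this]
      obtain K where K: "ideal K R" "J (Suc n) \<subseteq> K" "K \<subset> J n"
        and mK: "\<forall>a\<in>\<mm>. \<forall>z\<in>J n. a \<otimes> z \<in> K"
        by auto
      \<comment> \<open>By minimality \<open>f 1\<close> has entries in \<open>\<mm>\<close>, so
        \<open>decomp\<close> puts \<open>J n\<close> into the sum of \<open>J (Suc n)\<close> and
        \<open>\<mm>\<close> times \<open>J n\<close>, and \<open>K\<close> contains both.\<close>
      have "J n \<subseteq> K"
      proof
        fix g assume "g \<in> J n"
        then obtain w y where *: "w \<in> J (Suc n)" "y \<in> F (Suc 0)" "\<And>k. y k \<in> J n" "g = w \<oplus> f 1 y 0"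
          using decomp[of g] by auto
        have "f 1 y 0 = (\<Oplus>k\<in>{..<\<beta> (Suc 0)}. y k \<otimes> f (Suc 0) (unit_vec R k) 0)"
          using free_hom_expand[OF _ _ f_hom *(2)] by simp
        also have "\<dots> \<in> K"
        proof (rule ideal_finsum_closed[OF K(1)])
          fix k assume "k \<in> {..<\<beta> (Suc 0)}"
          then have e: "unit_vec R k \<in> F (Suc 0)" by (intro unit_vec_F) auto
          have "f (Suc 0) (unit_vec R k) 0 \<otimes> y k \<in> K" using mK entry_mem_max[OF e] *(3) by blast
          then show "y k \<otimes> f (Suc 0) (unit_vec R k) 0 \<in> K"
            using m_comm[OF F_entry[OF *(2), of k] F_entry[OF f_closed[OF e], of 0]] by simp
        qed
        finally show "g \<in> K"
          using *(1,4) K(2) additive_subgroup.a_closed[OF ideal.axioms(1)[OF K(1)]] by auto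
      qed
      then show False using K(3) by auto
    qed
    moreover have "x [^] n \<in> J n"
    proof -
      have "\<one> \<otimes> x [^] n = \<one> \<otimes> x [^] n \<oplus> \<zero>" using xc by simp
      then show ?thesis using one p0_zero xc unfolding J_def by blast
    qed
    ultimately have "x [^] n \<in> J (Suc n)" by simp
    then obtain s r z where *: "s \<in> carrier R - p1" "r \<in> carrier R" "z \<in> p0" "s \<otimes> x [^] n = r \<otimes> x [^] Suc n \<oplus> z"
      unfolding J_def by blast
    have zc: "z \<in> carrier R" using *(3) by (rule p0.Icarr)
    \<comment> \<open>As \<open>x\<close> is not in \<open>p0\<close>, the first factor must be.
      Since \<open>x\<close> lies in \<open>p1\<close>, this puts \<open>s\<close> into
      \<open>p1\<close>, contrary to its choice.\<close>
    have "(s \<ominus> r \<otimes> x) \<otimes> x [^] n = s \<otimes> x [^] n \<ominus> r \<otimes> x [^] Suc n"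
      using *(1,2) xc by (simp add: a_minus_def l_distr l_minus m_assoc m_comm[of x "x [^] n"])
    also have "\<dots> = z"
    proof -
      define t where "t = r \<otimes> x [^] Suc n"
      have "t \<in> carrier R" using *(2) xc by (simp add: t_def)
      then show ?thesis unfolding *(4) t_def[symmetric] using zc
        by (simp add: a_minus_def a_comm[of t z] a_assoc r_neg)
    qed
    finally have "(s \<ominus> r \<otimes> x) \<otimes> x [^] n \<in> p0" using *(3) by simp
    then have "s \<ominus> r \<otimes> x \<in> p0 \<or> x [^] n \<in> p0" using p0.I_prime[of "s \<ominus> r \<otimes> x" "x [^] n"] *(1,2) xc by auto
    moreover have "x [^] m \<notin> p0" for m :: nat
    proof (induction m)
      case 0
      show ?case using p0.one_imp_carrier p0.I_notcarr by auto
    next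
      case (Suc m)
      then show ?case using p0.I_prime[of "x [^] m" x] xc x(2) by auto
    qed
    ultimately have "s \<ominus> r \<otimes> x \<in> p1" using p01 by auto
    then have "s \<ominus> r \<otimes> x \<oplus> r \<otimes> x \<in> p1"
      using p1.I_l_closed[OF x(1) *(2)] by (rule additive_subgroup.a_closed[OF p1.is_additive_subgroup])
    moreover have "s \<ominus> r \<otimes> x \<oplus> r \<otimes> x = s" using *(1,2) xc by (simp add: a_minus_def a_assoc l_neg)
    ultimately show False using *(1) by simp
  qed
  then show ?thesis using C.betti_0_le by simp
qed

lemma betti_mono_if_socle:
  assumes wr: "weakly_reduced TYPE('s) R"
    and u: "u \<in> carrier R" "u \<noteq> \<zero>" and socle: "\<And>a. a \<in> \<mm> \<Longrightarrow> a \<otimes> u = \<zero>"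
  shows "\<beta> (Suc j) \<le> \<beta> (Suc (Suc j))"
proof (rule ccontr)
  assume "\<not> ?thesis"
  then have less: "\<beta> (Suc (Suc j)) < \<beta> (Suc j)" by simp
  have "\<exists>w\<in>F (Suc (Suc j)). (\<lambda>x. u \<otimes> unit_vec R k x) = f (Suc (Suc j)) w" if "k < \<beta> (Suc j)" for k
  proof (rule exact)
    note e = unit_vec_F[OF that]
    show "(\<lambda>x. u \<otimes> unit_vec R k x) \<in> F (Suc j)" using e u(1) by (intro free_module_closed) auto
    show "f (Suc j) (\<lambda>x. u \<otimes> unit_vec R k x) l = \<zero>" for l
      unfolding f_smult[OF u(1) e]
      using socle[OF entry_mem_max[OF e, of l]] m_comm[OF u(1) F_entry[OF f_closed[OF e], of l]] by simp
  qed
  then obtain \<psi> where \<psi>: "\<And>k. k < \<beta> (Suc j) \<Longrightarrow> \<psi> k \<in> F (Suc (Suc j))"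
    "\<And>k. k < \<beta> (Suc j) \<Longrightarrow> (\<lambda>x. u \<otimes> unit_vec R k x) = f (Suc (Suc j)) (\<psi> k)" by metis
  have "u = \<zero>"
  proof (rule weakly_reduced_low_rank[OF is_cring wr u(1) less,
        of "\<lambda>i l. f (Suc (Suc j)) (unit_vec R l) i" "\<lambda>l k. \<psi> k l"])
    show "f (Suc (Suc j)) (unit_vec R l) i \<in> carrier R" if "l < \<beta> (Suc (Suc j))" for i l
      using F_entry[OF f_closed[OF unit_vec_F[OF that]]] .
    show "\<psi> k l \<in> carrier R" if "k < \<beta> (Suc j)" for l k
      using F_entry[OF \<psi>(1)[OF that]] .
    fix i k assume i: "i < \<beta> (Suc j)" and k: "k < \<beta> (Suc j)"
    have "(\<Oplus>l\<in>{..<\<beta> (Suc (Suc j))}. f (Suc (Suc j)) (unit_vec R l) i \<otimes> \<psi> k l) =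
        (\<Oplus>l\<in>{..<\<beta> (Suc (Suc j))}. \<psi> k l \<otimes> f (Suc (Suc j)) (unit_vec R l) i)"
      using F_entry[OF \<psi>(1)[OF k]] F_entry[OF f_closed[OF unit_vec_F]]
      by (intro finsum_cong') (auto simp: m_comm)
    also have "\<dots> = f (Suc (Suc j)) (\<psi> k) i"
      using free_hom_expand[OF _ _ f_hom \<psi>(1)[OF k]] by simp
    also have "\<dots> = u \<otimes> unit_vec R k i" using fun_cong[OF \<psi>(2)[OF k], of i] by simp
    finally show "(\<Oplus>l\<in>{..<\<beta> (Suc (Suc j))}. f (Suc (Suc j)) (unit_vec R l) i \<otimes> \<psi> k l) =
        (if i = k then u else \<zero>)" using u(1) by (simp add: unit_vec_def)
  qed
  then show False using u(2) by simp
qed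

text \<open>Instead of the length of the syzygy, a single prime annihilator is examined: the one
  attached to a nonzero entry of \<open>f (Suc i)\<close>. If it is not maximal, rank zero there
  kills the entry by an element outside it; if it is maximal, its witness \<open>b\<close> is the
  socle element.\<close>

lemma map_nonzero_at_prime:
  assumes wr: "weakly_reduced TYPE('s) R" and dim: "krull_dim R = enat d" "d > 1"
    and nonzero: "\<And>j. \<exists>w\<in>F (Suc j). \<exists>k. f (Suc j) w k \<noteq> \<zero>"
    and p: "primeideal p R" "p \<noteq> \<mm>"
  shows "\<exists>w\<in>F (Suc i). \<exists>k. f (Suc i) w k \<notin> p"
proof (rule ccontr)
  assume "\<not> ?thesis"
  then have fp: "\<And>w k. w \<in> F (Suc i) \<Longrightarrow> f (Suc i) w k \<in> p" by auto
  \<comment> \<open>Each prime comes with its own \<open>c\<close> and homotopy, but the numerical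
    condition is the same for all.\<close>
  have iff: "(\<forall>w\<in>F (Suc i). \<forall>k. f (Suc i) w k \<in> q) \<longleftrightarrow> (\<Sum>j<Suc i. (-1) ^ j * int (\<beta> j)) = 0"
    if qm: "primeideal q R" "q \<noteq> \<mm>" for q
  proof -
    obtain c where c: "c \<in> carrier R - q" "\<forall>y\<in>carrier M. c \<odot>\<^bsub>M\<^esub> y = \<zero>\<^bsub>M\<^esub>"
      using exists_killing_element[OF qm] by blast
    obtain h where "contractible_complex q R \<beta> f h c"
      using contractible_at[OF qm(1) c] by blast
    then interpret C: contractible_complex q R \<beta> f h c .
    show ?thesis by (rule C.map_zero_iff_alternating_sum) simp
  qed
  have sum: "(\<Sum>j<Suc i. (-1) ^ j * int (\<beta> j)) = 0" using iff[OF p] fp by blast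
  obtain w k where w: "w \<in> F (Suc i)" and a: "f (Suc i) w k \<noteq> \<zero>" using nonzero[of i] by auto
  define a where "a = f (Suc i) w k"
  have ac: "a \<in> carrier R" unfolding a_def by (rule F_entry[OF f_closed[OF w]])
  have a0: "a \<noteq> \<zero>" using a by (simp add: a_def)
  obtain b where b: "b \<in> carrier R" "b \<noteq> \<zero>" and q: "primeideal {x \<in> carrier R. x \<otimes> b = \<zero>} R"
    and ab: "\<forall>x\<in>carrier R. x \<otimes> a = \<zero> \<longrightarrow> x \<otimes> b = \<zero>"
    using exists_prime_annihilator[OF is_cring ac a0] by blast
  define q where "q = {x \<in> carrier R. x \<otimes> b = \<zero>}"
  note q = q[folded q_def]
  have "q = \<mm>"
  proof (rule ccontr)
    assume qm: "q \<noteq> \<mm>"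
    obtain c where c: "c \<in> carrier R - q" "\<forall>y\<in>carrier M. c \<odot>\<^bsub>M\<^esub> y = \<zero>\<^bsub>M\<^esub>"
      using exists_killing_element[OF q qm] by blast
    obtain h where "contractible_complex q R \<beta> f h c"
      using contractible_at[OF q c] by blast
    then interpret C: contractible_complex q R \<beta> f h c .
    have fq: "\<forall>w\<in>F (Suc i). \<forall>k. f (Suc i) w k \<in> q" using iff[OF q qm] sum by simp
    obtain t where t: "t \<in> carrier R - q" "\<forall>k. t \<otimes> f (Suc i) w k = \<zero>"
      using C.annihilator_if_map_zero[OF fq[rule_format] w] by blast
    have "t \<otimes> a = \<zero>" using t(2) unfolding a_def by (rule spec)
    then have "t \<otimes> b = \<zero>" using ab t(1) by blast
    then have "t \<in> q" using t(1) unfolding q_def by blast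
    then show False using t(1) by blast
  qed
  have socle: "x \<otimes> b = \<zero>" if "x \<in> \<mm>" for x
  proof -
    have "x \<in> q" using that \<open>q = \<mm>\<close> by simp
    then show ?thesis by (simp add: q_def)
  qed
  \<comment> \<open>A chain of three primes makes the middle one nonmaximal and strictly larger than
    another prime, as \<open>betti_0_less\<close> requires.\<close>
  have "1 < krull_dim R" using dim by (simp add: one_enat_def)
  then obtain n \<pp> where n: "1 < n" and \<pp>: "\<forall>i\<le>n. \<pp> i \<in> prime_spectrum R" "\<forall>i<n. \<pp> i \<subset> \<pp> (Suc i)"
    unfolding krull_dim_def less_Sup_iff by (auto simp: one_enat_def)
  have p01: "primeideal (\<pp> 0) R" "primeideal (\<pp> 1) R" "primeideal (\<pp> 2) R" "\<pp> 0 \<subset> \<pp> 1" "\<pp> 1 \<subset> \<pp> 2"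
    using n spec[OF \<pp>(1), of 0] spec[OF \<pp>(1), of 1] spec[OF \<pp>(1), of 2] spec[OF \<pp>(2), of 0] spec[OF \<pp>(2), of 1]
    by (simp_all add: prime_spectrum_def numeral_2_eq_2)
  have "\<pp> 1 \<noteq> \<mm>" using p01(5) prime_le[OF p01(3)] by auto
  have pos: "0 < \<beta> 0"
  proof (rule ccontr)
    assume "\<not> 0 < \<beta> 0"
    then have "f (Suc 0) w k = \<zero>" if "w \<in> F (Suc 0)" for w k
      using f_closed[OF that] by (simp add: free_module_carrier)
    then show False using nonzero[of 0] by auto
  qed
  have "(\<Sum>j<Suc i. (-1) ^ j * int (\<beta> j)) \<noteq> 0"
    using pos betti_0_less[OF p01(1,2,4) \<open>\<pp> 1 \<noteq> \<mm>\<close> pos] betti_mono_if_socle[OF wr b socle]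
    by (intro alternating_sum_nonzero) auto
  then show False using sum by simp
qed

section \<open>Finite projective dimension from a vanishing map\<close>

lemma free_module_projective:
  assumes "\<one> \<noteq> \<zero>"
  shows "projective_module R (free_module R {..<n::nat})"
proof -
  \<comment> \<open>The definition of projectivity indexes bases by the element type of the module,
    so the index \<open>k\<close> is encoded by the \<open>k\<close>-th unit vector. Distinct
    indices stay distinct because \<open>\<one> \<noteq> \<zero>\<close>.\<close>
  define B where "B = (unit_vec R :: nat \<Rightarrow> nat \<Rightarrow> 'a) ` {..<n}"
  have fin: "finite B" by (simp add: B_def)
  have inj: "unit_vec R i = unit_vec R j \<longleftrightarrow> i = j" for i j :: nat
    using assms by (auto simp: unit_vec_def fun_eq_iff)
  define \<iota> where "\<iota> v b = (if b \<in> B then v (the_inv (unit_vec R) b) else \<zero>)" for v :: "nat \<Rightarrow> 'a" and b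
  define \<pi> where "\<pi> w k = (if k < n then w (unit_vec R k) else \<zero>)" for w :: "(nat \<Rightarrow> 'a) \<Rightarrow> 'a" and k :: nat
  have ti: "the_inv (unit_vec R) (unit_vec R k) = k" for k :: nat
    using inj by (intro the_inv_f_f) (auto simp: inj_def)
  have "\<iota> \<in> mod_hom R (free_module R {..<n}) (free_module R B)"
    using fin by (intro free_homI) (auto simp: free_module_carrier \<iota>_def free_module_entry B_def ti)
  moreover have "\<pi> \<in> mod_hom R (free_module R B) (free_module R {..<n})"
    using fin by (intro free_homI) (auto simp: free_module_carrier \<pi>_def B_def)
  moreover have "\<pi> (\<iota> v) = v" if "v \<in> carrier (free_module R {..<n})" for v
    using that by (auto simp: \<pi>_def \<iota>_def B_def ti free_module_carrier fun_eq_iff)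
  ultimately show ?thesis
    unfolding projective_module_def using free_module_is_module[of "{..<n}"] by blast
qed

lemma proj_dim_le_if_map_zero:
  assumes zero: "\<And>w k. w \<in> F (Suc i) \<Longrightarrow> f (Suc i) w k = \<zero>"
  shows "proj_dim R M \<le> enat i"
proof -
  have "\<one> \<noteq> \<zero>"
  proof
    assume "\<one> = \<zero>"
    then have "\<one> \<in> \<mm>" using additive_subgroup.zero_closed[OF ideal.axioms(1)[OF ideal_max_ideal]] by simp
    then have "carrier R = \<mm>" using ideal.one_imp_carrier[OF ideal_max_ideal] by simp
    then show False using maximalideal.I_notcarr[OF maximalideal_max_ideal] by simp
  qed
  \<comment> \<open>The resolution is cut off after degree \<open>i\<close>. Resolutions are indexed
    by all natural numbers, so rank zero fills the remaining degrees.\<close>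
  define \<gamma> where "\<gamma> j = (if j \<le> i then \<beta> j else 0)" for j
  define P where "P j = free_module R {..<\<gamma> j}" for j
  define g where "g j = (if j \<le> i then f j else (\<lambda>v k. \<zero>))" for j
  have P_le: "P j = free_module R {..<\<beta> j}" if "j \<le> i" for j using that by (simp add: P_def \<gamma>_def)
  have P_gt: "carrier (P j) = {\<lambda>k. \<zero>}" if "\<not> j \<le> i" for j
    using that by (auto simp: P_def \<gamma>_def free_module_carrier)
  have Pz: "(\<lambda>k. \<zero>) \<in> carrier (P j)" for j by (auto simp: P_def free_module_carrier)
  have Pzero: "\<zero>\<^bsub>P j\<^esub> = (\<lambda>k. \<zero>)" for j by (simp add: P_def free_module_zero)
  have gz: "g (Suc j) (\<lambda>k. \<zero>) = (\<lambda>k. \<zero>)" for j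
    using free_hom_zero[OF _ _ f_hom[of j]] by (auto simp: g_def)
  have g_hom: "g (Suc j) \<in> mod_hom R (P (Suc j)) (P j)" for j
  proof (cases "Suc j \<le> i")
    case True
    then show ?thesis using f_hom[of j] by (simp add: P_le g_def)
  next
    case False
    then have "g (Suc j) = (\<lambda>v k. \<zero>)" by (simp add: g_def)
    then show ?thesis unfolding P_def by (auto intro!: free_homI simp: free_module_carrier)
  qed
  have gS: "g (Suc j) ` carrier (P (Suc j)) = (if j < i then f (Suc j) ` F (Suc j) else {\<lambda>k. \<zero>})" for j
  proof (cases "j < i")
    case True
    then show ?thesis by (simp add: P_le g_def)
  next
    case False
    then have "\<not> Suc j \<le> i" by simp
    then show ?thesis using False by (simp add: P_gt gz)
  qed
  have f_im: "f (Suc i) ` F (Suc i) = {\<lambda>k. \<zero>}"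
  proof -
    have "f (Suc i) w = (\<lambda>k. \<zero>)" if "w \<in> F (Suc i)" for w using zero[OF that] by auto
    moreover have "(\<lambda>k. \<zero>) \<in> F (Suc i)" by (auto simp: free_module_carrier)
    ultimately show ?thesis by (auto simp: image_iff intro!: bexI[of _ "\<lambda>k. \<zero>"])
  qed
  have "projective_resolution_upto R M i P g f0"
    unfolding projective_resolution_upto_def
  proof (intro conjI allI impI)
    show "projective_module R (P j)" for j
      unfolding P_def by (rule free_module_projective) fact
    show "carrier (P j) = {\<zero>\<^bsub>P j\<^esub>}" if "i < j" for j using P_gt[of j] that by (simp add: Pzero)
    show "f0 \<in> mod_hom R (P 0) M" "f0 ` carrier (P 0) = carrier M"
      using f0_hom f0_surj by (simp_all add: P_le)
    show "g (Suc j) \<in> mod_hom R (P (Suc j)) (P j)" for j by (rule g_hom)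
    \<comment> \<open>For \<open>i = 0\<close> it is already \<open>f 1\<close> that vanishes, so
      that \<open>f0\<close> is injective.\<close>
    show "g 1 ` carrier (P 1) = a_kernel (P 0) M f0"
      using gS[of 0] f_1_image f_im by (cases "0 < i") (auto simp: P_le a_kernel_def')
    show "g (Suc (Suc j)) ` carrier (P (Suc (Suc j))) = a_kernel (P (Suc j)) (P j) (g (Suc j))" for j
    proof -
      consider "Suc j < i" | "Suc j = i" | "i < Suc j" by linarith
      then show ?thesis
      proof cases
        case 1
        then show ?thesis using gS[of "Suc j"] f_image[of j] by (simp add: P_le g_def a_kernel_def' free_module_zero)
      next
        case 2
        then show ?thesis using gS[of "Suc j"] f_image[of j] f_im
          by (simp add: P_le g_def a_kernel_def' free_module_zero)
      next
        case 3
        then show ?thesis using gS[of "Suc j"] P_gt[of "Suc j"] gz[of j]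
          by (auto simp: a_kernel_def' Pzero)
      qed
    qed
  qed
  then show ?thesis unfolding proj_dim_def by (intro Inf_lower) blast
qed

section \<open>Cosets in the syzygy modules and the support\<close>

lemma syzygy_smult:
  assumes a: "a \<in> carrier R" and w: "w \<in> F i"
  defines "N \<equiv> f (Suc i) ` F (Suc i)" and "L \<equiv> free_module R {..<\<beta> i}"
  shows "a \<odot>\<^bsub>syzygy R \<beta> f i\<^esub> (N +>\<^bsub>L\<^esub> w) = N +>\<^bsub>L\<^esub> (\<lambda>k. a \<otimes> w k)"
    and "N +>\<^bsub>L\<^esub> w \<in> carrier (syzygy R \<beta> f i)"
    and "N +>\<^bsub>L\<^esub> w = N \<Longrightarrow> w \<in> N"
    and "N +>\<^bsub>L\<^esub> (\<lambda>k. \<zero>) = N"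
proof -
  interpret L: module R L unfolding L_def by (rule free_module_is_module) simp
  have Lc: "carrier L = F i" by (simp add: L_def)
  have N_smult: "(\<lambda>k. b \<otimes> v k) \<in> N" if b: "b \<in> carrier R" and vN: "v \<in> N" for b v
  proof -
    obtain u where u: "u \<in> F (Suc i)" "v = f (Suc i) u" using vN by (auto simp: N_def)
    have "(\<lambda>k. b \<otimes> v k) = f (Suc i) (\<lambda>k. b \<otimes> u k)" using f_smult[OF b u(1)] u(2) by auto
    moreover have "(\<lambda>k. b \<otimes> u k) \<in> F (Suc i)" using u b by (intro free_module_closed) auto
    ultimately show ?thesis by (auto simp: N_def)
  qed
  have N_add: "(\<lambda>k. v k \<oplus> v' k) \<in> N" if v: "v \<in> N" "v' \<in> N" for v v'
  proof -
    obtain u u' where u: "u \<in> F (Suc i)" "v = f (Suc i) u" "u' \<in> F (Suc i)" "v' = f (Suc i) u'"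
      using v by (auto simp: N_def)
    have "(\<lambda>k. v k \<oplus> v' k) = f (Suc i) (\<lambda>k. u k \<oplus> u' k)" using f_add[OF u(1,3)] u by auto
    moreover have "(\<lambda>k. u k \<oplus> u' k) \<in> F (Suc i)" using u by (intro free_module_closed) auto
    ultimately show ?thesis by (auto simp: N_def)
  qed
  have N_zero: "(\<lambda>k. \<zero>) \<in> N"
  proof -
    have "(\<lambda>k. \<zero>) \<in> F (Suc i)" by (auto simp: free_module_carrier)
    moreover have "f (Suc i) (\<lambda>k. \<zero>) = (\<lambda>k. \<zero>)" using free_hom_zero[OF _ _ f_hom[of i]] by auto
    ultimately show ?thesis unfolding N_def by (intro image_eqI[of _ "f (Suc i)" "\<lambda>k. \<zero>"]) simp_all
  qed
  have N_sub: "N \<subseteq> carrier L" using f_closed by (auto simp: N_def L_def)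
  have "submodule N R L"
  proof (rule L.submoduleI[OF N_sub])
    show "\<ominus>\<^bsub>L\<^esub> v \<in> N" if "v \<in> N" for v
    proof -
      have v: "v \<in> carrier L" using N_sub that by auto
      have "\<ominus>\<^bsub>L\<^esub> v = (\<ominus> \<one>) \<odot>\<^bsub>L\<^esub> v" using L.smult_l_minus[of \<one> v] v by simp
      also have "\<dots> = (\<lambda>k. (\<ominus> \<one>) \<otimes> v k)" using v unfolding L_def by (intro free_module_smult) auto
      finally show ?thesis using N_smult[OF _ that, of "\<ominus> \<one>"] by simp
    qed
    show "b \<odot>\<^bsub>L\<^esub> v \<in> N" if "b \<in> carrier R" "v \<in> N" for b v
      using N_smult[OF that] free_module_smult[of "{..<\<beta> i}" v b] that N_sub by (auto simp: L_def)
  qed (use N_add N_zero in \<open>auto simp: L_def free_module_add free_module_zero\<close>)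
  then have N_subgroup: "subgroup N (add_monoid L)" by (rule submodule.axioms(1))
  have aw: "(\<lambda>k. a \<otimes> w k) \<in> carrier L" using a w unfolding L_def by (intro free_module_closed) auto
  \<comment> \<open>The scalar action on a coset is a union over its representatives; each of them
    contributes the same coset.\<close>
  have coset: "N +>\<^bsub>L\<^esub> (a \<odot>\<^bsub>L\<^esub> v) = N +>\<^bsub>L\<^esub> (\<lambda>k. a \<otimes> w k)" if vN: "v \<in> N +>\<^bsub>L\<^esub> w" for v
  proof -
    obtain n where n: "n \<in> N" "v = n \<oplus>\<^bsub>L\<^esub> w" using vN by (auto simp: a_r_coset_def')
    have nc: "n \<in> carrier L" using n(1) N_sub by auto
    have "a \<odot>\<^bsub>L\<^esub> v = a \<odot>\<^bsub>L\<^esub> n \<oplus>\<^bsub>L\<^esub> a \<odot>\<^bsub>L\<^esub> w"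
      using n(2) nc w a Lc by (simp add: L.smult_r_distr)
    also have "\<dots> = (\<lambda>k. a \<otimes> n k) \<oplus>\<^bsub>L\<^esub> (\<lambda>k. a \<otimes> w k)"
      using free_module_smult[of "{..<\<beta> i}" n a] free_module_smult[of "{..<\<beta> i}" w a] nc w a by (simp add: L_def)
    finally have "a \<odot>\<^bsub>L\<^esub> v \<in> N +>\<^bsub>L\<^esub> (\<lambda>k. a \<otimes> w k)" using N_smult[OF a n(1)] by (auto simp: a_r_coset_def')
    then show ?thesis using L.a_repr_independence[OF _ aw N_subgroup] by simp
  qed
  have self: "w \<in> N +>\<^bsub>L\<^esub> w" using N_zero w L.l_zero[of w] Lc
    by (auto simp: a_r_coset_def' L_def free_module_zero intro!: bexI[of _ "\<lambda>k. \<zero>"])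
  have "(\<Union>v\<in>N +>\<^bsub>L\<^esub> w. N +>\<^bsub>L\<^esub> (a \<odot>\<^bsub>L\<^esub> v)) = N +>\<^bsub>L\<^esub> (\<lambda>k. a \<otimes> w k)"
    using coset self by blast
  then show "a \<odot>\<^bsub>syzygy R \<beta> f i\<^esub> (N +>\<^bsub>L\<^esub> w) = N +>\<^bsub>L\<^esub> (\<lambda>k. a \<otimes> w k)"
    by (simp add: syzygy_def quotient_module_def N_def L_def)
  show "N +>\<^bsub>L\<^esub> w \<in> carrier (syzygy R \<beta> f i)"
    using w Lc by (auto simp: syzygy_def quotient_module_def N_def L_def A_RCOSETS_def')
  show "N +>\<^bsub>L\<^esub> w = N \<Longrightarrow> w \<in> N" using L.a_coset_join1[OF _ _ N_subgroup] w Lc by auto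
  show "N +>\<^bsub>L\<^esub> (\<lambda>k. \<zero>) = N" using L.a_coset_join2[OF _ N_subgroup N_zero] N_zero N_sub by auto
qed

text \<open>In positive degree, exactness turns the cokernel into an image. If the class of
  \<open>w\<close> vanishes in the localization, some \<open>s\<close> outside \<open>p\<close>
  moves \<open>w\<close> into the image of the next map, which is the kernel of
  \<open>f (Suc i)\<close>. The choice of \<open>s\<close> depends on \<open>w\<close>, and the
  theorem applies this to one vector at a time.\<close>

lemma map_killed_if_not_in_support:
  assumes p: "primeideal p R" "p \<notin> module_support R (syzygy R \<beta> f (Suc i))" and w: "w \<in> F (Suc i)"
  shows "\<exists>s\<in>carrier R - p. \<forall>k. s \<otimes> f (Suc i) w k = \<zero>"
proof -
  interpret p: primeideal p R by fact
  define K where "K = syzygy R \<beta> f (Suc i)"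
  define T where "T = carrier R - p"
  define N where "N = f (Suc (Suc i)) ` F (Suc (Suc i))"
  define L where "L = free_module R {..<\<beta> (Suc i)}"
  define x where "x = N +>\<^bsub>L\<^esub> w"
  have smult: "a \<odot>\<^bsub>K\<^esub> (N +>\<^bsub>L\<^esub> v) = N +>\<^bsub>L\<^esub> (\<lambda>k. a \<otimes> v k)" if "a \<in> carrier R" "v \<in> F (Suc i)" for a v
    unfolding K_def N_def L_def by (rule syzygy_smult(1)[OF that])
  have one: "\<one> \<in> T" unfolding T_def using p.one_imp_carrier p.I_notcarr by auto
  have z: "(\<lambda>k. \<zero>) \<in> F (Suc i)" by (auto simp: free_module_carrier)
  have K_zero: "\<zero>\<^bsub>K\<^esub> = N" by (simp add: K_def syzygy_def quotient_module_def N_def)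
  note N_eq = syzygy_smult(4)[OF one_closed z, folded N_def L_def]
  have xK: "x \<in> carrier K" unfolding x_def K_def N_def L_def by (rule syzygy_smult(2)[OF one_closed w])
  have "carrier (localization R T K) = {\<zero>\<^bsub>localization R T K\<^esub>}"
    using p by (auto simp: module_support_def prime_spectrum_def K_def T_def)
  moreover have "fraction T K x \<one> \<in> carrier (localization R T K)"
    using xK one by (auto simp: localization_def fraction_def quotient_def)
  ultimately have "fraction T K x \<one> = fraction T K N \<one>"
    by (simp add: localization_def K_zero)
  moreover have "(x, \<one>) \<in> fraction T K x \<one>"
    using xK one by (auto simp: fraction_def fraction_rel_def)
  ultimately have "(x, \<one>) \<in> fraction T K N \<one>" by simp
  then obtain s where s: "s \<in> T" "s \<odot>\<^bsub>K\<^esub> (\<one> \<odot>\<^bsub>K\<^esub> N) = s \<odot>\<^bsub>K\<^esub> (\<one> \<odot>\<^bsub>K\<^esub> x)"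
    by (auto simp: fraction_def fraction_rel_def)
  have sc: "s \<in> carrier R" using s(1) by (simp add: T_def)
  have wsimp: "(\<lambda>k. \<one> \<otimes> w k) = w" using F_entry[OF w] by auto
  have "s \<odot>\<^bsub>K\<^esub> (\<one> \<odot>\<^bsub>K\<^esub> x) = N +>\<^bsub>L\<^esub> (\<lambda>k. s \<otimes> w k)"
    unfolding x_def using smult[OF one_closed w] smult[OF sc w] wsimp by simp
  moreover have "s \<odot>\<^bsub>K\<^esub> (\<one> \<odot>\<^bsub>K\<^esub> N) = N"
    using smult[OF one_closed z] smult[OF sc z] sc by (simp add: N_eq)
  ultimately have eq: "N +>\<^bsub>L\<^esub> (\<lambda>k. s \<otimes> w k) = N" using s(2) by simp
  have sw: "(\<lambda>k. s \<otimes> w k) \<in> F (Suc i)" using w sc by (intro free_module_closed) auto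
  have "(\<lambda>k. s \<otimes> w k) \<in> N"
    using syzygy_smult(3)[OF one_closed sw] eq by (simp add: N_def L_def)
  then have "f (Suc i) (\<lambda>k. s \<otimes> w k) = (\<lambda>k. \<zero>)" unfolding N_def f_image by simp
  then have "s \<otimes> f (Suc i) w k = \<zero>" for k using f_smult[OF sc w, of k] by simp
  then show ?thesis using s(1) by (auto simp: T_def)
qed

end

theorem corollary1p4:
  fixes R :: "('a, 'k) ring_scheme"
    and M :: "('a, 'b, 'l) module_scheme"
    and d :: nat
    and \<beta> :: "nat \<Rightarrow> nat"
    and f :: "nat \<Rightarrow> (nat \<Rightarrow> 'a) \<Rightarrow> (nat \<Rightarrow> 'a)"
    and f0 :: "(nat \<Rightarrow> 'a) \<Rightarrow> 'b"
  assumes "noetherian_local_ring R"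
    and "weakly_reduced TYPE('s) R"
    and "krull_dim R = enat d" and "d > 1"
    and "module R M"
    and "module_length R M < \<infinity>"
    and "proj_dim R M = \<infinity>"
    and "minimal_free_resolution R M \<beta> f f0"
  shows "\<forall>i>0. module_support R (syzygy R \<beta> f i) = prime_spectrum R"
proof (intro allI impI)
  interpret noetherian_local_cring R using assms(1) by (rule noetherian_local_cringI)
  interpret finite_length_resolution R M \<beta> f f0
    by (intro finite_length_resolution.intro noetherian_local_cring_axioms
        finite_length_resolution_axioms.intro assms)
  \<comment> \<open>Infinite projective dimension forbids cutting off the resolution in any
    degree.\<close>
  have nonzero: "\<exists>w\<in>F (Suc j). \<exists>k. f (Suc j) w k \<noteq> \<zero>\<^bsub>R\<^esub>" for j
    using proj_dim_le_if_map_zero[of j] assms(7) by auto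
  fix i :: nat assume "i > 0"
  then obtain i' where i: "i = Suc i'" by (cases i) auto
  have "p \<in> module_support R (syzygy R \<beta> f i)" if "p \<in> prime_spectrum R" for p
  proof (rule ccontr)
    assume "p \<notin> module_support R (syzygy R \<beta> f i)"
    moreover have p: "primeideal p R" using that by (simp add: prime_spectrum_def)
    ultimately have killed: "\<exists>s\<in>carrier R - p. \<forall>k. s \<otimes>\<^bsub>R\<^esub> f (Suc i') w k = \<zero>\<^bsub>R\<^esub>" if "w \<in> F (Suc i')" for w
      using map_killed_if_not_in_support[OF p _ that] i by simp
    interpret p: primeideal p R by fact
    show False
    proof (cases "p = \<mm>")
      case False
      obtain w k where w: "w \<in> F (Suc i')" "f (Suc i') w k \<notin> p"
        using map_nonzero_at_prime[OF assms(2-4) nonzero p False] by blast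
      obtain s where s: "s \<in> carrier R - p" "s \<otimes>\<^bsub>R\<^esub> f (Suc i') w k = \<zero>\<^bsub>R\<^esub>" using killed[OF w(1)] by blast
      have "\<zero>\<^bsub>R\<^esub> \<in> p" by (rule additive_subgroup.zero_closed[OF p.is_additive_subgroup])
      then show False using p.I_prime[of s "f (Suc i') w k"] s w F_entry[OF f_closed[OF w(1)], of k] by auto
    next
      case True
      obtain w k where w: "w \<in> F (Suc i')" "f (Suc i') w k \<noteq> \<zero>\<^bsub>R\<^esub>" using nonzero by blast
      obtain s where s: "s \<in> carrier R - p" "s \<otimes>\<^bsub>R\<^esub> f (Suc i') w k = \<zero>\<^bsub>R\<^esub>" using killed[OF w(1)] by blast
      \<comment> \<open>Outside the maximal ideal \<open>s\<close> is a unit, so it cannot kill a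
        nonzero entry.\<close>
      obtain t where t: "t \<in> carrier R" "t \<otimes>\<^bsub>R\<^esub> s = \<one>\<^bsub>R\<^esub>" using exists_inverse[of s] s(1) True by auto
      have ac: "f (Suc i') w k \<in> carrier R" by (rule F_entry[OF f_closed[OF w(1)]])
      have "f (Suc i') w k = t \<otimes>\<^bsub>R\<^esub> s \<otimes>\<^bsub>R\<^esub> f (Suc i') w k" using t(2) ac by simp
      also have "\<dots> = t \<otimes>\<^bsub>R\<^esub> (s \<otimes>\<^bsub>R\<^esub> f (Suc i') w k)" using s(1) t(1) ac by (intro m_assoc) auto
      finally show False using s(2) t(1) w(2) by simp
    qed
  qed
  then show "module_support R (syzygy R \<beta> f i) = prime_spectrum R"
    by (auto simp: module_support_def)
qed

end
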